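(* Let $H$ be a Hopf algebra over a field $\mathbb{K}$. The finite dimensional algebras of the form $V\otimes V^*$, for finite dimensional right $H$-comodules $V$, form a system of cogenerators in the category $fdAlg(\mathcal{M}^H)$ of finite dimensional algebras in $\mathcal{M}^H$ (and also in $Alg(\mathcal{M}^H)$). The coalgebras $V^*\otimes V$, for finite dimensional right $H$-comodules $V$, form a system of generators of the category $CoAlg(\mathcal{M}^H)$ of right $H$-comodule coalgebras.
   Context: $\mathcal{M}^H$ is the monoidal category of right $H$-comodules (tensor product $\otimes_{\mathbb{K}}$ with coaction $v\otimes w\mapsto v_0\otimes w_0\otimes v_1w_1$, unit object $\mathbb{K}$). $Alg(\mathcal{M}^H)$ and $CoAlg(\mathcal{M}^H)$ are the categories of (associative unital) algebras and (coassociative counital) coalgebras in $\mathcal{M}^H$; $fdAlg(\mathcal{M}^H)$ is the full subcategory of finite dimensional algebras. For a finite dimensional right $H$-comodule $V$, the dual space $V^*$ is a right $H$-comodule via the antipode $S$, with coaction determined by $f_0(v)f_1=f(v_0)S(v_1)$ for $f\in V^*$, $v\in V$; it is the right dual of $V$, with $H$-comodule maps $ev_V:V^*\otimes V\to\mathbb{K}$, $ev_V(v^*\otimes v)=v^*(v)$, and $co_V:\mathbb{K}\to V\otimes V^*$, $co_V(1)=\sum_iv_i\otimes v_i^*$ for dual bases $(v_i),(v_i^* )$. Then $V\otimes V^*$ is an algebra in $\mathcal{M}^H$ with multiplication $1_V\otimes ev_V\otimes1_{V^*}$ and unit $co_V$, and $V^*\otimes V$ is a coalgebra in $\mathcal{M}^H$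 with comultiplication $1_{V^*}\otimes co_V\otimes1_V$ and counit $ev_V$. A system of generators is a class of objects such that for any two distinct parallel morphisms $u\neq v:X\to Y$ there are an object $G$ in the class and $h:G\to X$ with $uh\neq vh$; cogenerators are defined dually (there is $h:Y\to G$ with $hu\neq hv$).
   Formalization: The claim "and also in Alg(M^H)" is false for infinite dimensional targets (K[x] → K(t), x ↦ t or 0, trivial coaction); it is stated for parallel morphisms X → Y in Alg(M^H) with X arbitrary and Y finite dimensional. *)

theory Defs
  imports Complex_Main "HOL-Library.Function_Algebras"
begin

section \<open>Vector spaces and linear maps\<close>

text \<open>
  A vector space over the field \<open>'k\<close> is a subspace \<open>carrier V\<close> of an ambient type that is itself a
  vector space under \<open>smult V\<close>; carriers are needed because tensor products and duals are carved
  out of function types. Morphisms only matter on carriers. Every finite dimensional space is isomorphic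
  to one inside the type \<open>nat \<Rightarrow> 'k\<close>, so that type suffices for existential statements about
  finite dimensional comodules.
\<close>

record ('k, 'a) vspace =
  carrier :: "'a set"
  smult :: "'k \<Rightarrow> 'a \<Rightarrow> 'a"

definition vspace :: "('k::field, 'a::ab_group_add, 'z) vspace_scheme \<Rightarrow> bool" where
  "vspace V \<longleftrightarrow> vector_space (smult V) \<and> module.subspace (smult V) (carrier V)"

definition fin_dim :: "('k::field, 'a::ab_group_add, 'z) vspace_scheme \<Rightarrow> bool" where
  "fin_dim V \<longleftrightarrow> (\<exists>B. finite B \<and> module.span (smult V) B = carrier V)"

definition basis :: "('k::field, 'a::ab_group_add, 'z) vspace_scheme \<Rightarrow> 'a set \<Rightarrow> bool" where
  "basis V B \<longleftrightarrow> \<not> module.dependent (smult V) B \<and> module.span (smult V) B = carrier V"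

definition linear_map ::
  "('k::field, 'a::ab_group_add, 'z) vspace_scheme \<Rightarrow> ('k, 'b::ab_group_add, 'w) vspace_scheme
    \<Rightarrow> ('a \<Rightarrow> 'b) \<Rightarrow> bool" where
  "linear_map V W f \<longleftrightarrow>
     (\<forall>x \<in> carrier V. f x \<in> carrier W) \<and>
     (\<forall>x \<in> carrier V. \<forall>y \<in> carrier V. f (x + y) = f x + f y) \<and>
     (\<forall>c. \<forall>x \<in> carrier V. f (smult V c x) = smult W c (f x))"

definition bilinear_map ::
  "('k::field, 'a::ab_group_add, 'z) vspace_scheme \<Rightarrow> ('k, 'b::ab_group_add, 'w) vspace_scheme
    \<Rightarrow> ('k, 'c::ab_group_add, 'u) vspace_scheme \<Rightarrow> ('a \<Rightarrow> 'b \<Rightarrow> 'c) \<Rightarrow> bool" where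
  "bilinear_map V W U B \<longleftrightarrow>
     (\<forall>v \<in> carrier V. linear_map W U (B v)) \<and> (\<forall>w \<in> carrier W. linear_map V U (\<lambda>v. B v w))"

definition ground :: "('k::field, 'k) vspace" where
  "ground = \<lparr>carrier = UNIV, smult = (*)\<rparr>"

text \<open>Scalar multiplication of \<open>'k\<close>-valued functions (their addition is pointwise as well).\<close>

definition fscale :: "'k::field \<Rightarrow> ('i \<Rightarrow> 'k) \<Rightarrow> 'i \<Rightarrow> 'k" where
  "fscale c f = (\<lambda>i. c * f i)"


section \<open>Tensor products over the ground field\<close>

text \<open>
  The tensor product \<open>V \<otimes> W\<close> is realised inside the dual of the space of bilinear forms on
  \<open>V \<times> W\<close>: the tensor \<open>v \<otimes> w\<close> is evaluation at \<open>(v, w)\<close>, and \<open>V \<otimes> W\<close> is the span of these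
  tensors. (Functionals are normalised to be \<open>0\<close> at arguments that are not bilinear forms.)
  Over a field this has the universal property of the tensor product; see \<open>tensor_universal\<close>.
  Since a tensor \<open>t\<close> satisfies \<open>t \<beta> = \<Sum>\<^sub>i \<beta> v\<^sub>i w\<^sub>i\<close> whenever \<open>t = \<Sum>\<^sub>i v\<^sub>i \<otimes> w\<^sub>i\<close>, linear maps defined on
  pure tensors have closed formulas; they are written out below.
\<close>

type_synonym ('k, 'a, 'b) tensor = "('a \<Rightarrow> 'b \<Rightarrow> 'k) \<Rightarrow> 'k"

definition functional_on ::
  "('k::field, 'a::ab_group_add, 'z) vspace_scheme \<Rightarrow> ('k, 'b::ab_group_add, 'w) vspace_scheme
    \<Rightarrow> ('k, 'a, 'b) tensor \<Rightarrow> ('k, 'a, 'b) tensor" where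
  "functional_on V W t = (\<lambda>\<beta>. if bilinear_map V W ground \<beta> then t \<beta> else 0)"

definition pure ::
  "('k::field, 'a::ab_group_add, 'z) vspace_scheme \<Rightarrow> ('k, 'b::ab_group_add, 'w) vspace_scheme
    \<Rightarrow> 'a \<Rightarrow> 'b \<Rightarrow> ('k, 'a, 'b) tensor" where
  "pure V W v w = functional_on V W (\<lambda>\<beta>. \<beta> v w)"

definition tensor ::
  "('k::field, 'a::ab_group_add, 'z) vspace_scheme \<Rightarrow> ('k, 'b::ab_group_add, 'w) vspace_scheme
    \<Rightarrow> ('k, ('k, 'a, 'b) tensor) vspace" (infixr \<open>\<otimes>\<close> 70) where
  "V \<otimes> W =
     \<lparr>carrier = module.span fscale {pure V W v w | v w. v \<in> carrier V \<and> w \<in> carrier W},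
      smult = fscale\<rparr>"

lemma vector_space_fscale: "vector_space (fscale :: 'k::field \<Rightarrow> ('i \<Rightarrow> 'k) \<Rightarrow> 'i \<Rightarrow> 'k)"
  by unfold_locales (auto simp: fscale_def fun_eq_iff algebra_simps)

lemma vector_space_mult: "vector_space ((*) :: 'k::field \<Rightarrow> 'k \<Rightarrow> 'k)"
  by unfold_locales (auto simp: algebra_simps)

lemma vspace_tensor:
  fixes V :: "('k::field, 'a::ab_group_add, 'z) vspace_scheme"
    and W :: "('k, 'b::ab_group_add, 'w) vspace_scheme"
  shows "vspace (V \<otimes> W)"
proof -
  interpret T: vector_space "fscale :: 'k \<Rightarrow> ('k, 'a, 'b) tensor \<Rightarrow> ('k, 'a, 'b) tensor"
    by (rule vector_space_fscale)
  show ?thesis by (simp add: vspace_def tensor_def T.vector_space_axioms)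
qed

lemma pure_apply: "bilinear_map V W ground \<beta> \<Longrightarrow> pure V W v w \<beta> = \<beta> v w"
  by (simp add: pure_def functional_on_def)

lemma linear_map_span_eq:
  assumes f: "linear_map V W f" and g: "linear_map V W g" and V: "vspace V" and W: "vspace W"
    and S: "carrier V = module.span (smult V) S" and eq: "\<And>x. x \<in> S \<Longrightarrow> f x = g x"
    and x: "x \<in> carrier V"
  shows "f x = g x"
proof -
  interpret V: vector_space "smult V" using V by (simp add: vspace_def)
  interpret W: vector_space "smult W" using W by (simp add: vspace_def)
  have sub: "V.subspace (carrier V)" using V by (simp add: vspace_def)
  have zero: "h 0 = 0" if "linear_map V W h" for h
    using that V.subspace_0[OF sub] unfolding linear_map_def
    by (metis V.scale_zero_left W.scale_zero_left)
  have "x \<in> carrier V \<and> f x = g x"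
  proof (rule V.span_induct_alt[of x S])
    show "x \<in> V.span S" using x S by simp
    show "0 \<in> carrier V \<and> f 0 = g 0" using zero[OF f] zero[OF g] V.subspace_0[OF sub] by simp
    fix c x y assume xS: "x \<in> S" and y: "y \<in> carrier V \<and> f y = g y"
    have xV: "x \<in> carrier V" using xS S V.span_base by simp
    have cx: "smult V c x \<in> carrier V" using xV sub V.subspace_scale by blast
    have cy: "smult V c x + y \<in> carrier V" using cx y sub V.subspace_add by blast
    have lin: "h (smult V c x + y) = smult W c (h x) + h y" if "linear_map V W h" for h
      using that xV cx y unfolding linear_map_def by simp
    then show "smult V c x + y \<in> carrier V \<and> f (smult V c x + y) = g (smult V c x + y)"
      using y eq[OF xS] cy lin[OF f] lin[OF g] by simp
  qed
  then show ?thesis ..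
qed

theorem tensor_universal:
  fixes V :: "('k::field, 'a::ab_group_add, 'z) vspace_scheme"
    and W :: "('k, 'b::ab_group_add, 'w) vspace_scheme"
    and U :: "('k, 'c::ab_group_add, 'u) vspace_scheme"
  assumes U: "vspace U" and B: "bilinear_map V W U B"
  shows "\<exists>f. linear_map (V \<otimes> W) U f \<and>
      (\<forall>v \<in> carrier V. \<forall>w \<in> carrier W. f (pure V W v w) = B v w) \<and>
      (\<forall>g. linear_map (V \<otimes> W) U g \<and>
           (\<forall>v \<in> carrier V. \<forall>w \<in> carrier W. g (pure V W v w) = B v w) \<longrightarrow>
         (\<forall>t \<in> carrier (V \<otimes> W). g t = f t))"
proof -
  interpret T: vector_space "fscale :: 'k \<Rightarrow> ('k, 'a, 'b) tensor \<Rightarrow> ('k, 'a, 'b) tensor"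
    by (rule vector_space_fscale)
  interpret U: vector_space "smult U" using U by (simp add: vspace_def)
  interpret K: vector_space "(*) :: 'k \<Rightarrow> 'k \<Rightarrow> 'k" by (rule vector_space_mult)
  interpret TU: vector_space_pair "fscale :: 'k \<Rightarrow> ('k, 'a, 'b) tensor \<Rightarrow> ('k, 'a, 'b) tensor" "smult U" ..
  interpret UK: vector_space_pair "smult U" "(*) :: 'k \<Rightarrow> 'k \<Rightarrow> 'k" ..
  interpret TK: vector_space_pair "fscale :: 'k \<Rightarrow> ('k, 'a, 'b) tensor \<Rightarrow> ('k, 'a, 'b) tensor"
    "(*) :: 'k \<Rightarrow> 'k \<Rightarrow> 'k" ..
  have subU: "U.subspace (carrier U)" using U by (simp add: vspace_def)
  let ?P = "{pure V W v w | v w. v \<in> carrier V \<and> w \<in> carrier W}"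
  have car: "carrier (V \<otimes> W) = T.span ?P" and sm: "smult (V \<otimes> W) = fscale"
    by (simp_all add: tensor_def)
  obtain S where S: "S \<subseteq> ?P" "T.independent S" "?P \<subseteq> T.span S"
    using T.maximal_independent_subset by blast
  have spanS: "T.span S = T.span ?P"
    using S T.span_mono[of S ?P] T.span_minimal[OF S(3)] by blast
  have "\<exists>p. fst p \<in> carrier V \<and> snd p \<in> carrier W \<and> s = pure V W (fst p) (snd p)" if "s \<in> S" for s
    using S(1) that by fastforce
  then obtain p where p: "\<And>s. s \<in> S \<Longrightarrow> fst (p s) \<in> carrier V \<and> snd (p s) \<in> carrier W \<and>
      s = pure V W (fst (p s)) (snd (p s))" by metis
  obtain f where f: "Vector_Spaces.linear fscale (smult U) f"
    and fS: "\<And>s. s \<in> S \<Longrightarrow> f s = B (fst (p s)) (snd (p s))"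
    using TU.linear_independent_extend[OF S(2), of "\<lambda>s. B (fst (p s)) (snd (p s))"] by blast
  interpret f: Vector_Spaces.linear fscale "smult U" f by (rule f)
  have Bin: "B v w \<in> carrier U" if "v \<in> carrier V" "w \<in> carrier W" for v w
    using B that by (auto simp: bilinear_map_def linear_map_def)
  have fin: "f t \<in> carrier U" if "t \<in> carrier (V \<otimes> W)" for t
  proof -
    have "f ` S \<subseteq> carrier U" using fS p Bin by auto
    then have "U.span (f ` S) \<subseteq> carrier U" using subU by (rule U.span_minimal)
    then show ?thesis using that f.span_image[of S] car spanS by auto
  qed
  have pureB: "f (pure V W v w) = B v w" if v: "v \<in> carrier V" and w: "w \<in> carrier W" for v w
  proof (rule ccontr)
    assume ne: "f (pure V W v w) \<noteq> B v w"
    define d where "d = f (pure V W v w) - B v w"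
    have "U.independent {d}" using ne by (simp add: d_def)
    then obtain \<phi> where \<phi>: "Vector_Spaces.linear (smult U) (*) \<phi>" and \<phi>d: "\<phi> d = 1"
      using UK.linear_independent_extend[of "{d}" "\<lambda>_. 1"] by auto
    interpret \<phi>: Vector_Spaces.linear "smult U" "(*)" \<phi> by (rule \<phi>)
    let ?\<beta> = "\<lambda>v w. \<phi> (B v w)"
    have bil: "bilinear_map V W ground ?\<beta>"
      using B by (auto simp: bilinear_map_def linear_map_def ground_def \<phi>.add \<phi>.scale)
    have "Vector_Spaces.linear fscale (*) (\<lambda>t. \<phi> (f t))"
      by (simp add: Vector_Spaces.linear_iff vector_space_fscale vector_space_mult
          f.add f.scale \<phi>.add \<phi>.scale)
    moreover have "Vector_Spaces.linear fscale (*) (\<lambda>t. t ?\<beta>)"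
      by (simp add: Vector_Spaces.linear_iff vector_space_fscale vector_space_mult fscale_def)
    moreover have "\<phi> (f s) = s ?\<beta>" if "s \<in> S" for s
      using p[OF that] fS[OF that] pure_apply[OF bil] by metis
    moreover have "pure V W v w \<in> T.span S" using S(3) v w by auto
    ultimately have "\<phi> (f (pure V W v w)) = pure V W v w ?\<beta>"
      by (rule TK.linear_eq_on_span)
    then have "\<phi> d = 0" by (simp add: d_def \<phi>.diff pure_apply[OF bil])
    then show False using \<phi>d by simp
  qed
  have lin: "linear_map (V \<otimes> W) U f"
    using fin by (auto simp: linear_map_def sm f.add f.scale)
  have "g t = f t" if g: "linear_map (V \<otimes> W) U g"
    and gB: "\<forall>v \<in> carrier V. \<forall>w \<in> carrier W. g (pure V W v w) = B v w"
    and t: "t \<in> carrier (V \<otimes> W)" for g t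
  proof (rule linear_map_span_eq[OF g lin vspace_tensor U _ _ t])
    show "carrier (V \<otimes> W) = module.span (smult (V \<otimes> W)) ?P" using car sm by simp
    show "g x = f x" if "x \<in> ?P" for x using that gB pureB by auto
  qed
  then show ?thesis using lin pureB by blast
qed

text \<open>\<open>tmap V' W' f g\<close> is \<open>f \<otimes> g\<close>, with values in \<open>V' \<otimes> W'\<close>.\<close>

definition tmap ::
  "('k::field, 'c::ab_group_add, 'z) vspace_scheme \<Rightarrow> ('k, 'd::ab_group_add, 'w) vspace_scheme
    \<Rightarrow> ('a \<Rightarrow> 'c) \<Rightarrow> ('b \<Rightarrow> 'd) \<Rightarrow> ('k, 'a, 'b) tensor \<Rightarrow> ('k, 'c, 'd) tensor" where
  "tmap V' W' f g t = functional_on V' W' (\<lambda>\<beta>. t (\<lambda>v w. \<beta> (f v) (g w)))"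

text \<open>\<open>(u \<otimes> v) \<otimes> w \<mapsto> u \<otimes> (v \<otimes> w)\<close>\<close>

definition assoc ::
  "('k::field, 'a::ab_group_add, 'z) vspace_scheme \<Rightarrow> ('k, 'b::ab_group_add, 'w) vspace_scheme
    \<Rightarrow> ('k, 'c::ab_group_add, 'u) vspace_scheme
    \<Rightarrow> ('k, ('k, 'a, 'b) tensor, 'c) tensor \<Rightarrow> ('k, 'a, ('k, 'b, 'c) tensor) tensor" where
  "assoc U V W t = functional_on U (V \<otimes> W) (\<lambda>\<beta>. t (\<lambda>s w. s (\<lambda>u v. \<beta> u (pure V W v w))))"

text \<open>\<open>(v \<otimes> a) \<otimes> (w \<otimes> b) \<mapsto> (v \<otimes> w) \<otimes> (a \<otimes> b)\<close>\<close>

definition interchange ::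
  "('k::field, 'a::ab_group_add, 'z) vspace_scheme \<Rightarrow> ('k, 'b::ab_group_add, 'w) vspace_scheme
    \<Rightarrow> ('k, 'c::ab_group_add, 'u) vspace_scheme \<Rightarrow> ('k, 'd::ab_group_add, 'y) vspace_scheme
    \<Rightarrow> ('k, ('k, 'a, 'b) tensor, ('k, 'c, 'd) tensor) tensor
    \<Rightarrow> ('k, ('k, 'a, 'c) tensor, ('k, 'b, 'd) tensor) tensor" where
  "interchange V A W B t = functional_on (V \<otimes> W) (A \<otimes> B)
     (\<lambda>\<beta>. t (\<lambda>x y. x (\<lambda>v a. y (\<lambda>w b. \<beta> (pure V W v w) (pure A B a b)))))"


section \<open>Algebras, coalgebras and Hopf algebras\<close>

text \<open>
  Multiplications are linear maps out of the tensor square. The equations \<open>1 a = a = a 1\<close> and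
  \<open>(\<epsilon> \<otimes> id) (\<Delta> c) = 1 \<otimes> c\<close>, \<open>(id \<otimes> \<epsilon>) (\<Delta> c) = c \<otimes> 1\<close> are the unit and counit laws.
\<close>

definition algebra ::
  "('k::field, 'a::ab_group_add, 'z) vspace_scheme
    \<Rightarrow> (('k, 'a, 'a) tensor \<Rightarrow> 'a) \<Rightarrow> ('k \<Rightarrow> 'a) \<Rightarrow> bool" where
  "algebra A \<mu> \<eta> \<longleftrightarrow>
     vspace A \<and> linear_map (A \<otimes> A) A \<mu> \<and> linear_map ground A \<eta> \<and>
     (\<forall>t \<in> carrier ((A \<otimes> A) \<otimes> A). \<mu> (tmap A A \<mu> id t) = \<mu> (tmap A A id \<mu> (assoc A A A t))) \<and>
     (\<forall>a \<in> carrier A. \<mu> (pure A A (\<eta> 1) a) = a \<and> \<mu> (pure A A a (\<eta> 1)) = a)"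

definition coalgebra ::
  "('k::field, 'a::ab_group_add, 'z) vspace_scheme
    \<Rightarrow> ('a \<Rightarrow> ('k, 'a, 'a) tensor) \<Rightarrow> ('a \<Rightarrow> 'k) \<Rightarrow> bool" where
  "coalgebra C \<Delta> \<epsilon> \<longleftrightarrow>
     vspace C \<and> linear_map C (C \<otimes> C) \<Delta> \<and> linear_map C ground \<epsilon> \<and>
     (\<forall>c \<in> carrier C.
        assoc C C C (tmap (C \<otimes> C) C \<Delta> id (\<Delta> c)) = tmap C (C \<otimes> C) id \<Delta> (\<Delta> c)) \<and>
     (\<forall>c \<in> carrier C.
        tmap ground C \<epsilon> id (\<Delta> c) = pure ground C 1 c \<and>
        tmap C ground id \<epsilon> (\<Delta> c) = pure C ground c 1)"

record ('k, 'h) hopf = "('k, 'h) vspace" +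
  hmult :: "('k, 'h, 'h) tensor \<Rightarrow> 'h"
  hunit :: "'k \<Rightarrow> 'h"
  hcomult :: "'h \<Rightarrow> ('k, 'h, 'h) tensor"
  hcounit :: "'h \<Rightarrow> 'k"
  antipode :: "'h \<Rightarrow> 'h"

text \<open>
  Comultiplication and counit are algebra maps, for the algebra structure
  \<open>(a \<otimes> b) (c \<otimes> d) = a c \<otimes> b d\<close> on \<open>H \<otimes> H\<close>. The antipode is not assumed to be bijective.
\<close>

definition hopf_algebra :: "('k::field, 'h::ab_group_add) hopf \<Rightarrow> bool" where
  "hopf_algebra H \<longleftrightarrow>
     algebra H (hmult H) (hunit H) \<and>
     coalgebra H (hcomult H) (hcounit H) \<and>
     (\<forall>t \<in> carrier (H \<otimes> H). hcomult H (hmult H t) =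
        tmap H H (hmult H) (hmult H)
          (interchange H H H H (tmap (H \<otimes> H) (H \<otimes> H) (hcomult H) (hcomult H) t))) \<and>
     hcomult H (hunit H 1) = pure H H (hunit H 1) (hunit H 1) \<and>
     (\<forall>a \<in> carrier H. \<forall>b \<in> carrier H.
        hcounit H (hmult H (pure H H a b)) = hcounit H a * hcounit H b) \<and>
     hcounit H (hunit H 1) = 1 \<and>
     linear_map H H (antipode H) \<and>
     (\<forall>h \<in> carrier H.
        hmult H (tmap H H (antipode H) id (hcomult H h)) = hunit H (hcounit H h) \<and>
        hmult H (tmap H H id (antipode H) (hcomult H h)) = hunit H (hcounit H h))"


section \<open>The monoidal category of right comodules\<close>

record ('k, 'a, 'h) comod = "('k, 'a) vspace" +
  coact :: "'a \<Rightarrow> ('k, 'a, 'h) tensor"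

definition comodule ::
  "('k::field, 'h::ab_group_add) hopf \<Rightarrow> ('k, 'a::ab_group_add, 'h, 'z) comod_scheme \<Rightarrow> bool" where
  "comodule H V \<longleftrightarrow>
     vspace V \<and> linear_map V (V \<otimes> H) (coact V) \<and>
     (\<forall>v \<in> carrier V.
        assoc V H H (tmap (V \<otimes> H) H (coact V) id (coact V v))
          = tmap V (H \<otimes> H) id (hcomult H) (coact V v)) \<and>
     (\<forall>v \<in> carrier V. tmap V ground id (hcounit H) (coact V v) = pure V ground v 1)"

definition comodule_map ::
  "('k::field, 'h::ab_group_add) hopf \<Rightarrow> ('k, 'a::ab_group_add, 'h, 'z) comod_scheme
    \<Rightarrow> ('k, 'b::ab_group_add, 'h, 'w) comod_scheme \<Rightarrow> ('a \<Rightarrow> 'b) \<Rightarrow> bool" where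
  "comodule_map H V W f \<longleftrightarrow>
     linear_map V W f \<and> (\<forall>v \<in> carrier V. coact W (f v) = tmap W H f id (coact V v))"

definition unit_comod :: "('k::field, 'h::ab_group_add) hopf \<Rightarrow> ('k, 'k, 'h) comod" where
  "unit_comod H =
     \<lparr>carrier = carrier ground, smult = smult ground, coact = (\<lambda>c. pure ground H c (hunit H 1))\<rparr>"

definition tensor_comod ::
  "('k::field, 'h::ab_group_add) hopf \<Rightarrow> ('k, 'a::ab_group_add, 'h, 'z) comod_scheme
    \<Rightarrow> ('k, 'b::ab_group_add, 'h, 'w) comod_scheme \<Rightarrow> ('k, ('k, 'a, 'b) tensor, 'h) comod" where
  "tensor_comod H V W =
     \<lparr>carrier = carrier (V \<otimes> W), smult = smult (V \<otimes> W),
      coact = (\<lambda>t. tmap (V \<otimes> W) H id (hmult H)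
        (interchange V H W H (tmap (V \<otimes> H) (W \<otimes> H) (coact V) (coact W) t)))\<rparr>"


section \<open>Algebras and coalgebras in the category of comodules\<close>

record ('k, 'a, 'h) comod_alg = "('k, 'a, 'h) comod" +
  amult :: "('k, 'a, 'a) tensor \<Rightarrow> 'a"
  aunit :: "'k \<Rightarrow> 'a"

record ('k, 'a, 'h) comod_coalg = "('k, 'a, 'h) comod" +
  ccomult :: "'a \<Rightarrow> ('k, 'a, 'a) tensor"
  ccounit :: "'a \<Rightarrow> 'k"

definition comodule_algebra ::
  "('k::field, 'h::ab_group_add) hopf \<Rightarrow> ('k, 'a::ab_group_add, 'h) comod_alg \<Rightarrow> bool" where
  "comodule_algebra H A \<longleftrightarrow>
     comodule H A \<and> algebra A (amult A) (aunit A) \<and>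
     comodule_map H (tensor_comod H A A) A (amult A) \<and>
     comodule_map H (unit_comod H) A (aunit A)"

definition comodule_coalgebra ::
  "('k::field, 'h::ab_group_add) hopf \<Rightarrow> ('k, 'a::ab_group_add, 'h) comod_coalg \<Rightarrow> bool" where
  "comodule_coalgebra H C \<longleftrightarrow>
     comodule H C \<and> coalgebra C (ccomult C) (ccounit C) \<and>
     comodule_map H C (tensor_comod H C C) (ccomult C) \<and>
     comodule_map H C (unit_comod H) (ccounit C)"

definition comodule_algebra_map ::
  "('k::field, 'h::ab_group_add) hopf \<Rightarrow> ('k, 'a::ab_group_add, 'h) comod_alg
    \<Rightarrow> ('k, 'b::ab_group_add, 'h) comod_alg \<Rightarrow> ('a \<Rightarrow> 'b) \<Rightarrow> bool" where
  "comodule_algebra_map H A B f \<longleftrightarrow>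
     comodule_map H A B f \<and>
     (\<forall>t \<in> carrier (A \<otimes> A). f (amult A t) = amult B (tmap B B f f t)) \<and>
     f (aunit A 1) = aunit B 1"

definition comodule_coalgebra_map ::
  "('k::field, 'h::ab_group_add) hopf \<Rightarrow> ('k, 'a::ab_group_add, 'h) comod_coalg
    \<Rightarrow> ('k, 'b::ab_group_add, 'h) comod_coalg \<Rightarrow> ('a \<Rightarrow> 'b) \<Rightarrow> bool" where
  "comodule_coalgebra_map H C D f \<longleftrightarrow>
     comodule_map H C D f \<and>
     (\<forall>c \<in> carrier C. ccomult D (f c) = tmap D D f f (ccomult C c)) \<and>
     (\<forall>c \<in> carrier C. ccounit D (f c) = ccounit C c)"


section \<open>Duals\<close>

text \<open>
  Functionals are extended by \<open>0\<close> outside the carrier so that they are determined by their values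
  on it. The coaction of the dual is pinned down by \<open>f\<^sub>0(v) f\<^sub>1 = f(v\<^sub>0) S(v\<^sub>1)\<close>, read in
  \<open>\<bbbK> \<otimes> H\<close> as \<open>f\<^sub>0(v) \<otimes> f\<^sub>1 = f(v\<^sub>0) \<otimes> S(v\<^sub>1)\<close>.
\<close>

definition dual_space :: "('k::field, 'a::ab_group_add, 'z) vspace_scheme \<Rightarrow> ('k, 'a \<Rightarrow> 'k) vspace"
  where
  "dual_space V =
     \<lparr>carrier = {f. linear_map V ground f \<and> (\<forall>x. x \<notin> carrier V \<longrightarrow> f x = 0)}, smult = fscale\<rparr>"

definition dual_comod ::
  "('k::field, 'h::ab_group_add) hopf \<Rightarrow> ('k, 'a::ab_group_add, 'h, 'z) comod_scheme
    \<Rightarrow> ('k, 'a \<Rightarrow> 'k, 'h) comod" where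
  "dual_comod H V =
     \<lparr>carrier = carrier (dual_space V), smult = smult (dual_space V),
      coact = (\<lambda>f. THE t. t \<in> carrier (dual_space V \<otimes> H) \<and>
        (\<forall>v \<in> carrier V.
           tmap ground H (\<lambda>g. g v) id t = tmap ground H f (antipode H) (coact V v)))\<rparr>"

text \<open>
  \<open>coev V\<close> is \<open>\<Sum>\<^sub>i v\<^sub>i \<otimes> v\<^sub>i\<^sup>*\<close> for a (finite) basis of \<open>V\<close>; the coefficient functional
  \<open>\<lambda>x. representation B x b\<close> is \<open>0\<close> outside the span of \<open>B\<close>.
\<close>

definition coev :: "('k::field, 'a::ab_group_add, 'z) vspace_scheme \<Rightarrow> ('k, 'a, 'a \<Rightarrow> 'k) tensor"
  where
  "coev V = (let B = (SOME B. basis V B)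
     in \<Sum>b\<in>B. pure V (dual_space V) b (\<lambda>x. module.representation (smult V) B x b))"

text \<open>
  \<open>V \<otimes> V\<^sup>*\<close> with \<open>(v \<otimes> f) (w \<otimes> g) = f(w) (v \<otimes> g)\<close>, i.e. multiplication \<open>1 \<otimes> ev \<otimes> 1\<close>, and unit
  \<open>coev\<close>.
\<close>

definition end_alg ::
  "('k::field, 'h::ab_group_add) hopf \<Rightarrow> ('k, 'a::ab_group_add, 'h) comod
    \<Rightarrow> ('k, ('k, 'a, 'a \<Rightarrow> 'k) tensor, 'h) comod_alg" where
  "end_alg H V = (let T = tensor_comod H V (dual_comod H V) in
     \<lparr>carrier = carrier T, smult = smult T, coact = coact T,
      amult = (\<lambda>t. functional_on V (dual_space V)
        (\<lambda>\<beta>. t (\<lambda>x y. x (\<lambda>v f. y (\<lambda>w g. f w * \<beta> v g))))),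
      aunit = (\<lambda>c. fscale c (coev V))\<rparr>)"

text \<open>
  \<open>V\<^sup>* \<otimes> V\<close> with \<open>\<Delta> (f \<otimes> v) = \<Sum>\<^sub>i (f \<otimes> v\<^sub>i) \<otimes> (v\<^sub>i\<^sup>* \<otimes> v)\<close>, i.e. comultiplication \<open>1 \<otimes> coev \<otimes> 1\<close>,
  and counit \<open>ev\<close>.
\<close>

definition coend_coalg ::
  "('k::field, 'h::ab_group_add) hopf \<Rightarrow> ('k, 'a::ab_group_add, 'h) comod
    \<Rightarrow> ('k, ('k, 'a \<Rightarrow> 'k, 'a) tensor, 'h) comod_coalg" where
  "coend_coalg H V = (let T = tensor_comod H (dual_comod H V) V in
     \<lparr>carrier = carrier T, smult = smult T, coact = coact T,
      ccomult = (\<lambda>t. functional_on (dual_space V \<otimes> V) (dual_space V \<otimes> V)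
        (\<lambda>\<beta>. t (\<lambda>f v. coev V (\<lambda>w g.
           \<beta> (pure (dual_space V) V f w) (pure (dual_space V) V g v))))),
      ccounit = (\<lambda>t. t (\<lambda>f v. f v))\<rparr>)"

end

theory Submission
  imports Defs
begin

text \<open>
  In terms of a basis \<open>e\<^sub>i\<close>, a finite dimensional comodule \<open>V\<close> is a matrix \<open>c\<close> over \<open>H\<close> with
  \<open>\<Delta> c\<^sub>i\<^sub>j = \<Sum>\<^sub>k c\<^sub>i\<^sub>k \<otimes> c\<^sub>k\<^sub>j\<close> and \<open>\<epsilon> c\<^sub>i\<^sub>j = \<delta>\<^sub>i\<^sub>j\<close>. The matrix \<open>(S c\<^sub>i\<^sub>j)\<close> is its inverse and its transpose
  is the matrix of \<open>V\<^sup>*\<close>, so the axioms for \<open>V \<otimes> V\<^sup>*\<close> and \<open>V\<^sup>* \<otimes> V\<close> become matrix identities.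

  A finite dimensional algebra \<open>Y\<close> embeds into \<open>Y \<otimes> Y\<^sup>*\<close> by left multiplication,
  \<open>a \<mapsto> \<Sum>\<^sub>j a y\<^sub>j \<otimes> y\<^sub>j\<^sup>*\<close>. An element \<open>x\<close> of a coalgebra \<open>X\<close> lies in a finite dimensional subspace \<open>V\<close>
  that is both a subcomodule and a right coideal. If \<open>\<Delta> e\<^sub>j = \<Sum>\<^sub>i e\<^sub>i \<otimes> d\<^sub>i\<^sub>j\<close> then \<open>e\<^sub>i\<^sup>* \<otimes> e\<^sub>j \<mapsto> d\<^sub>i\<^sub>j\<close> is a
  morphism \<open>V\<^sup>* \<otimes> V \<rightarrow> X\<close> whose image contains \<open>V\<close>. Using right rather than left coideals is what
  makes the argument work without an inverse of the antipode.
\<close>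

section \<open>Linear algebra on carriers\<close>

text \<open>Tensors are functionals on bilinear forms, so identities between them are checked on
  pure tensors or on a basis and extended by linearity. Finite families come with biorthogonal
  functionals, and contraction with these extracts coefficients.

  Why right coideals: colinearity of \<Delta> at \<open>e j\<close>, contracted with the functional
  dual to \<open>e p\<close>, equates the sum over i of \<open>c p i\<close> times the coaction of
  \<open>d i j\<close> with the sum over q of \<open>d p q\<close> \<otimes> \<open>c q j\<close>.
  Here \<open>c\<close> multiplies the factor in \<open>H\<close> from the left, so its left inverse
  S(c) removes it, and what remains is exactly the coaction on V^* \<otimes> V. For left coideals
  \<open>c\<close> would stand on the right with transposed indices, and only the inverse of S could
  remove it. The embedding of an algebra is governed by order in the same way: left multiplication
  brings \<open>c\<close> and S(c) next to each other.

  Both constructions give more than separation: one injective map for each finite dimensional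
  algebra, and for each element of a coalgebra a map whose image contains it. The comodule V is
  rebuilt on K^n, because its type is fixed while that of the given object is arbitrary.\<close>

lemma vspace_module: "vspace V \<Longrightarrow> module (smult V)"
  by (simp add: vspace_def vector_space_def module_def)

lemma vspace_zero: "vspace V \<Longrightarrow> 0 \<in> carrier V"
  using module.subspace_0[OF vspace_module] by (auto simp: vspace_def)

lemma vspace_add: "vspace V \<Longrightarrow> x \<in> carrier V \<Longrightarrow> y \<in> carrier V \<Longrightarrow> x + y \<in> carrier V"
  using module.subspace_add[OF vspace_module] by (auto simp: vspace_def)

lemma vspace_scale: "vspace V \<Longrightarrow> x \<in> carrier V \<Longrightarrow> smult V c x \<in> carrier V"
  using module.subspace_scale[OF vspace_module] by (auto simp: vspace_def)

lemma vspace_sum: "vspace V \<Longrightarrow> (\<And>i. i \<in> I \<Longrightarrow> x i \<in> carrier V) \<Longrightarrow> sum x I \<in> carrier V"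
  by (meson vspace_module vspace_def module.subspace_sum)

lemma vspace_smult_simps:
  assumes "vspace V"
  shows "smult V 0 x = 0" and "smult V c 0 = 0" and "smult V 1 x = x"
    and "smult V a (smult V b x) = smult V (a * b) x"
  using vspace_module[OF assms]
  by (simp_all add: module.scale_zero_left module.scale_zero_right module.scale_one
      module.scale_scale)

lemma vspace_smult_distrib:
  assumes "vspace V"
  shows "smult V c (x + y) = smult V c x + smult V c y"
    and "smult V (a + b) x = smult V a x + smult V b x"
    and "smult V c (\<Sum>i\<in>I. f i) = (\<Sum>i\<in>I. smult V c (f i))"
    and "smult V (\<Sum>i\<in>I. g i) x = (\<Sum>i\<in>I. smult V (g i) x)"
  using vspace_module[OF assms]
  by (simp_all add: module.scale_right_distrib module.scale_left_distrib module.scale_sum_left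
      module.scale_sum_right)

lemma ground_simps [simp]: "carrier ground = UNIV" "smult ground = (*)"
  by (simp_all add: ground_def)

lemma vspace_ground: "vspace (ground :: ('k::field, 'k) vspace)"
proof -
  interpret vector_space "(*) :: 'k \<Rightarrow> 'k \<Rightarrow> 'k" by (rule vector_space_mult)
  show ?thesis by (simp add: vspace_def vector_space_mult subspace_UNIV)
qed

lemma smult_delta:
  assumes "vspace V"
  shows "smult V (if P then 1 else 0) x = (if P then x else 0)"
  using vspace_smult_simps[OF assms] by simp

lemma linear_mapI:
  assumes "\<And>x. x \<in> carrier V \<Longrightarrow> f x \<in> carrier W"
    and "\<And>x y. x \<in> carrier V \<Longrightarrow> y \<in> carrier V \<Longrightarrow> f (x + y) = f x + f y"
    and "\<And>c x. x \<in> carrier V \<Longrightarrow> f (smult V c x) = smult W c (f x)"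
  shows "linear_map V W f"
  using assms by (simp add: linear_map_def)

lemma linear_map_in: "linear_map V W f \<Longrightarrow> x \<in> carrier V \<Longrightarrow> f x \<in> carrier W"
  by (simp add: linear_map_def)

lemma linear_map_add:
  "linear_map V W f \<Longrightarrow> x \<in> carrier V \<Longrightarrow> y \<in> carrier V \<Longrightarrow> f (x + y) = f x + f y"
  by (simp add: linear_map_def)

lemma linear_map_scale:
  "linear_map V W f \<Longrightarrow> x \<in> carrier V \<Longrightarrow> f (smult V c x) = smult W c (f x)"
  by (simp add: linear_map_def)

lemma linear_map_zero:
  assumes "linear_map V W f" "vspace V" "vspace W"
  shows "f 0 = 0"
  using linear_map_scale[OF assms(1) vspace_zero[OF assms(2)], of 0]
    vspace_smult_simps[OF assms(2)] vspace_smult_simps[OF assms(3)] by simp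

lemma linear_map_sum:
  assumes f: "linear_map V W f" and V: "vspace V" and W: "vspace W"
    and x: "\<And>i. i \<in> I \<Longrightarrow> x i \<in> carrier V"
  shows "f (\<Sum>i\<in>I. x i) = (\<Sum>i\<in>I. f (x i))"
  using x
proof (induction I rule: infinite_finite_induct)
  case (insert i I)
  then show ?case using linear_map_add[OF f] vspace_sum[OF V, of I x] by simp
qed (simp_all add: linear_map_zero[OF f V W])

lemma linear_map_sum2:
  assumes f: "linear_map V W f" and V: "vspace V" and W: "vspace W"
    and x: "\<And>i j. i \<in> I \<Longrightarrow> j \<in> J \<Longrightarrow> x i j \<in> carrier V"
  shows "f (\<Sum>i\<in>I. \<Sum>j\<in>J. x i j) = (\<Sum>i\<in>I. \<Sum>j\<in>J. f (x i j))"
proof -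
  have "f (\<Sum>i\<in>I. \<Sum>j\<in>J. x i j) = (\<Sum>i\<in>I. f (\<Sum>j\<in>J. x i j))"
    by (intro linear_map_sum[OF f V W] vspace_sum[OF V] x)
  also have "\<dots> = (\<Sum>i\<in>I. \<Sum>j\<in>J. f (x i j))"
    by (intro sum.cong refl linear_map_sum[OF f V W] x)
  finally show ?thesis .
qed

lemma linear_map_comp:
  "linear_map V W f \<Longrightarrow> linear_map W U g \<Longrightarrow> linear_map V U (\<lambda>x. g (f x))"
  by (simp add: linear_map_def)

lemma linear_map_id: "linear_map V V id"
  by (simp add: linear_map_def)

lemma linear_map_ident: "linear_map V V (\<lambda>x. x)"
  by (simp add: linear_map_def)

lemma linear_map_plus:
  assumes "vspace W" "linear_map V W f" "linear_map V W g"
  shows "linear_map V W (\<lambda>x. f x + g x)"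
  using assms by (auto simp: linear_map_def vspace_add vspace_smult_distrib algebra_simps)

lemma linear_map_smult:
  assumes "vspace W" "linear_map V W f"
  shows "linear_map V W (\<lambda>x. smult W c (f x))"
  using assms by (auto simp: linear_map_def vspace_scale vspace_smult_simps vspace_smult_distrib
      mult.commute)

lemma linear_map_const_zero: "vspace W \<Longrightarrow> linear_map V W (\<lambda>x. 0)"
  by (auto simp: linear_map_def vspace_zero vspace_smult_simps)

lemma linear_map_sum_fun:
  assumes "vspace W" "\<And>i. i \<in> I \<Longrightarrow> linear_map V W (f i)"
  shows "linear_map V W (\<lambda>x. \<Sum>i\<in>I. f i x)"
  using assms(2)
  by (induction I rule: infinite_finite_induct)
    (simp_all add: linear_map_const_zero linear_map_plus assms(1))

lemma linear_map_smult_vec: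
  assumes "vspace W" "linear_map V ground f" "w \<in> carrier W"
  shows "linear_map V W (\<lambda>x. smult W (f x) w)"
  using assms by (auto simp: linear_map_def vspace_scale vspace_smult_simps vspace_smult_distrib)

lemma linear_form_mult: "linear_map V ground f \<Longrightarrow> linear_map V ground (\<lambda>x. c * f x)"
  using linear_map_smult[OF vspace_ground, of V f c] by simp

lemma linear_form_mult_right: "linear_map V ground f \<Longrightarrow> linear_map V ground (\<lambda>x. f x * c)"
  using linear_form_mult[of V f c] by (simp add: mult.commute)

text \<open>Linearity only concerns values on the carrier. This allows a map to be replaced by a
  closed formula, or by its truncation to 0 outside the carrier.\<close>

lemma linear_map_cong:
  assumes "linear_map V W f" "vspace V" "\<And>x. x \<in> carrier V \<Longrightarrow> f x = g x"
  shows "linear_map V W g"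
  using assms by (simp add: linear_map_def vspace_add vspace_scale)

lemma bilinear_mapI:
  assumes "\<And>v. v \<in> carrier V \<Longrightarrow> linear_map W U (B v)"
    and "\<And>w. w \<in> carrier W \<Longrightarrow> linear_map V U (\<lambda>v. B v w)"
  shows "bilinear_map V W U B"
  using assms by (simp add: bilinear_map_def)

lemma bilinear_map_right: "bilinear_map V W U B \<Longrightarrow> v \<in> carrier V \<Longrightarrow> linear_map W U (B v)"
  by (simp add: bilinear_map_def)

lemma bilinear_map_left: "bilinear_map V W U B \<Longrightarrow> w \<in> carrier W \<Longrightarrow> linear_map V U (\<lambda>v. B v w)"
  by (simp add: bilinear_map_def)

lemma bilinear_map_comp:
  assumes "bilinear_map V W U B" "linear_map V' V f" "linear_map W' W g"
  shows "bilinear_map V' W' U (\<lambda>x y. B (f x) (g y))"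
  using assms by (simp add: bilinear_map_def linear_map_def)

lemma bilinear_map_comp_out:
  assumes "bilinear_map V W U B" "linear_map U U' f"
  shows "bilinear_map V W U' (\<lambda>x y. f (B x y))"
  using assms by (simp add: bilinear_map_def linear_map_def)

lemma bilinear_map_sum:
  assumes B: "bilinear_map V W U B" and V: "vspace V" and W: "vspace W" and U: "vspace U"
    and x: "\<And>i. i \<in> I \<Longrightarrow> x i \<in> carrier V" and y: "\<And>j. j \<in> J \<Longrightarrow> y j \<in> carrier W"
  shows "B (\<Sum>i\<in>I. x i) (\<Sum>j\<in>J. y j) = (\<Sum>i\<in>I. \<Sum>j\<in>J. B (x i) (y j))"
proof -
  have "B (\<Sum>i\<in>I. x i) (\<Sum>j\<in>J. y j) = (\<Sum>i\<in>I. B (x i) (\<Sum>j\<in>J. y j))"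
    by (intro linear_map_sum[OF bilinear_map_left[OF B] V U] vspace_sum[OF W] x y)
  also have "\<dots> = (\<Sum>i\<in>I. \<Sum>j\<in>J. B (x i) (y j))"
    by (intro sum.cong refl linear_map_sum[OF bilinear_map_right[OF B] W U] x y)
  finally show ?thesis .
qed

lemma bilinear_map_prod:
  assumes "linear_map V ground f" "linear_map W ground g"
  shows "bilinear_map V W ground (\<lambda>x y. f x * g y)"
  using assms by (intro bilinear_mapI linear_form_mult linear_form_mult_right)

lemma bilinear_map_scale_vec:
  assumes "vspace W" "linear_map V ground f"
  shows "bilinear_map V W W (\<lambda>v w. smult W (f v) w)"
    and "bilinear_map W V W (\<lambda>w v. smult W (f v) w)"
  using assms
  by (auto intro!: bilinear_mapI linear_map_smult linear_map_ident linear_map_smult_vec)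


section \<open>Tensor products\<close>

lemma tensor_smult [simp]: "smult (V \<otimes> W) = fscale"
  by (simp add: tensor_def)

lemma fscale_simps [simp]:
  "fscale 0 f = 0" "fscale 1 f = f" "fscale c 0 = 0" "fscale a (fscale b f) = fscale (a * b) f"
  by (simp_all add: fscale_def fun_eq_iff mult.assoc)

lemma sum_fun_apply: "(\<Sum>i\<in>I. f i) x = (\<Sum>i\<in>I. f i x)"
  by (induction I rule: infinite_finite_induct) simp_all

lemma pure_in: "v \<in> carrier V \<Longrightarrow> w \<in> carrier W \<Longrightarrow> pure V W v w \<in> carrier (V \<otimes> W)"
  unfolding tensor_def
  by (auto intro!: module.span_base[OF vspace_module[OF vspace_tensor, unfolded tensor_smult]])

lemma bilinear_form_simps:
  assumes "bilinear_map V W ground \<beta>" "v \<in> carrier V" "w \<in> carrier W"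
  shows "v' \<in> carrier V \<Longrightarrow> \<beta> (v + v') w = \<beta> v w + \<beta> v' w"
    and "w' \<in> carrier W \<Longrightarrow> \<beta> v (w + w') = \<beta> v w + \<beta> v w'"
    and "\<beta> (smult V c v) w = c * \<beta> v w"
    and "\<beta> v (smult W c w) = c * \<beta> v w"
  using assms by (simp_all add: bilinear_map_def linear_map_def)

text \<open>Equality of tensors is tested on all forms: on bilinear ones it is bilinearity of the
  form itself, on the others both sides are 0 by the normalisation in
  \<open>functional_on\<close>.\<close>

lemma bilinear_pure: "bilinear_map V W (V \<otimes> W) (pure V W)"
proof (rule bilinear_mapI)
  show "linear_map W (V \<otimes> W) (pure V W v)" if "v \<in> carrier V" for v
    using that
    by (intro linear_mapI pure_in ext)
      (auto simp: pure_def functional_on_def fscale_def bilinear_form_simps)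
  show "linear_map V (V \<otimes> W) (\<lambda>v. pure V W v w)" if "w \<in> carrier W" for w
    using that
    by (intro linear_mapI pure_in ext)
      (auto simp: pure_def functional_on_def fscale_def bilinear_form_simps)
qed

lemmas linear_pure_right = bilinear_map_right[OF bilinear_pure]
lemmas linear_pure_left = bilinear_map_left[OF bilinear_pure]

lemma pure_scale_left:
  "v \<in> carrier V \<Longrightarrow> w \<in> carrier W \<Longrightarrow> pure V W (smult V c v) w = fscale c (pure V W v w)"
  using linear_map_scale[OF linear_pure_left] by fastforce

lemma pure_scale_right:
  "v \<in> carrier V \<Longrightarrow> w \<in> carrier W \<Longrightarrow> pure V W v (smult W c w) = fscale c (pure V W v w)"
  using linear_map_scale[OF linear_pure_right] by fastforce

lemma pure_sum_left:
  assumes "vspace V" "w \<in> carrier W" "\<And>i. i \<in> I \<Longrightarrow> x i \<in> carrier V"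
  shows "pure V W (\<Sum>i\<in>I. x i) w = (\<Sum>i\<in>I. pure V W (x i) w)"
  by (rule linear_map_sum[OF linear_pure_left assms(1) vspace_tensor]) (use assms in auto)

lemma pure_sum_right:
  assumes "vspace W" "v \<in> carrier V" "\<And>i. i \<in> I \<Longrightarrow> x i \<in> carrier W"
  shows "pure V W v (\<Sum>i\<in>I. x i) = (\<Sum>i\<in>I. pure V W v (x i))"
  by (rule linear_map_sum[OF linear_pure_right assms(1) vspace_tensor]) (use assms in auto)

lemma pure_zero_left: "vspace V \<Longrightarrow> w \<in> carrier W \<Longrightarrow> pure V W 0 w = 0"
  using linear_map_zero[OF linear_pure_left _ vspace_tensor] by blast

lemma pure_zero_right: "vspace W \<Longrightarrow> v \<in> carrier V \<Longrightarrow> pure V W v 0 = 0"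
  using linear_map_zero[OF linear_pure_right _ vspace_tensor] by blast

text \<open>Elements of the span are linear combinations, but each scalar can be absorbed into the
  left factor, so sums of pure tensors suffice. This is where \<open>vspace V\<close>
  enters.\<close>

lemma tensor_induct [consumes 2, case_names zero add]:
  fixes V :: "('k::field, 'a::ab_group_add, 'z) vspace_scheme"
    and W :: "('k, 'b::ab_group_add, 'w) vspace_scheme"
  assumes t: "t \<in> carrier (V \<otimes> W)" and V: "vspace V"
    and zero: "P 0"
    and add: "\<And>v w s. v \<in> carrier V \<Longrightarrow> w \<in> carrier W \<Longrightarrow> s \<in> carrier (V \<otimes> W) \<Longrightarrow> P s \<Longrightarrow>
      P (pure V W v w + s)"
  shows "P t"
proof -
  interpret T: vector_space "fscale :: 'k \<Rightarrow> ('k, 'a, 'b) tensor \<Rightarrow> ('k, 'a, 'b) tensor"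
    by (rule vector_space_fscale)
  let ?P = "{pure V W v w | v w. v \<in> carrier V \<and> w \<in> carrier W}"
  have "t \<in> carrier (V \<otimes> W) \<and> P t"
  proof (rule T.span_induct_alt[of t ?P])
    show "t \<in> T.span ?P" using t by (simp add: tensor_def)
    show "0 \<in> carrier (V \<otimes> W) \<and> P 0" using zero vspace_zero[OF vspace_tensor] by blast
  next
    fix c x s assume x: "x \<in> ?P" and s: "s \<in> carrier (V \<otimes> W) \<and> P s"
    then obtain v w where vw: "v \<in> carrier V" "w \<in> carrier W" "x = pure V W v w" by blast
    then have e: "fscale c x = pure V W (smult V c v) w" by (simp add: pure_scale_left)
    show "fscale c x + s \<in> carrier (V \<otimes> W) \<and> P (fscale c x + s)"
      unfolding e using vw s V
      by (auto intro!: add vspace_add[OF vspace_tensor] pure_in vspace_scale)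
  qed
  then show ?thesis ..
qed

lemma tensor_linear_eq:
  assumes f: "linear_map (V \<otimes> W) U f" and g: "linear_map (V \<otimes> W) U g" and V: "vspace V"
    and U: "vspace U"
    and eq: "\<And>v w. v \<in> carrier V \<Longrightarrow> w \<in> carrier W \<Longrightarrow> f (pure V W v w) = g (pure V W v w)"
    and t: "t \<in> carrier (V \<otimes> W)"
  shows "f t = g t"
  using t V
proof (induction rule: tensor_induct)
  case zero
  show ?case
    by (simp only: linear_map_zero[OF f vspace_tensor U] linear_map_zero[OF g vspace_tensor U])
next
  case (add v w s)
  then show ?case using linear_map_add[OF f] linear_map_add[OF g] eq pure_in by metis
qed

lemma tensor_linear_in:
  assumes V: "vspace V" and U: "vspace U"
    and add: "\<And>s t. f (s + t) = f s + f t" and zero: "f 0 = 0"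
    and pure: "\<And>v w. v \<in> carrier V \<Longrightarrow> w \<in> carrier W \<Longrightarrow> f (pure V W v w) \<in> carrier U"
    and t: "t \<in> carrier (V \<otimes> W)"
  shows "f t \<in> carrier U"
  using t V
proof (induction rule: tensor_induct)
  case zero show ?case by (simp only: assms(4) vspace_zero[OF U])
next
  case (add v w s) then show ?case using assms(3) pure vspace_add[OF U] by metis
qed

text \<open>A fixed tensor is a finite sum of evaluations at pairs (v, w), so it depends linearly on
  any parameter on which the form depends linearly. The nested evaluations in \<open>assoc\<close>,
  \<open>interchange\<close>, \<open>end_mult\<close> and \<open>coend_comult\<close> are bilinear
  for this reason.\<close>

lemma tensor_eval_linear:
  assumes t: "t \<in> carrier (V \<otimes> W)" and V: "vspace V"
    and bil: "\<And>u. u \<in> carrier U \<Longrightarrow> bilinear_map V W ground (\<beta> u)"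
    and lin: "\<And>v w. v \<in> carrier V \<Longrightarrow> w \<in> carrier W \<Longrightarrow> linear_map U ground (\<lambda>u. \<beta> u v w)"
    and U: "vspace U"
  shows "linear_map U ground (\<lambda>u. t (\<beta> u))"
  using t V
proof (induction rule: tensor_induct)
  case zero show ?case using linear_map_const_zero[OF vspace_ground] by simp
next
  case (add v w s)
  have "linear_map U ground (\<lambda>u. \<beta> u v w + s (\<beta> u))"
    using add lin by (intro linear_map_plus vspace_ground)
  then show ?case by (rule linear_map_cong) (use U in \<open>auto simp: pure_apply[OF bil]\<close>)
qed

lemma tensor_eval_linear_tensor: "linear_map (V \<otimes> W) ground (\<lambda>t. t \<beta>)"
  by (rule linear_mapI) (auto simp: fscale_def)

text \<open>The maps \<open>tmap\<close>, \<open>assoc\<close>, \<open>interchange\<close>,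
  \<open>end_mult\<close> and \<open>coend_comult\<close> all have this shape. Additivity and
  homogeneity are pointwise; the content is that values lie in the span of pure tensors, and for
  that pure arguments suffice.\<close>

lemma linear_functional_on:
  assumes V: "vspace V"
    and "\<And>v w. v \<in> carrier V \<Longrightarrow> w \<in> carrier W \<Longrightarrow>
      functional_on V' W' (\<lambda>\<beta>. pure V W v w (G \<beta>)) \<in> carrier (V' \<otimes> W')"
  shows "linear_map (V \<otimes> W) (V' \<otimes> W') (\<lambda>t. functional_on V' W' (\<lambda>\<beta>. t (G \<beta>)))"
    (is "linear_map _ _ ?F")
proof -
  have F: "?F (s + t) = ?F s + ?F t" "?F 0 = 0" "?F (fscale c t) = fscale c (?F t)" for s t c
    by (auto simp: fun_eq_iff functional_on_def fscale_def)
  have "?F t \<in> carrier (V' \<otimes> W')" if "t \<in> carrier (V \<otimes> W)" for t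
    using F(1,2) assms(2) that by (rule tensor_linear_in[OF V vspace_tensor])
  then show ?thesis by (rule linear_mapI) (simp_all only: F tensor_smult)
qed

text \<open>When both factors are tensors themselves, an induction on the left factor, and inside it
  one on the right factor, leaves only pure tensors of pure tensors.\<close>

lemma linear_functional_on_tensors:
  assumes V: "vspace V" and W: "vspace W"
    and pures: "\<And>v a w b. v \<in> carrier V \<Longrightarrow> a \<in> carrier A \<Longrightarrow> w \<in> carrier W \<Longrightarrow> b \<in> carrier B \<Longrightarrow>
      functional_on V' W' (\<lambda>\<beta>. pure (V \<otimes> A) (W \<otimes> B) (pure V A v a) (pure W B w b) (G \<beta>))
        \<in> carrier (V' \<otimes> W')"
  shows "linear_map ((V \<otimes> A) \<otimes> (W \<otimes> B)) (V' \<otimes> W') (\<lambda>t. functional_on V' W' (\<lambda>\<beta>. t (G \<beta>)))"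
    (is "linear_map _ _ ?F")
proof (rule linear_functional_on[OF vspace_tensor])
  have F: "?F (s + t) = ?F s + ?F t" "?F 0 = 0" for s t
    by (auto simp: fun_eq_iff functional_on_def)
  fix x y assume x: "x \<in> carrier (V \<otimes> A)" and y: "y \<in> carrier (W \<otimes> B)"
  from x V show "?F (pure (V \<otimes> A) (W \<otimes> B) x y) \<in> carrier (V' \<otimes> W')"
  proof (induction rule: tensor_induct)
    case zero
    show ?case by (simp only: pure_zero_left[OF vspace_tensor y] F vspace_zero[OF vspace_tensor])
  next
    case (add v a s)
    note va = add(1,2)
    from y W have "?F (pure (V \<otimes> A) (W \<otimes> B) (pure V A v a) y) \<in> carrier (V' \<otimes> W')"
    proof (induction rule: tensor_induct)
      case zero
      show ?case
        by (simp only: pure_zero_right[OF vspace_tensor pure_in[OF va]] F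
            vspace_zero[OF vspace_tensor])
    next
      case (add w b y)
      from vspace_add[OF vspace_tensor pures[OF va add(1,2)] add(4)] show ?case
        by (simp only: linear_map_add[OF linear_pure_right[OF pure_in[OF va]]
              pure_in[OF add(1,2)] add(3)] F)
    qed
    from vspace_add[OF vspace_tensor this add(4)] show ?case
      by (simp only: linear_map_add[OF linear_pure_left[OF y] pure_in[OF va] add(3)] F)
  qed
qed

text \<open>Both bracketings are linear in each argument, so the three arguments are reduced to pure
  tensors one at a time. It serves the two products built on tensors, \<open>tmul\<close> and
  \<open>end_mult\<close>.\<close>

lemma tensor_bilinear_assoc:
  assumes V: "vspace V" and m: "bilinear_map (V \<otimes> W) (V \<otimes> W) (V \<otimes> W) m"
    and pures: "\<And>a b c d x y. a \<in> carrier V \<Longrightarrow> b \<in> carrier W \<Longrightarrow> c \<in> carrier V \<Longrightarrow> d \<in> carrier W \<Longrightarrow>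
      x \<in> carrier V \<Longrightarrow> y \<in> carrier W \<Longrightarrow>
      m (m (pure V W a b) (pure V W c d)) (pure V W x y) =
      m (pure V W a b) (m (pure V W c d) (pure V W x y))"
    and r: "r \<in> carrier (V \<otimes> W)" and s: "s \<in> carrier (V \<otimes> W)" and t: "t \<in> carrier (V \<otimes> W)"
  shows "m (m r s) t = m r (m s t)"
proof -
  note L = bilinear_map_left[OF m] and R = bilinear_map_right[OF m]
  show ?thesis
  proof (rule tensor_linear_eq[OF linear_map_comp[OF L[OF s] L[OF t]] L[OF linear_map_in[OF R[OF s] t]]
        V vspace_tensor _ r])
    fix a b assume ab: "a \<in> carrier V" "b \<in> carrier W"
    note abi = pure_in[OF ab]
    show "m (m (pure V W a b) s) t = m (pure V W a b) (m s t)"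
    proof (rule tensor_linear_eq[OF linear_map_comp[OF R[OF abi] L[OF t]]
          linear_map_comp[OF L[OF t] R[OF abi]] V vspace_tensor _ s])
      fix c d assume cd: "c \<in> carrier V" "d \<in> carrier W"
      note cdi = pure_in[OF cd]
      show "m (m (pure V W a b) (pure V W c d)) t = m (pure V W a b) (m (pure V W c d) t)"
        by (rule tensor_linear_eq[OF R[OF linear_map_in[OF R[OF abi] cdi]]
              linear_map_comp[OF R[OF cdi] R[OF abi]] V vspace_tensor _ t])
          (rule pures[OF ab cd])
    qed
  qed
qed

section \<open>Tensor products of maps, associativity and interchange on pure tensors\<close>

lemma functional_on_eq_pure:
  assumes "\<And>\<beta>. bilinear_map V W ground \<beta> \<Longrightarrow> F \<beta> = \<beta> v w"
  shows "functional_on V W F = pure V W v w"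
  using assms by (auto simp: functional_on_def pure_def)

lemma tmap_pure:
  assumes "linear_map V V' f" "linear_map W W' g"
  shows "tmap V' W' f g (pure V W v w) = pure V' W' (f v) (g w)"
  unfolding tmap_def
  by (rule functional_on_eq_pure) (simp add: pure_apply bilinear_map_comp[OF _ assms])

lemma linear_tmap:
  assumes V: "vspace V" and "linear_map V V' f" "linear_map W W' g"
  shows "linear_map (V \<otimes> W) (V' \<otimes> W') (tmap V' W' f g)"
  unfolding tmap_def[abs_def]
  by (rule linear_functional_on[OF V], fold tmap_def)
    (simp add: tmap_pure[OF assms(2,3)] pure_in linear_map_in[OF assms(2)]
      linear_map_in[OF assms(3)])

text \<open>A pure tensor takes the value 0 at a form that is not bilinear, so each form nested in
  \<open>assoc\<close> has to be shown bilinear before the formula can be evaluated.\<close>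

lemma assoc_form_bilinear:
  assumes U: "vspace U" and W: "vspace W" and \<beta>: "bilinear_map U (V \<otimes> W) ground \<beta>"
  shows "bilinear_map (U \<otimes> V) W ground (\<lambda>s w. s (\<lambda>u v. \<beta> u (pure V W v w)))"
    and "w \<in> carrier W \<Longrightarrow> bilinear_map U V ground (\<lambda>u v. \<beta> u (pure V W v w))"
proof -
  have r: "linear_map V ground (\<lambda>v. \<beta> u (pure V W v w))" if "u \<in> carrier U" "w \<in> carrier W" for u w
    using that by (intro linear_map_comp[OF linear_pure_left] bilinear_map_right[OF \<beta>])
  show b: "bilinear_map U V ground (\<lambda>u v. \<beta> u (pure V W v w))" if "w \<in> carrier W" for w
    using that by (intro bilinear_mapI r bilinear_map_left[OF \<beta>] pure_in)
  show "bilinear_map (U \<otimes> V) W ground (\<lambda>s w. s (\<lambda>u v. \<beta> u (pure V W v w)))"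
  proof (rule bilinear_mapI)
    show "linear_map W ground (\<lambda>w. s (\<lambda>u v. \<beta> u (pure V W v w)))" if "s \<in> carrier (U \<otimes> V)" for s
      by (rule tensor_eval_linear[OF that U b _ W])
        (assumption, rule linear_map_comp[OF linear_pure_right bilinear_map_right[OF \<beta>]])
  qed (rule tensor_eval_linear_tensor)
qed

lemma assoc_pure_functional:
  assumes U: "vspace U" and W: "vspace W" and w: "w \<in> carrier W"
  shows "assoc U V W (pure (U \<otimes> V) W s w) =
    functional_on U (V \<otimes> W) (\<lambda>\<beta>. s (\<lambda>u v. \<beta> u (pure V W v w)))"
  unfolding assoc_def functional_on_def
  using pure_apply[OF assoc_form_bilinear(1)[OF U W]] by (auto simp: fun_eq_iff)

lemma assoc_pure:
  assumes U: "vspace U" and W: "vspace W" and w: "w \<in> carrier W"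
  shows "assoc U V W (pure (U \<otimes> V) W (pure U V u v) w) = pure U (V \<otimes> W) u (pure V W v w)"
  unfolding assoc_pure_functional[OF U W w]
  by (rule functional_on_eq_pure) (simp add: pure_apply assoc_form_bilinear(2)[OF U W _ w])

lemma linear_assoc:
  assumes U: "vspace U" and W: "vspace W"
  shows "linear_map ((U \<otimes> V) \<otimes> W) (U \<otimes> (V \<otimes> W)) (assoc U V W)"
  unfolding assoc_def[abs_def]
proof (rule linear_functional_on[OF vspace_tensor], fold assoc_def)
  fix s w assume s: "s \<in> carrier (U \<otimes> V)" and w: "w \<in> carrier W"
  \<comment> \<open>For fixed \<open>w\<close> the value is again of \<open>functional_on\<close>
    shape in \<open>s\<close>, so the linearity criterion applies a second time, now on U \<otimes>
    V.\<close>
  have "linear_map (U \<otimes> V) (U \<otimes> V \<otimes> W)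
      (\<lambda>s. functional_on U (V \<otimes> W) (\<lambda>\<beta>. s (\<lambda>u v. \<beta> u (pure V W v w))))"
    by (rule linear_functional_on[OF U])
      (simp add: assoc_pure_functional[OF U W w, symmetric] assoc_pure[OF U W w] pure_in w)
  then show "assoc U V W (pure (U \<otimes> V) W s w) \<in> carrier (U \<otimes> (V \<otimes> W))"
    unfolding assoc_pure_functional[OF U W w] using s by (rule linear_map_in)
qed

text \<open>The levels go from the inside out, matching the nested evaluations that
  \<open>interchange_pure\<close> performs.\<close>

lemma interchange_form_bilinear:
  assumes V: "vspace V" and A: "vspace A" and W: "vspace W" and B: "vspace B"
    and \<beta>: "bilinear_map (V \<otimes> W) (A \<otimes> B) ground \<beta>"
  shows "v \<in> carrier V \<Longrightarrow> a \<in> carrier A \<Longrightarrow>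
      bilinear_map W B ground (\<lambda>w b. \<beta> (pure V W v w) (pure A B a b))"
    and "y \<in> carrier (W \<otimes> B) \<Longrightarrow>
      bilinear_map V A ground (\<lambda>v a. y (\<lambda>w b. \<beta> (pure V W v w) (pure A B a b)))"
    and "bilinear_map (V \<otimes> A) (W \<otimes> B) ground
      (\<lambda>x y. x (\<lambda>v a. y (\<lambda>w b. \<beta> (pure V W v w) (pure A B a b))))"
proof -
  have lv: "linear_map V ground (\<lambda>v. \<beta> (pure V W v w) (pure A B a b))"
    if "w \<in> carrier W" "a \<in> carrier A" "b \<in> carrier B" for w a b
    using that by (intro linear_map_comp[OF linear_pure_left bilinear_map_left[OF \<beta>]] pure_in)
  have lw: "linear_map W ground (\<lambda>w. \<beta> (pure V W v w) (pure A B a b))"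
    if "v \<in> carrier V" "a \<in> carrier A" "b \<in> carrier B" for v a b
    using that by (intro linear_map_comp[OF linear_pure_right bilinear_map_left[OF \<beta>]] pure_in)
  have la: "linear_map A ground (\<lambda>a. \<beta> (pure V W v w) (pure A B a b))"
    if "v \<in> carrier V" "w \<in> carrier W" "b \<in> carrier B" for v w b
    using that by (intro linear_map_comp[OF linear_pure_left bilinear_map_right[OF \<beta>]] pure_in)
  have lb: "linear_map B ground (\<lambda>b. \<beta> (pure V W v w) (pure A B a b))"
    if "v \<in> carrier V" "w \<in> carrier W" "a \<in> carrier A" for v w a
    using that by (intro linear_map_comp[OF linear_pure_right bilinear_map_right[OF \<beta>]] pure_in)
  show i: "bilinear_map W B ground (\<lambda>w b. \<beta> (pure V W v w) (pure A B a b))"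
    if "v \<in> carrier V" "a \<in> carrier A" for v a
    using that by (intro bilinear_mapI lw lb)
  show ii: "bilinear_map V A ground (\<lambda>v a. y (\<lambda>w b. \<beta> (pure V W v w) (pure A B a b)))"
    if "y \<in> carrier (W \<otimes> B)" for y
  proof (rule bilinear_mapI)
    show "linear_map A ground (\<lambda>a. y (\<lambda>w b. \<beta> (pure V W v w) (pure A B a b)))"
      if "v \<in> carrier V" for v
      by (rule tensor_eval_linear[OF \<open>y \<in> _\<close> W _ _ A]) (use that i la in auto)
    show "linear_map V ground (\<lambda>v. y (\<lambda>w b. \<beta> (pure V W v w) (pure A B a b)))"
      if "a \<in> carrier A" for a
      by (rule tensor_eval_linear[OF \<open>y \<in> _\<close> W _ _ V]) (use that i lv in auto)
  qed
  show "bilinear_map (V \<otimes> A) (W \<otimes> B) ground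
      (\<lambda>x y. x (\<lambda>v a. y (\<lambda>w b. \<beta> (pure V W v w) (pure A B a b))))"
  proof (rule bilinear_mapI)
    show "linear_map (W \<otimes> B) ground
        (\<lambda>y. x (\<lambda>v a. y (\<lambda>w b. \<beta> (pure V W v w) (pure A B a b))))"
      if "x \<in> carrier (V \<otimes> A)" for x
      by (rule tensor_eval_linear[OF that V ii _ vspace_tensor])
        (assumption, rule tensor_eval_linear_tensor)
  qed (rule tensor_eval_linear_tensor)
qed

lemma interchange_pure:
  assumes V: "vspace V" and A: "vspace A" and W: "vspace W" and B: "vspace B"
    and "v \<in> carrier V" "a \<in> carrier A" "w \<in> carrier W" "b \<in> carrier B"
  shows "interchange V A W B (pure (V \<otimes> A) (W \<otimes> B) (pure V A v a) (pure W B w b)) =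
    pure (V \<otimes> W) (A \<otimes> B) (pure V W v w) (pure A B a b)"
  unfolding interchange_def
  by (rule functional_on_eq_pure)
    (simp add: assms pure_in pure_apply interchange_form_bilinear[OF V A W B])

lemma linear_interchange:
  assumes V: "vspace V" and A: "vspace A" and W: "vspace W" and B: "vspace B"
  shows "linear_map ((V \<otimes> A) \<otimes> (W \<otimes> B)) ((V \<otimes> W) \<otimes> (A \<otimes> B)) (interchange V A W B)"
  unfolding interchange_def[abs_def]
  by (rule linear_functional_on_tensors[OF V W], fold interchange_def)
    (simp add: interchange_pure[OF assms] pure_in)

text \<open>The map promised by \<open>tensor_universal\<close>, picked by choice. For bilinear
  \<open>B\<close> its values on the carrier are forced by the uniqueness part; elsewhere they are
  arbitrary.\<close>

definition tlift ::
  "('k::field, 'a::ab_group_add, 'z) vspace_scheme \<Rightarrow> ('k, 'b::ab_group_add, 'w) vspace_scheme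
    \<Rightarrow> ('k, 'c::ab_group_add, 'u) vspace_scheme \<Rightarrow> ('a \<Rightarrow> 'b \<Rightarrow> 'c) \<Rightarrow> ('k, 'a, 'b) tensor \<Rightarrow> 'c" where
  "tlift V W U B = (SOME f. linear_map (V \<otimes> W) U f \<and>
     (\<forall>v \<in> carrier V. \<forall>w \<in> carrier W. f (pure V W v w) = B v w))"

lemma tlift:
  assumes "vspace U" "bilinear_map V W U B"
  shows "linear_map (V \<otimes> W) U (tlift V W U B)"
    and "v \<in> carrier V \<Longrightarrow> w \<in> carrier W \<Longrightarrow> tlift V W U B (pure V W v w) = B v w"
proof -
  have "\<exists>f. linear_map (V \<otimes> W) U f \<and>
     (\<forall>v \<in> carrier V. \<forall>w \<in> carrier W. f (pure V W v w) = B v w)"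
    using tensor_universal[OF assms] by blast
  from someI_ex[OF this, folded tlift_def]
  show "linear_map (V \<otimes> W) U (tlift V W U B)"
    and "v \<in> carrier V \<Longrightarrow> w \<in> carrier W \<Longrightarrow> tlift V W U B (pure V W v w) = B v w" by blast+
qed

text \<open>The contraction \<phi> \<otimes> 1 followed by K \<otimes> W \<cong> W;
  \<open>rslice\<close> is the mirror image. With a dual functional for \<phi> it reads off one
  coefficient of a tensor.\<close>

definition lslice ::
  "('k::field, 'a::ab_group_add, 'z) vspace_scheme \<Rightarrow> ('k, 'b::ab_group_add, 'w) vspace_scheme
    \<Rightarrow> ('a \<Rightarrow> 'k) \<Rightarrow> ('k, 'a, 'b) tensor \<Rightarrow> 'b" where
  "lslice V W \<phi> = tlift V W W (\<lambda>v w. smult W (\<phi> v) w)"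

definition rslice ::
  "('k::field, 'a::ab_group_add, 'z) vspace_scheme \<Rightarrow> ('k, 'b::ab_group_add, 'w) vspace_scheme
    \<Rightarrow> ('b \<Rightarrow> 'k) \<Rightarrow> ('k, 'a, 'b) tensor \<Rightarrow> 'a" where
  "rslice V W \<phi> = tlift V W V (\<lambda>v w. smult V (\<phi> w) v)"

lemma
  assumes "vspace W" "linear_map V ground \<phi>"
  shows linear_lslice: "linear_map (V \<otimes> W) W (lslice V W \<phi>)"
    and lslice_pure: "v \<in> carrier V \<Longrightarrow> w \<in> carrier W \<Longrightarrow>
      lslice V W \<phi> (pure V W v w) = smult W (\<phi> v) w"
  unfolding lslice_def using tlift[OF assms(1) bilinear_map_scale_vec(1)[OF assms]] by blast+

lemma
  assumes "vspace V" "linear_map W ground \<phi>"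
  shows linear_rslice: "linear_map (V \<otimes> W) V (rslice V W \<phi>)"
    and rslice_pure: "v \<in> carrier V \<Longrightarrow> w \<in> carrier W \<Longrightarrow>
      rslice V W \<phi> (pure V W v w) = smult V (\<phi> w) v"
  unfolding rslice_def using tlift[OF assms(1) bilinear_map_scale_vec(2)[OF assms]] by blast+

section \<open>Dual bases\<close>

text \<open>Biorthogonal functionals make independence usable by calculation. The family may span a
  proper subspace while the functionals live on all of \<open>V\<close>: a finite dimensional
  subcomodule of an infinite dimensional coalgebra is handled without restricting the coalgebra. The
  index type is free, so pairs can index bases of tensor products.\<close>

definition dual_family ::
  "('k::field, 'a::ab_group_add, 'z) vspace_scheme \<Rightarrow> 'i set \<Rightarrow> ('i \<Rightarrow> 'a) \<Rightarrow> ('i \<Rightarrow> 'a \<Rightarrow> 'k) \<Rightarrow> bool"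
  where
  "dual_family V I e f \<longleftrightarrow> finite I \<and> (\<forall>i\<in>I. e i \<in> carrier V \<and> linear_map V ground (f i)) \<and>
     (\<forall>i\<in>I. \<forall>j\<in>I. f i (e j) = (if i = j then 1 else 0))"

definition dual_basis ::
  "('k::field, 'a::ab_group_add, 'z) vspace_scheme \<Rightarrow> 'i set \<Rightarrow> ('i \<Rightarrow> 'a) \<Rightarrow> ('i \<Rightarrow> 'a \<Rightarrow> 'k) \<Rightarrow> bool"
  where
  "dual_basis V I e f \<longleftrightarrow> dual_family V I e f \<and>
     (\<forall>v\<in>carrier V. v = (\<Sum>i\<in>I. smult V (f i v) (e i)))"

lemma dual_familyD:
  assumes "dual_family V I e f"
  shows "finite I" and "i \<in> I \<Longrightarrow> e i \<in> carrier V" and "i \<in> I \<Longrightarrow> linear_map V ground (f i)"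
    and "i \<in> I \<Longrightarrow> j \<in> I \<Longrightarrow> f i (e j) = (if i = j then 1 else 0)"
  using assms by (auto simp: dual_family_def)

lemma dual_basisD:
  assumes "dual_basis V I e f"
  shows "dual_family V I e f" and "finite I" and "i \<in> I \<Longrightarrow> e i \<in> carrier V"
    and "i \<in> I \<Longrightarrow> linear_map V ground (f i)"
    and "i \<in> I \<Longrightarrow> j \<in> I \<Longrightarrow> f i (e j) = (if i = j then 1 else 0)"
    and "v \<in> carrier V \<Longrightarrow> (\<Sum>i\<in>I. smult V (f i v) (e i)) = v"
  using assms by (auto simp: dual_basis_def dual_family_def)

lemma dual_basis_linear_expand:
  assumes b: "dual_basis V I e f" and V: "vspace V" and W: "vspace W"
    and g: "linear_map V W g" and v: "v \<in> carrier V"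
  shows "g v = (\<Sum>i\<in>I. smult W (f i v) (g (e i)))"
proof -
  have "g v = g (\<Sum>i\<in>I. smult V (f i v) (e i))" using dual_basisD(6)[OF b v] by simp
  also have "\<dots> = (\<Sum>i\<in>I. g (smult V (f i v) (e i)))"
    by (rule linear_map_sum[OF g V W]) (rule vspace_scale[OF V dual_basisD(3)[OF b]])
  also have "\<dots> = (\<Sum>i\<in>I. smult W (f i v) (g (e i)))"
    by (rule sum.cong[OF refl], rule linear_map_scale[OF g dual_basisD(3)[OF b]])
  finally show ?thesis .
qed

lemma dual_basis_linear_eq:
  assumes b: "dual_basis V I e f" and V: "vspace V" and W: "vspace W"
    and g: "linear_map V W g" and h: "linear_map V W h"
    and eq: "\<And>i. i \<in> I \<Longrightarrow> g (e i) = h (e i)" and v: "v \<in> carrier V"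
  shows "g v = h v"
  unfolding dual_basis_linear_expand[OF b V W g v] dual_basis_linear_expand[OF b V W h v]
  by (simp add: eq)

lemma dual_family_lslice:
  assumes b: "dual_family V I e f" and W: "vspace W"
    and w: "\<And>j. j \<in> I \<Longrightarrow> w j \<in> carrier W" and i: "i \<in> I"
  shows "lslice V W (f i) (\<Sum>j\<in>I. pure V W (e j) (w j)) = w i"
proof -
  note D = dual_familyD[OF b]
  have "lslice V W (f i) (\<Sum>j\<in>I. pure V W (e j) (w j)) = (\<Sum>j\<in>I. lslice V W (f i) (pure V W (e j) (w j)))"
    by (rule linear_map_sum[OF linear_lslice[OF W D(3)[OF i]] vspace_tensor W])
      (rule pure_in[OF D(2) w])
  also have "\<dots> = (\<Sum>j\<in>I. if i = j then w j else 0)"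
    by (rule sum.cong) (simp_all add: lslice_pure[OF W D(3)[OF i]] D(2,4) w i smult_delta[OF W])
  also have "\<dots> = w i" using i D(1) by simp
  finally show ?thesis .
qed

text \<open>Both sides are linear in \<open>t\<close>, and on v \<otimes> w the claim is the
  expansion of v. This is what turns a coaction into a matrix over \<open>H\<close>.\<close>

lemma dual_basis_tensor_expand:
  assumes b: "dual_basis V I e f" and V: "vspace V" and W: "vspace W"
    and t: "t \<in> carrier (V \<otimes> W)"
  shows "(\<Sum>i\<in>I. pure V W (e i) (lslice V W (f i) t)) = t"
proof -
  note D = dual_basisD[OF b]
  show ?thesis
  proof (rule tensor_linear_eq[where W = W, OF _ linear_map_ident V vspace_tensor _ t])
    show "linear_map (V \<otimes> W) (V \<otimes> W) (\<lambda>t. \<Sum>i\<in>I. pure V W (e i) (lslice V W (f i) t))"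
      by (rule linear_map_sum_fun[OF vspace_tensor])
        (rule linear_map_comp[OF linear_lslice[OF W D(4)] linear_pure_right[OF D(3)]])
  next
    fix v w assume v: "v \<in> carrier V" and w: "w \<in> carrier W"
    have "(\<Sum>i\<in>I. pure V W (e i) (lslice V W (f i) (pure V W v w))) =
        (\<Sum>i\<in>I. pure V W (smult V (f i v) (e i)) w)"
      by (rule sum.cong[OF refl])
        (simp add: lslice_pure[OF W D(4)] v w pure_scale_left pure_scale_right D(3))
    also have "\<dots> = pure V W (\<Sum>i\<in>I. smult V (f i v) (e i)) w"
      by (rule pure_sum_left[OF V w, symmetric]) (rule vspace_scale[OF V D(3)])
    also have "\<dots> = pure V W v w" by (simp only: D(6)[OF v])
    finally show "(\<Sum>i\<in>I. pure V W (e i) (lslice V W (f i) (pure V W v w))) = pure V W v w" .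
  qed
qed

text \<open>Since tensors are functionals on bilinear forms, the functional dual to
  \<open>e i \<otimes> e' j\<close> is just evaluation at the product form of \<open>f i\<close> and
  \<open>f' j\<close>.\<close>

lemma dual_basis_tensor:
  assumes b: "dual_basis V I e f" and b': "dual_basis W J e' f'" and V: "vspace V" and W: "vspace W"
  shows "dual_basis (V \<otimes> W) (I \<times> J) (\<lambda>p. pure V W (e (fst p)) (e' (snd p)))
    (\<lambda>p t. t (\<lambda>v w. f (fst p) v * f' (snd p) w))"
proof -
  note D = dual_basisD[OF b] and D' = dual_basisD[OF b']
  have bil: "bilinear_map V W ground (\<lambda>v w. f (fst p) v * f' (snd p) w)" if "p \<in> I \<times> J" for p
    using that by (intro bilinear_map_prod D(4) D'(4)) auto
  have fam: "dual_family (V \<otimes> W) (I \<times> J) (\<lambda>p. pure V W (e (fst p)) (e' (snd p)))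
    (\<lambda>p t. t (\<lambda>v w. f (fst p) v * f' (snd p) w))"
    unfolding dual_family_def
    using D D' by (auto simp: pure_in tensor_eval_linear_tensor pure_apply[OF bil] prod_eq_iff)
  have "(\<Sum>p\<in>I\<times>J. fscale (t (\<lambda>v w. f (fst p) v * f' (snd p) w)) (pure V W (e (fst p)) (e' (snd p)))) = t"
    if t: "t \<in> carrier (V \<otimes> W)" for t
  proof (rule tensor_linear_eq[where W = W, OF _ linear_map_ident V vspace_tensor _ t])
    show "linear_map (V \<otimes> W) (V \<otimes> W) (\<lambda>t. \<Sum>p\<in>I\<times>J.
        fscale (t (\<lambda>v w. f (fst p) v * f' (snd p) w)) (pure V W (e (fst p)) (e' (snd p))))"
      by (rule linear_map_sum_fun[OF vspace_tensor], fold tensor_smult[of V W],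
          rule linear_map_smult_vec[OF vspace_tensor tensor_eval_linear_tensor pure_in])
        (use D D' in auto)
  next
    fix v w assume v: "v \<in> carrier V" and w: "w \<in> carrier W"
    have "(\<Sum>p\<in>I\<times>J. fscale (pure V W v w (\<lambda>v w. f (fst p) v * f' (snd p) w)) (pure V W (e (fst p)) (e' (snd p))))
      = (\<Sum>p\<in>I\<times>J. pure V W (smult V (f (fst p) v) (e (fst p))) (smult W (f' (snd p) w) (e' (snd p))))"
      by (rule sum.cong[OF refl])
        (auto simp: pure_apply[OF bil] D(3) D'(3) pure_scale_left pure_scale_right
          vspace_scale[OF V] vspace_scale[OF W] mult.commute)
    also have "\<dots> = (\<Sum>i\<in>I. \<Sum>j\<in>J. pure V W (smult V (f i v) (e i)) (smult W (f' j w) (e' j)))"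
      by (simp add: sum.cartesian_product case_prod_unfold)
    also have "\<dots> = (\<Sum>i\<in>I. pure V W (smult V (f i v) (e i)) w)"
      by (rule sum.cong[OF refl], subst pure_sum_right[OF W, symmetric])
        (simp_all add: D(3) D'(3,6) w vspace_scale[OF V] vspace_scale[OF W])
    also have "\<dots> = pure V W v w"
      by (subst pure_sum_left[OF V w, symmetric]) (simp_all add: D(3,6) v vspace_scale[OF V])
    finally show "(\<Sum>p\<in>I\<times>J. fscale (pure V W v w (\<lambda>v w. f (fst p) v * f' (snd p) w))
      (pure V W (e (fst p)) (e' (snd p)))) = pure V W v w" .
  qed
  then show ?thesis using fam by (simp add: dual_basis_def)
qed

section \<open>Dual spaces, existence of dual bases, and the coevaluation tensor\<close>

lemma dual_space_simps:
  "smult (dual_space V) = fscale"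
  "g \<in> carrier (dual_space V) \<longleftrightarrow> linear_map V ground g \<and> (\<forall>x. x \<notin> carrier V \<longrightarrow> g x = 0)"
  by (simp_all add: dual_space_def)

lemma vspace_dual_space:
  fixes V :: "('k::field, 'a::ab_group_add, 'z) vspace_scheme"
  shows "vspace (dual_space V)"
proof -
  interpret vector_space "fscale :: 'k \<Rightarrow> ('a \<Rightarrow> 'k) \<Rightarrow> 'a \<Rightarrow> 'k" by (rule vector_space_fscale)
  have "subspace (carrier (dual_space V))"
    unfolding subspace_def
    by (auto simp: dual_space_simps linear_map_def fscale_def algebra_simps)
  then show ?thesis by (simp add: vspace_def dual_space_simps vector_space_fscale)
qed

lemma linear_dual_eval: "v \<in> carrier V \<Longrightarrow> linear_map (dual_space V) ground (\<lambda>g. g v)"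
  by (simp add: linear_map_def dual_space_simps fscale_def)

text \<open>The functionals become the basis, and evaluations at \<open>e i\<close> become the dual
  functionals. The expansion of \<open>g\<close> is an equality of functions on the whole type, so
  off the carrier it rests on \<open>g\<close> and all \<open>f i\<close> vanishing there.\<close>

lemma dual_basis_dual_space:
  assumes b: "dual_basis V I e f" and f: "\<And>i. i \<in> I \<Longrightarrow> f i \<in> carrier (dual_space V)"
    and V: "vspace V"
  shows "dual_basis (dual_space V) I f (\<lambda>i g. g (e i))"
proof -
  note D = dual_basisD[OF b]
  have "g x = (\<Sum>i\<in>I. fscale (g (e i)) (f i)) x" if g: "g \<in> carrier (dual_space V)" for g x
  proof (cases "x \<in> carrier V")
    case True
    have "g x = (\<Sum>i\<in>I. g (e i) * f i x)"
    proof (rule dual_basis_linear_eq[OF b V vspace_ground _ _ _ True])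
      show "linear_map V ground g" using g by (simp add: dual_space_simps)
      show "linear_map V ground (\<lambda>x. \<Sum>i\<in>I. g (e i) * f i x)"
        by (intro linear_map_sum_fun vspace_ground linear_form_mult D(4))
      show "g (e i) = (\<Sum>j\<in>I. g (e j) * f j (e i))" if "i \<in> I" for i
      proof -
        have "(\<Sum>j\<in>I. g (e j) * f j (e i)) = (\<Sum>j\<in>I. if i = j then g (e i) else 0)"
          using that by (intro sum.cong) (auto simp: D(5))
        then show ?thesis using that D(2) by simp
      qed
    qed
    then show ?thesis by (simp add: sum_fun_apply fscale_def)
  next
    case False
    then show ?thesis using g f by (simp add: sum_fun_apply fscale_def dual_space_simps)
  qed
  then show ?thesis
    using D f by (auto simp: dual_basis_def dual_family_def dual_space_simps(1) linear_dual_eval)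
qed

text \<open>A maximal independent subset of \<open>S\<close> spans the same space, and its
  coordinate functionals extend to the ambient type. That the basis consists of members of
  \<open>S\<close> matters for local finiteness, where closure properties are first known for the
  members of a spanning set.\<close>

lemma dual_family_exists:
  fixes V :: "('k::field, 'a::ab_group_add, 'z) vspace_scheme"
  assumes V: "vspace V" and S: "finite S" "S \<subseteq> carrier V"
  shows "\<exists>n e f. dual_family V {..<n::nat} e f \<and> e ` {..<n} \<subseteq> S \<and>
    (\<forall>v\<in>module.span (smult V) S. v = (\<Sum>i<n. smult V (f i v) (e i)))"
proof -
  interpret V: vector_space "smult V" using V by (simp add: vspace_def)
  interpret VK: vector_space_pair "smult V" "(*) :: 'k \<Rightarrow> 'k \<Rightarrow> 'k"
    using vector_space_mult by (simp add: vector_space_pair_def V.vector_space_axioms)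
  obtain B where B: "B \<subseteq> S" "V.independent B" "S \<subseteq> V.span B"
    using V.maximal_independent_subset by blast
  have fB: "finite B" using B S finite_subset by blast
  obtain e where e: "bij_betw e {..<card B} B"
    using ex_bij_betw_nat_finite[OF fB] by (auto simp: lessThan_atLeast0)
  let ?I = "{..<card B}"
  have "\<exists>\<phi>. Vector_Spaces.linear (smult V) (*) \<phi> \<and> (\<forall>b\<in>B. \<phi> b = (if b = e i then 1 else 0))" for i
    using VK.linear_independent_extend[OF B(2), of "\<lambda>b. if b = e i then 1 else 0"] by blast
  then obtain f where f: "\<And>i. Vector_Spaces.linear (smult V) (*) (f i)"
    and fe: "\<And>i b. b \<in> B \<Longrightarrow> f i b = (if b = e i then 1 else 0)" by metis
  have eB: "e i \<in> B" if "i \<in> ?I" for i using e that by (auto simp: bij_betw_def)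
  have delta: "f i (e j) = (if i = j then 1 else 0)" if "i \<in> ?I" "j \<in> ?I" for i j
    using that e by (auto simp: fe eB bij_betw_def inj_on_def)
  have add: "f i (x + y) = f i x + f i y" and scale: "f i (smult V c x) = c * f i x" for i x y c
    using f[of i] by (simp_all add: Vector_Spaces.linear_iff)
  have fam: "dual_family V ?I e f"
    unfolding dual_family_def
    using B S eB delta by (auto intro!: linear_mapI simp: add scale)
  have expand: "v = (\<Sum>i\<in>?I. smult V (f i v) (e i))" if "v \<in> V.span B" for v
  proof (rule V.span_induct_alt[OF that])
    show "0 = (\<Sum>i\<in>?I. smult V (f i 0) (e i))"
      using scale[of _ 0 0] by simp
    fix c x y assume x: "x \<in> B" and y: "y = (\<Sum>i\<in>?I. smult V (f i y) (e i))"
    obtain j where j: "j \<in> ?I" "x = e j" using e x by (auto simp: bij_betw_def)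
    have "x = (\<Sum>i\<in>?I. if i = j then e i else 0)" using j by simp
    also have "\<dots> = (\<Sum>i\<in>?I. smult V (f i x) (e i))"
      using j delta by (intro sum.cong) auto
    finally have xs: "(\<Sum>i\<in>?I. smult V (f i x) (e i)) = x" ..
    have "(\<Sum>i\<in>?I. smult V (f i (smult V c x + y)) (e i)) =
        smult V c (\<Sum>i\<in>?I. smult V (f i x) (e i)) + (\<Sum>i\<in>?I. smult V (f i y) (e i))"
      by (simp add: add scale V.scale_left_distrib sum.distrib V.scale_sum_right)
    then show "smult V c x + y = (\<Sum>i\<in>?I. smult V (f i (smult V c x + y)) (e i))"
      using xs y by simp
  qed
  have "V.span S \<subseteq> V.span B" using B(3) V.span_minimal[OF _ V.subspace_span] by blast
  moreover have "e ` ?I \<subseteq> S" using eB B(1) by blast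
  ultimately show ?thesis using fam expand by blast
qed

lemma dual_basis_exists:
  assumes V: "vspace V" and fin: "fin_dim V"
  obtains n :: nat and e f where "dual_basis V {..<n} e f" "\<forall>i\<in>{..<n}. f i \<in> carrier (dual_space V)"
proof -
  obtain S where S: "finite S" "module.span (smult V) S = carrier V"
    using fin by (auto simp: fin_dim_def)
  have "S \<subseteq> carrier V" using S(2) module.span_base[OF vspace_module[OF V]] by blast
  from dual_family_exists[OF V S(1) this] obtain n :: nat and e f
    where b: "dual_basis V {..<n} e f"
    unfolding S(2) dual_basis_def by blast
  \<comment> \<open>Truncation puts the functionals into \<open>dual_space V\<close>, whose elements
    vanish off the carrier; on the carrier nothing changes.\<close>
  define g where "g i = (\<lambda>x. if x \<in> carrier V then f i x else 0)" for i
  have g: "g i x = f i x" if "x \<in> carrier V" for i x using that by (simp add: g_def)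
  have "g i \<in> carrier (dual_space V)" if "i < n" for i
    using dual_basisD(4)[OF b, of i] that
      linear_map_cong[of V ground "f i" "g i", OF _ V g[symmetric]]
    by (simp add: dual_space_simps g_def)
  moreover have "dual_basis V {..<n} e g"
    using b calculation unfolding dual_basis_def dual_family_def
    by (auto simp: g dual_space_simps)
  ultimately show ?thesis using that by blast
qed

lemma dual_basis_fin_dim:
  assumes V: "vspace V" and b: "dual_basis V I e f"
  shows "fin_dim V"
proof -
  interpret V: vector_space "smult V" using V by (simp add: vspace_def)
  note D = dual_basisD[OF b]
  have sub: "V.subspace (carrier V)" using V by (simp add: vspace_def)
  have "V.span (e ` I) \<subseteq> carrier V" using D(3) sub by (intro V.span_minimal) auto
  moreover have "v \<in> V.span (e ` I)" if "v \<in> carrier V" for v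
  proof -
    have "(\<Sum>i\<in>I. smult V (f i v) (e i)) \<in> V.span (e ` I)"
      by (intro V.span_sum V.span_scale V.span_base) auto
    then show ?thesis using D(6)[OF that] by simp
  qed
  ultimately have "V.span (e ` I) = carrier V" by blast
  then show ?thesis using D(2) by (auto simp: fin_dim_def)
qed

text \<open>Write \<open>e i\<close> in the second basis, move the scalars across the tensor sign,
  and resum: the right factors become the expansion of \<open>f' j\<close> in the dual basis
  \<open>f\<close>.\<close>

lemma dual_basis_tensor_invariant:
  assumes b: "dual_basis V I e f" and b': "dual_basis V J e' f'" and V: "vspace V"
    and f: "\<And>i. i \<in> I \<Longrightarrow> f i \<in> carrier (dual_space V)"
    and f': "\<And>i. i \<in> J \<Longrightarrow> f' i \<in> carrier (dual_space V)"
  shows "(\<Sum>i\<in>I. pure V (dual_space V) (e i) (f i)) = (\<Sum>j\<in>J. pure V (dual_space V) (e' j) (f' j))"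
proof -
  note D = dual_basisD[OF b] and D' = dual_basisD[OF b']
  note vs = V vspace_dual_space[of V]
  have "(\<Sum>i\<in>I. pure V (dual_space V) (e i) (f i)) =
      (\<Sum>i\<in>I. pure V (dual_space V) (\<Sum>j\<in>J. smult V (f' j (e i)) (e' j)) (f i))"
    by (intro sum.cong refl) (simp only: D'(6)[OF D(3)])
  also have "\<dots> = (\<Sum>i\<in>I. \<Sum>j\<in>J. pure V (dual_space V) (e' j) (fscale (f' j (e i)) (f i)))"
    by (intro sum.cong refl, subst pure_sum_left[OF V f])
      (auto intro!: vspace_scale[OF V] D'(3) sum.cong
        simp: pure_scale_left f f' D'(3) pure_scale_right[where W = "dual_space V", unfolded dual_space_simps(1)])
  also have "\<dots> = (\<Sum>j\<in>J. \<Sum>i\<in>I. pure V (dual_space V) (e' j) (fscale (f' j (e i)) (f i)))"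
    by (rule sum.swap)
  also have "\<dots> = (\<Sum>j\<in>J. pure V (dual_space V) (e' j) (\<Sum>i\<in>I. fscale (f' j (e i)) (f i)))"
    by (intro sum.cong refl pure_sum_right[OF vs(2), symmetric] D'(3))
      (auto intro!: vspace_scale[OF vs(2), unfolded dual_space_simps(1)] f)
  also have "\<dots> = (\<Sum>j\<in>J. pure V (dual_space V) (e' j) (f' j))"
    using dual_basisD(6)[OF dual_basis_dual_space[OF b f V] f']
    by (intro sum.cong refl) (simp add: dual_space_simps(1))
  finally show ?thesis .
qed

text \<open>\<open>coev\<close> uses a basis picked by \<open>SOME\<close>. A finite generating set
  shows that a basis exists and that the picked one is finite; basis invariance then allows any dual
  basis in its place.\<close>

lemma coev_eq:
  fixes V :: "('k::field, 'a::ab_group_add, 'z) vspace_scheme"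
  assumes b: "dual_basis V I e f" and V: "vspace V"
    and f: "\<And>i. i \<in> I \<Longrightarrow> f i \<in> carrier (dual_space V)"
  shows "coev V = (\<Sum>i\<in>I. pure V (dual_space V) (e i) (f i))"
proof -
  interpret V: vector_space "smult V" using V by (simp add: vspace_def)
  obtain S where S: "finite S" "V.span S = carrier V"
    using dual_basis_fin_dim[OF V b] by (auto simp: fin_dim_def)
  obtain B0 where "B0 \<subseteq> S" "V.independent B0" "S \<subseteq> V.span B0"
    using V.maximal_independent_subset by blast
  then have "basis V B0"
    using S V.span_mono[of B0 S] V.span_minimal[of S "V.span B0"] by (auto simp: basis_def)
  define B where "B = (SOME B. basis V B)"
  have B: "V.independent B" "V.span B = carrier V"
    using someI[of "basis V", OF \<open>basis V B0\<close>, folded B_def] by (simp_all add: basis_def)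
  have fB: "finite B"
    using V.independent_span_bound[OF S(1) B(1)] B(2) S(2) V.span_superset by blast
  have in_B: "b \<in> carrier V" if "b \<in> B" for b using B(2) V.span_base[OF that] by simp
  define r where "r b x = V.representation B x b" for b x
  have r: "r b \<in> carrier (dual_space V)" for b
    unfolding dual_space_simps r_def
    by (auto intro!: linear_mapI simp: B V.representation_add V.representation_scale)
      (simp add: V.representation_def B)
  have "dual_basis V B (\<lambda>b. b) r"
    unfolding dual_basis_def dual_family_def
    using fB in_B r B
    by (auto simp: dual_space_simps r_def V.representation_basis V.sum_representation_eq)
  from dual_basis_tensor_invariant[OF this b V r f]
  show ?thesis by (simp add: coev_def Let_def B_def[symmetric] r_def[abs_def])
qed

section \<open>Coefficient matrices of coactions\<close>

lemma tmap_sum_pure: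
  assumes V: "vspace V" and f: "linear_map V V' f" and g: "linear_map W W' g"
    and "\<And>i. i \<in> I \<Longrightarrow> v i \<in> carrier V" "\<And>i. i \<in> I \<Longrightarrow> w i \<in> carrier W"
  shows "tmap V' W' f g (\<Sum>i\<in>I. pure V W (v i) (w i)) = (\<Sum>i\<in>I. pure V' W' (f (v i)) (g (w i)))"
  using linear_map_sum[OF linear_tmap[OF V f g] vspace_tensor vspace_tensor, of I "\<lambda>i. pure V W (v i) (w i)"] assms
  by (simp add: pure_in tmap_pure[OF f g])

text \<open>The space \<open>C\<close> is arbitrary because the formula serves coactions of
  \<open>H\<close> as well as a comultiplication seen as a right coaction of a coalgebra on itself.
  Rebracketing collects the matrix square of \<open>c\<close> as the coefficient of
  \<open>e i\<close>.\<close>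

lemma coassoc_sum:
  assumes V: "vspace V" and C: "vspace C" and \<delta>: "linear_map V (V \<otimes> C) \<delta>"
    and e: "\<And>i. i \<in> I \<Longrightarrow> e i \<in> carrier V" and c: "\<And>i j. i \<in> I \<Longrightarrow> j \<in> I \<Longrightarrow> c i j \<in> carrier C"
    and \<delta>e: "\<And>j. j \<in> I \<Longrightarrow> \<delta> (e j) = (\<Sum>i\<in>I. pure V C (e i) (c i j))"
    and j: "j \<in> I"
  shows "assoc V C C (tmap (V \<otimes> C) C \<delta> id (\<delta> (e j))) =
    (\<Sum>i\<in>I. pure V (C \<otimes> C) (e i) (\<Sum>k\<in>I. pure C C (c i k) (c k j)))"
proof -
  have "assoc V C C (tmap (V \<otimes> C) C \<delta> id (\<delta> (e j))) =
      assoc V C C (\<Sum>k\<in>I. pure (V \<otimes> C) C (\<delta> (e k)) (c k j))"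
    unfolding \<delta>e[OF j] using tmap_sum_pure[OF V \<delta> linear_map_id[of C], of I e "\<lambda>k. c k j"] e c j
    by simp
  also have "\<dots> = (\<Sum>k\<in>I. assoc V C C (pure (V \<otimes> C) C (\<delta> (e k)) (c k j)))"
    by (rule linear_map_sum[OF linear_assoc[OF V C] vspace_tensor vspace_tensor])
      (intro pure_in linear_map_in[OF \<delta>] e c j)
  also have "\<dots> = (\<Sum>k\<in>I. \<Sum>i\<in>I. pure V (C \<otimes> C) (e i) (pure C C (c i k) (c k j)))"
  proof (rule sum.cong[OF refl])
    fix k assume k: "k \<in> I"
    have "assoc V C C (pure (V \<otimes> C) C (\<delta> (e k)) (c k j)) =
        assoc V C C (\<Sum>i\<in>I. pure (V \<otimes> C) C (pure V C (e i) (c i k)) (c k j))"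
      unfolding \<delta>e[OF k] using e c j k by (subst pure_sum_left[OF vspace_tensor]) (auto simp: pure_in)
    also have "\<dots> = (\<Sum>i\<in>I. assoc V C C (pure (V \<otimes> C) C (pure V C (e i) (c i k)) (c k j)))"
      by (rule linear_map_sum[OF linear_assoc[OF V C] vspace_tensor vspace_tensor])
        (intro pure_in e c j k)
    also have "\<dots> = (\<Sum>i\<in>I. pure V (C \<otimes> C) (e i) (pure C C (c i k) (c k j)))"
      by (intro sum.cong refl assoc_pure[OF V C] c j k)
    finally show "assoc V C C (pure (V \<otimes> C) C (\<delta> (e k)) (c k j)) =
        (\<Sum>i\<in>I. pure V (C \<otimes> C) (e i) (pure C C (c i k) (c k j)))" .
  qed
  also have "\<dots> = (\<Sum>i\<in>I. \<Sum>k\<in>I. pure V (C \<otimes> C) (e i) (pure C C (c i k) (c k j)))"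
    by (rule sum.swap)
  also have "\<dots> = (\<Sum>i\<in>I. pure V (C \<otimes> C) (e i) (\<Sum>k\<in>I. pure C C (c i k) (c k j)))"
    by (intro sum.cong refl pure_sum_right[OF vspace_tensor, symmetric] pure_in e c j)
  finally show ?thesis .
qed

text \<open>Coassociativity and the counit law at \<open>e j\<close> are compared coefficient by
  coefficient, by contraction with the functional dual to \<open>e i\<close>. The axioms enter only
  at the \<open>e j\<close>, so a basis of a stable subspace can be used.\<close>

lemma coefficient_matrix:
  assumes V: "vspace V" and C: "vspace C" and \<delta>: "linear_map V (V \<otimes> C) \<delta>"
    and \<Delta>: "linear_map C (C \<otimes> C) \<Delta>" and \<epsilon>: "linear_map C ground \<epsilon>"
    and b: "dual_family V I e f" and c: "\<And>i j. i \<in> I \<Longrightarrow> j \<in> I \<Longrightarrow> c i j \<in> carrier C"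
    and \<delta>e: "\<And>j. j \<in> I \<Longrightarrow> \<delta> (e j) = (\<Sum>i\<in>I. pure V C (e i) (c i j))"
    and coassoc: "\<And>j. j \<in> I \<Longrightarrow> assoc V C C (tmap (V \<otimes> C) C \<delta> id (\<delta> (e j))) =
      tmap V (C \<otimes> C) id \<Delta> (\<delta> (e j))"
    and counit: "\<And>j. j \<in> I \<Longrightarrow> tmap V ground id \<epsilon> (\<delta> (e j)) = pure V ground (e j) 1"
    and ij: "i \<in> I" "j \<in> I"
  shows "\<Delta> (c i j) = (\<Sum>k\<in>I. pure C C (c i k) (c k j))" and "\<epsilon> (c i j) = (if i = j then 1 else 0)"
proof -
  note D = dual_familyD[OF b]
  have "(\<Sum>i\<in>I. pure V (C \<otimes> C) (e i) (\<Delta> (c i j))) =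
      (\<Sum>i\<in>I. pure V (C \<otimes> C) (e i) (\<Sum>k\<in>I. pure C C (c i k) (c k j)))"
    using coassoc[OF ij(2)] coassoc_sum[OF V C \<delta> D(2) c \<delta>e ij(2)]
      tmap_sum_pure[OF V linear_map_id[of V] \<Delta>, of I e "\<lambda>i. c i j"] D(2) c ij(2) \<delta>e
    by simp
  from arg_cong[where f = "lslice V (C \<otimes> C) (f i)", OF this]
  show "\<Delta> (c i j) = (\<Sum>k\<in>I. pure C C (c i k) (c k j))"
    using dual_family_lslice[OF b vspace_tensor _ ij(1), of "\<lambda>i. \<Delta> (c i j)" C C]
      dual_family_lslice[OF b vspace_tensor _ ij(1), of "\<lambda>i. \<Sum>k\<in>I. pure C C (c i k) (c k j)" C C]
    by (simp only: linear_map_in[OF \<Delta> c[OF _ ij(2)]] vspace_sum[OF vspace_tensor] pure_in c ij)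
  have "(\<Sum>i\<in>I. pure V ground (e i) (\<epsilon> (c i j))) = pure V ground (e j) 1"
    using counit[OF ij(2)] tmap_sum_pure[OF V linear_map_id[of V] \<epsilon>, of I e "\<lambda>i. c i j"] D(2) c ij(2) \<delta>e
    by simp
  from arg_cong[where f = "lslice V ground (f i)", OF this]
  show "\<epsilon> (c i j) = (if i = j then 1 else 0)"
    using dual_family_lslice[OF b vspace_ground _ ij(1), of "\<lambda>i. \<epsilon> (c i j)"]
      lslice_pure[OF vspace_ground D(3)[OF ij(1)] D(2)[OF ij(2)], of 1] D(4)[OF ij]
    by simp
qed

section \<open>Matrix coalgebras in a Hopf algebra\<close>

locale hopf_alg =
  fixes H :: "('k::field, 'h::ab_group_add) hopf"
  assumes hopf_algebra: "hopf_algebra H"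
begin

section \<open>Arithmetic in H and in H \<otimes> H\<close>

abbreviation mul (infixl "\<odot>" 75) where "a \<odot> b \<equiv> hmult H (pure H H a b)"
abbreviation one where "one \<equiv> hunit H 1"
abbreviation "S \<equiv> antipode H"
abbreviation "\<Delta> \<equiv> hcomult H"
abbreviation "\<epsilon> \<equiv> hcounit H"

lemma vspace_H: "vspace H" and linear_mult: "linear_map (H \<otimes> H) H (hmult H)"
  and linear_unit: "linear_map ground H (hunit H)"
  and linear_comult: "linear_map H (H \<otimes> H) \<Delta>" and linear_counit: "linear_map H ground \<epsilon>"
  and linear_antipode: "linear_map H H S"
  and comult_one: "\<Delta> one = pure H H one one" and counit_one: "\<epsilon> one = 1"
  using hopf_algebra by (simp_all add: hopf_algebra_def algebra_def coalgebra_def)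

lemmas antipode_in = linear_map_in[OF linear_antipode]
  and comult_in = linear_map_in[OF linear_comult]

lemma one_in: "one \<in> carrier H"
  using linear_map_in[OF linear_unit, of 1] by simp

lemma hunit_eq: "hunit H c = smult H c one"
  using linear_map_scale[OF linear_unit, of 1 c] by simp

lemma mul_in: "a \<in> carrier H \<Longrightarrow> b \<in> carrier H \<Longrightarrow> a \<odot> b \<in> carrier H"
  by (intro linear_map_in[OF linear_mult] pure_in)

lemma mul_one: "a \<in> carrier H \<Longrightarrow> one \<odot> a = a" "a \<in> carrier H \<Longrightarrow> a \<odot> one = a"
  using hopf_algebra by (simp_all add: hopf_algebra_def algebra_def)

lemma mul_assoc:
  assumes "a \<in> carrier H" "b \<in> carrier H" "c \<in> carrier H"
  shows "a \<odot> b \<odot> c = a \<odot> (b \<odot> c)"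
proof -
  let ?t = "pure (H \<otimes> H) H (pure H H a b) c"
  have "?t \<in> carrier ((H \<otimes> H) \<otimes> H)" using assms by (intro pure_in)
  then have "hmult H (tmap H H (hmult H) id ?t) = hmult H (tmap H H id (hmult H) (assoc H H H ?t))"
    using hopf_algebra by (simp add: hopf_algebra_def algebra_def)
  then show ?thesis
    by (simp add: tmap_pure[OF linear_mult linear_map_id] assoc_pure[OF vspace_H vspace_H assms(3)]
        tmap_pure[OF linear_map_id linear_mult])
qed

lemma bilinear_mul: "bilinear_map H H H (\<lambda>a b. a \<odot> b)"
  by (rule bilinear_map_comp_out[OF bilinear_pure linear_mult])

lemmas linear_mul_left = bilinear_map_left[OF bilinear_mul]
  and linear_mul_right = bilinear_map_right[OF bilinear_mul]

lemma mul_sum_left: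
  "b \<in> carrier H \<Longrightarrow> (\<And>i. i \<in> I \<Longrightarrow> x i \<in> carrier H) \<Longrightarrow> (\<Sum>i\<in>I. x i) \<odot> b = (\<Sum>i\<in>I. x i \<odot> b)"
  by (rule linear_map_sum[OF linear_mul_left vspace_H vspace_H])

lemma mul_sum_right:
  "a \<in> carrier H \<Longrightarrow> (\<And>i. i \<in> I \<Longrightarrow> x i \<in> carrier H) \<Longrightarrow> a \<odot> (\<Sum>i\<in>I. x i) = (\<Sum>i\<in>I. a \<odot> x i)"
  by (rule linear_map_sum[OF linear_mul_right vspace_H vspace_H])

lemma mul_zero: "a \<in> carrier H \<Longrightarrow> 0 \<odot> a = 0" "a \<in> carrier H \<Longrightarrow> a \<odot> 0 = 0"
  using linear_map_zero[OF linear_mul_left vspace_H vspace_H]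
    linear_map_zero[OF linear_mul_right vspace_H vspace_H] by auto

lemma counit_mul: "a \<in> carrier H \<Longrightarrow> b \<in> carrier H \<Longrightarrow> \<epsilon> (a \<odot> b) = \<epsilon> a * \<epsilon> b"
  using hopf_algebra by (simp add: hopf_algebra_def)

text \<open>The algebra structure of H \<otimes> H, written as the composite that occurs in
  \<open>hopf_algebra\<close>, so that multiplicativity of \<Delta> becomes
  \<open>comult_mul\<close>.\<close>

definition tmul :: "('k, 'h, 'h) tensor \<Rightarrow> ('k, 'h, 'h) tensor \<Rightarrow> ('k, 'h, 'h) tensor" where
  "tmul s t = tmap H H (hmult H) (hmult H) (interchange H H H H (pure (H \<otimes> H) (H \<otimes> H) s t))"

lemma tmul_pure:
  assumes "a \<in> carrier H" "b \<in> carrier H" "c \<in> carrier H" "d \<in> carrier H"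
  shows "tmul (pure H H a b) (pure H H c d) = pure H H (a \<odot> c) (b \<odot> d)"
  unfolding tmul_def
  by (simp add: interchange_pure vspace_H assms tmap_pure[OF linear_mult linear_mult])

lemma bilinear_tmul: "bilinear_map (H \<otimes> H) (H \<otimes> H) (H \<otimes> H) tmul"
  unfolding tmul_def[abs_def]
  by (rule bilinear_map_comp_out[OF bilinear_pure linear_map_comp[OF
        linear_interchange[OF vspace_H vspace_H vspace_H vspace_H]
        linear_tmap[OF vspace_tensor linear_mult linear_mult]]])

lemmas linear_tmul_left = bilinear_map_left[OF bilinear_tmul]
  and linear_tmul_right = bilinear_map_right[OF bilinear_tmul]

lemma tmul_in: "s \<in> carrier (H \<otimes> H) \<Longrightarrow> t \<in> carrier (H \<otimes> H) \<Longrightarrow> tmul s t \<in> carrier (H \<otimes> H)"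
  by (rule linear_map_in[OF linear_tmul_right])

lemma tmul_sum_left:
  "t \<in> carrier (H \<otimes> H) \<Longrightarrow> (\<And>i. i \<in> I \<Longrightarrow> x i \<in> carrier (H \<otimes> H)) \<Longrightarrow>
    tmul (\<Sum>i\<in>I. x i) t = (\<Sum>i\<in>I. tmul (x i) t)"
  by (rule linear_map_sum[OF linear_tmul_left vspace_tensor vspace_tensor])

lemma tmul_sum_right:
  "t \<in> carrier (H \<otimes> H) \<Longrightarrow> (\<And>i. i \<in> I \<Longrightarrow> x i \<in> carrier (H \<otimes> H)) \<Longrightarrow>
    tmul t (\<Sum>i\<in>I. x i) = (\<Sum>i\<in>I. tmul t (x i))"
  by (rule linear_map_sum[OF linear_tmul_right vspace_tensor vspace_tensor])

lemma tmul_one: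
  assumes "t \<in> carrier (H \<otimes> H)"
  shows "tmul (pure H H one one) t = t" and "tmul t (pure H H one one) = t"
proof -
  have 1: "pure H H one one \<in> carrier (H \<otimes> H)" by (intro pure_in one_in)
  show "tmul (pure H H one one) t = t"
    by (rule tensor_linear_eq[OF linear_tmul_right[OF 1] linear_map_ident vspace_H vspace_tensor _ assms])
      (simp add: tmul_pure one_in mul_one)
  show "tmul t (pure H H one one) = t"
    by (rule tensor_linear_eq[OF linear_tmul_left[OF 1] linear_map_ident vspace_H vspace_tensor _ assms])
      (simp add: tmul_pure one_in mul_one)
qed

lemma tmul_assoc:
  assumes r: "r \<in> carrier (H \<otimes> H)" and s: "s \<in> carrier (H \<otimes> H)" and t: "t \<in> carrier (H \<otimes> H)"
  shows "tmul (tmul r s) t = tmul r (tmul s t)"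
  by (rule tensor_bilinear_assoc[OF vspace_H bilinear_tmul _ assms])
    (simp add: tmul_pure mul_in mul_assoc)

lemma comult_mul:
  assumes "a \<in> carrier H" "b \<in> carrier H"
  shows "\<Delta> (a \<odot> b) = tmul (\<Delta> a) (\<Delta> b)"
proof -
  have "\<Delta> (a \<odot> b) = tmap H H (hmult H) (hmult H)
      (interchange H H H H (tmap (H \<otimes> H) (H \<otimes> H) \<Delta> \<Delta> (pure H H a b)))"
    using hopf_algebra pure_in[OF assms] by (simp add: hopf_algebra_def)
  then show ?thesis by (simp add: tmap_pure[OF linear_comult linear_comult] tmul_def)
qed

text \<open>The matrix of a comodule, detached from any vector space. Tensor products, duals and
  copies of comodules become the Kronecker product, the transposed antipode matrix, and the same
  matrix on K^n.\<close>

definition comatrix :: "'i set \<Rightarrow> ('i \<Rightarrow> 'i \<Rightarrow> 'h) \<Rightarrow> bool" where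
  "comatrix I c \<longleftrightarrow> finite I \<and> (\<forall>i\<in>I. \<forall>j\<in>I. c i j \<in> carrier H \<and>
     \<Delta> (c i j) = (\<Sum>k\<in>I. pure H H (c i k) (c k j)) \<and> \<epsilon> (c i j) = (if i = j then 1 else 0))"

lemma comatrixD:
  assumes "comatrix I c"
  shows "finite I" and "i \<in> I \<Longrightarrow> j \<in> I \<Longrightarrow> c i j \<in> carrier H"
    and "i \<in> I \<Longrightarrow> j \<in> I \<Longrightarrow> \<Delta> (c i j) = (\<Sum>k\<in>I. pure H H (c i k) (c k j))"
    and "i \<in> I \<Longrightarrow> j \<in> I \<Longrightarrow> \<epsilon> (c i j) = (if i = j then 1 else 0)"
  using assms by (auto simp: comatrix_def)

lemma comatrix_antipode:
  assumes c: "comatrix I c" and ij: "i \<in> I" "j \<in> I"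
  shows "(\<Sum>k\<in>I. S (c i k) \<odot> c k j) = (if i = j then one else 0)"
    and "(\<Sum>k\<in>I. c i k \<odot> S (c k j)) = (if i = j then one else 0)"
proof -
  note D = comatrixD[OF c]
  have u: "hunit H (\<epsilon> (c i j)) = (if i = j then one else 0)"
    by (simp add: D(4) ij hunit_eq[of "0"] vspace_smult_simps[OF vspace_H])
  have *: "hmult H (\<Sum>k\<in>I. pure H H (f (c i k)) (g (c k j))) = (\<Sum>k\<in>I. f (c i k) \<odot> g (c k j))"
    if "linear_map H H f" "linear_map H H g" for f g
    by (rule linear_map_sum[OF linear_mult vspace_tensor vspace_H])
      (intro pure_in linear_map_in[OF that(1)] linear_map_in[OF that(2)] D(2) ij)
  have "hmult H (tmap H H S id (\<Delta> (c i j))) = hunit H (\<epsilon> (c i j))"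
    and "hmult H (tmap H H id S (\<Delta> (c i j))) = hunit H (\<epsilon> (c i j))"
    using hopf_algebra D(2)[OF ij] by (simp_all add: hopf_algebra_def)
  then show "(\<Sum>k\<in>I. S (c i k) \<odot> c k j) = (if i = j then one else 0)"
    and "(\<Sum>k\<in>I. c i k \<odot> S (c k j)) = (if i = j then one else 0)"
    using *[OF linear_antipode linear_map_id] *[OF linear_map_id linear_antipode]
    by (simp_all add: u D(3) ij tmap_sum_pure[OF vspace_H linear_antipode linear_map_id] D(2)
        tmap_sum_pure[OF vspace_H linear_map_id linear_antipode])
qed

text \<open>The Kronecker product: \<Delta> is multiplicative, and each factor contributes its own
  summation index.\<close>

lemma comatrix_prod:
  assumes c: "comatrix I c" and d: "comatrix J d"
  shows "comatrix (I \<times> J) (\<lambda>p q. c (fst p) (fst q) \<odot> d (snd p) (snd q))"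
proof -
  note C = comatrixD[OF c] and D = comatrixD[OF d]
  have "\<Delta> (c i k \<odot> d j l) = (\<Sum>r\<in>I\<times>J. pure H H (c i (fst r) \<odot> d j (snd r)) (c (fst r) k \<odot> d (snd r) l))"
    if "i \<in> I" "k \<in> I" "j \<in> J" "l \<in> J" for i j k l
  proof -
    have "\<Delta> (c i k \<odot> d j l) =
        tmul (\<Sum>r\<in>I. pure H H (c i r) (c r k)) (\<Sum>s\<in>J. pure H H (d j s) (d s l))"
      using that by (simp add: comult_mul C D)
    also have "\<dots> = (\<Sum>r\<in>I. \<Sum>s\<in>J. tmul (pure H H (c i r) (c r k)) (pure H H (d j s) (d s l)))"
      by (intro bilinear_map_sum[OF bilinear_tmul vspace_tensor vspace_tensor vspace_tensor] pure_in
          C(2) D(2) that)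
    also have "\<dots> = (\<Sum>r\<in>I. \<Sum>s\<in>J. pure H H (c i r \<odot> d j s) (c r k \<odot> d s l))"
      by (intro sum.cong refl tmul_pure C(2) D(2) that)
    finally show ?thesis by (simp add: sum.cartesian_product case_prod_unfold)
  qed
  then show ?thesis
    unfolding comatrix_def
    using C D by (auto simp: mul_in counit_mul)
qed

text \<open>
  The matrices \<open>(\<Delta> (S c\<^sub>i\<^sub>j))\<close> and \<open>(\<Sum>\<^sub>k S c\<^sub>k\<^sub>j \<otimes> S c\<^sub>i\<^sub>k)\<close> over \<open>H \<otimes> H\<close> are a left and a right
  inverse of \<open>(\<Delta> c\<^sub>i\<^sub>j)\<close>, so they agree.
\<close>

lemma comult_antipode:
  assumes c: "comatrix I c" and ij: "i \<in> I" "j \<in> I"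
  shows "\<Delta> (S (c i j)) = (\<Sum>k\<in>I. pure H H (S (c k j)) (S (c i k)))"
proof -
  note D = comatrixD[OF c]
  define M where "M i j = \<Delta> (c i j)" for i j
  define L where "L i j = \<Delta> (S (c i j))" for i j
  define R where "R i j = (\<Sum>k\<in>I. pure H H (S (c k j)) (S (c i k)))" for i j
  define e where "e i j = (if i = j then pure H H one one else 0)" for i j :: 'a
  have M_in: "M i j \<in> carrier (H \<otimes> H)" and L_in: "L i j \<in> carrier (H \<otimes> H)"
    and R_in: "R i j \<in> carrier (H \<otimes> H)" if "i \<in> I" "j \<in> I" for i j
    unfolding M_def L_def R_def using that
    by (auto intro!: comult_in antipode_in vspace_sum[OF vspace_tensor] pure_in D(2))
  have LM: "(\<Sum>k\<in>I. tmul (L i k) (M k j)) = e i j" if ij: "i \<in> I" "j \<in> I" for i j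
  proof -
    have "(\<Sum>k\<in>I. tmul (L i k) (M k j)) = (\<Sum>k\<in>I. \<Delta> (S (c i k) \<odot> c k j))"
      unfolding L_def M_def by (intro sum.cong refl comult_mul[symmetric] antipode_in D(2) ij)
    also have "\<dots> = \<Delta> (\<Sum>k\<in>I. S (c i k) \<odot> c k j)"
      by (intro linear_map_sum[OF linear_comult vspace_H vspace_tensor, symmetric] mul_in antipode_in
          D(2) ij)
    also have "\<dots> = e i j"
      by (simp add: comatrix_antipode[OF c ij] e_def comult_one
          linear_map_zero[OF linear_comult vspace_H vspace_tensor])
    finally show ?thesis .
  qed
  have MR: "(\<Sum>k\<in>I. tmul (M i k) (R k j)) = e i j" if ij: "i \<in> I" "j \<in> I" for i j
  proof -
    have "(\<Sum>k\<in>I. tmul (M i k) (R k j)) =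
        (\<Sum>k\<in>I. \<Sum>m\<in>I. \<Sum>l\<in>I. pure H H (c i m \<odot> S (c l j)) (c m k \<odot> S (c k l)))"
    proof (rule sum.cong[OF refl])
      fix k assume k: "k \<in> I"
      have "tmul (M i k) (R k j) =
          (\<Sum>m\<in>I. \<Sum>l\<in>I. tmul (pure H H (c i m) (c m k)) (pure H H (S (c l j)) (S (c k l))))"
        unfolding M_def D(3)[OF ij(1) k] R_def
        by (intro bilinear_map_sum[OF bilinear_tmul vspace_tensor vspace_tensor vspace_tensor] pure_in
            antipode_in D(2) ij k)
      also have "\<dots> = (\<Sum>m\<in>I. \<Sum>l\<in>I. pure H H (c i m \<odot> S (c l j)) (c m k \<odot> S (c k l)))"
        by (intro sum.cong refl tmul_pure antipode_in D(2) ij k)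
      finally show "tmul (M i k) (R k j) =
        (\<Sum>m\<in>I. \<Sum>l\<in>I. pure H H (c i m \<odot> S (c l j)) (c m k \<odot> S (c k l)))" .
    qed
    \<comment> \<open>The sum over \<open>k\<close> touches only the right tensor factor, where it
      gives the Kronecker delta of \<open>m\<close> and \<open>l\<close>; the remaining sum over
      \<open>m\<close> then contracts the left factor.\<close>
    also have "\<dots> = (\<Sum>m\<in>I. \<Sum>l\<in>I. \<Sum>k\<in>I. pure H H (c i m \<odot> S (c l j)) (c m k \<odot> S (c k l)))"
      by (subst sum.swap) (intro sum.cong refl sum.swap)
    also have "\<dots> = (\<Sum>m\<in>I. \<Sum>l\<in>I. pure H H (c i m \<odot> S (c l j)) (\<Sum>k\<in>I. c m k \<odot> S (c k l)))"
      by (intro sum.cong refl pure_sum_right[OF vspace_H, symmetric] mul_in antipode_in D(2) ij)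
    also have "\<dots> = (\<Sum>m\<in>I. \<Sum>l\<in>I. if m = l then pure H H (c i m \<odot> S (c l j)) one else 0)"
      by (intro sum.cong refl)
        (simp add: comatrix_antipode[OF c] pure_zero_right[OF vspace_H] mul_in antipode_in D(2) ij)
    also have "\<dots> = (\<Sum>m\<in>I. pure H H (c i m \<odot> S (c m j)) one)"
      using D(1) by simp
    also have "\<dots> = pure H H (\<Sum>m\<in>I. c i m \<odot> S (c m j)) one"
      by (intro pure_sum_left[OF vspace_H, symmetric] mul_in antipode_in D(2) ij one_in)
    also have "\<dots> = e i j"
      by (simp add: comatrix_antipode[OF c ij] e_def pure_zero_left[OF vspace_H one_in])
    finally show ?thesis .
  qed
  \<comment> \<open>The computation L = L(MR) = (LM)R = R, with the identity matrix over H \<otimes>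
    H written through conditionals.\<close>
  have "L i j = (\<Sum>k\<in>I. if k = j then tmul (L i k) (pure H H one one) else 0)"
    using D(1) ij by (simp add: tmul_one L_in)
  also have "\<dots> = (\<Sum>k\<in>I. tmul (L i k) (e k j))"
    by (intro sum.cong refl)
      (simp add: e_def linear_map_zero[OF linear_tmul_right[OF L_in] vspace_tensor vspace_tensor] ij)
  also have "\<dots> = (\<Sum>k\<in>I. \<Sum>l\<in>I. tmul (L i k) (tmul (M k l) (R l j)))"
    by (intro sum.cong refl, subst MR[symmetric])
      (auto intro!: tmul_sum_right tmul_in L_in M_in R_in ij)
  also have "\<dots> = (\<Sum>l\<in>I. \<Sum>k\<in>I. tmul (tmul (L i k) (M k l)) (R l j))"
    by (subst sum.swap) (intro sum.cong refl tmul_assoc[symmetric] L_in M_in R_in ij)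
  also have "\<dots> = (\<Sum>l\<in>I. tmul (e i l) (R l j))"
    by (intro sum.cong refl, subst LM[symmetric])
      (auto intro!: tmul_sum_left[symmetric] tmul_in L_in M_in R_in ij)
  also have "\<dots> = (\<Sum>l\<in>I. if i = l then tmul (pure H H one one) (R l j) else 0)"
    by (intro sum.cong refl)
      (simp add: e_def linear_map_zero[OF linear_tmul_left[OF R_in] vspace_tensor vspace_tensor] ij)
  also have "\<dots> = R i j"
    using D(1) ij by (simp add: tmul_one R_in)
  finally show ?thesis by (simp add: L_def R_def)
qed

text \<open>\<Delta> after S reverses the tensor order, and the transposition undoes this. For the
  counit, \<epsilon> is applied to S(c) c = 1, where \<epsilon>(c) is the identity matrix.\<close>

lemma comatrix_dual:
  assumes c: "comatrix I c"
  shows "comatrix I (\<lambda>i j. S (c j i))"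
proof -
  note D = comatrixD[OF c]
  have "\<epsilon> (S (c j i)) = (if i = j then 1 else 0)" if ij: "i \<in> I" "j \<in> I" for i j
  proof -
    have "\<epsilon> (S (c j i)) = (\<Sum>k\<in>I. if k = i then \<epsilon> (S (c j k)) else 0)" using D(1) ij by simp
    also have "\<dots> = (\<Sum>k\<in>I. \<epsilon> (S (c j k) \<odot> c k i))"
      by (intro sum.cong refl) (simp add: counit_mul antipode_in D(2,4) ij)
    also have "\<dots> = \<epsilon> (\<Sum>k\<in>I. S (c j k) \<odot> c k i)"
      by (intro linear_map_sum[OF linear_counit vspace_H vspace_ground, symmetric] mul_in antipode_in
          D(2) ij)
    also have "\<dots> = (if i = j then 1 else 0)"
      by (simp add: comatrix_antipode[OF c] ij counit_one
          linear_map_zero[OF linear_counit vspace_H vspace_ground])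
    finally show ?thesis .
  qed
  then show ?thesis
    unfolding comatrix_def using D by (auto simp: antipode_in comult_antipode[OF c])
qed

end

section \<open>Comodules given by matrices\<close>

text \<open>Comodules and algebras are records extending \<open>vspace\<close>, while
  \<open>pure\<close> and \<otimes> read only \<open>carrier\<close> and \<open>smult\<close>.
  Congruences of this kind exchange, say, \<open>tensor_comod H V W\<close> and V \<otimes> W inside
  such terms although the records differ.\<close>

lemma vspace_eq_cong:
  assumes "carrier V = carrier V'" "smult V = smult V'"
  shows "vspace V \<longleftrightarrow> vspace V'" and "linear_map V W g \<longleftrightarrow> linear_map V' W g"
    and "linear_map U V h \<longleftrightarrow> linear_map U V' h"
  using assms by (simp_all add: vspace_def linear_map_def)

lemma pure_cong:
  assumes "carrier V = carrier V'" "smult V = smult V'" "carrier W = carrier W'" "smult W = smult W'"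
  shows "pure V W = pure V' W'"
  using assms by (simp add: fun_eq_iff pure_def functional_on_def bilinear_map_def linear_map_def)

lemma tensor_cong:
  assumes "carrier V = carrier V'" "smult V = smult V'" "carrier W = carrier W'" "smult W = smult W'"
  shows "V \<otimes> W = V' \<otimes> W'"
  using assms by (simp add: tensor_def pure_cong[OF assms])

lemma dual_basis_cong:
  assumes "carrier V = carrier V'" "smult V = smult V'"
  shows "dual_basis V I e f \<longleftrightarrow> dual_basis V' I e f"
  using assms by (simp add: dual_basis_def dual_family_def vspace_eq_cong(2)[OF assms])

context hopf_alg
begin

text \<open>The comodule axioms are absent on purpose: they follow from \<open>comatrix\<close>, so
  a comodule can be built by giving a matrix.\<close>

definition has_matrix ::
  "('k, 'a::ab_group_add, 'h, 'z) comod_scheme \<Rightarrow> 'i set \<Rightarrow> ('i \<Rightarrow> 'a) \<Rightarrow> ('i \<Rightarrow> 'a \<Rightarrow> 'k)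
    \<Rightarrow> ('i \<Rightarrow> 'i \<Rightarrow> 'h) \<Rightarrow> bool" where
  "has_matrix V I e f c \<longleftrightarrow> vspace V \<and> dual_basis V I e f \<and> comatrix I c \<and>
     linear_map V (V \<otimes> H) (coact V) \<and>
     (\<forall>j\<in>I. coact V (e j) = (\<Sum>i\<in>I. pure V H (e i) (c i j)))"

lemma has_matrixD:
  assumes "has_matrix V I e f c"
  shows "vspace V" and "dual_basis V I e f" and "comatrix I c"
    and "linear_map V (V \<otimes> H) (coact V)"
    and "j \<in> I \<Longrightarrow> coact V (e j) = (\<Sum>i\<in>I. pure V H (e i) (c i j))"
  using assms by (auto simp: has_matrix_def)

lemma has_matrix_cong:
  assumes "carrier V = carrier V'" "smult V = smult V'" "coact V = coact V'"
  shows "has_matrix V I e f c \<longleftrightarrow> has_matrix V' I e f c"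
  by (simp add: has_matrix_def vspace_eq_cong[OF assms(1,2)] dual_basis_cong[OF assms(1,2)]
      pure_cong[OF assms(1,2) refl refl] tensor_cong[OF assms(1,2) refl refl] assms(3))

text \<open>Both axioms are linear in the vector; on a basis they are the comultiplication and
  counit rules of the matrix.\<close>

lemma has_matrix_comodule:
  assumes m: "has_matrix V I e f c"
  shows "comodule H V"
proof -
  note V = has_matrixD(1)[OF m] and b = has_matrixD(2)[OF m] and lin = has_matrixD(4)[OF m]
    and ce = has_matrixD(5)[OF m]
  note B = dual_basisD[OF b] and C = comatrixD[OF has_matrixD(3)[OF m]]
  have "assoc V H H (tmap (V \<otimes> H) H (coact V) id (coact V v)) = tmap V (H \<otimes> H) id \<Delta> (coact V v)"
    if v: "v \<in> carrier V" for v
  proof (rule dual_basis_linear_eq[OF b V vspace_tensor _ _ _ v])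
    show "linear_map V (V \<otimes> (H \<otimes> H)) (\<lambda>v. assoc V H H (tmap (V \<otimes> H) H (coact V) id (coact V v)))"
      by (rule linear_map_comp[OF linear_map_comp[OF lin linear_tmap[OF V lin linear_map_id]]
            linear_assoc[OF V vspace_H]])
    show "linear_map V (V \<otimes> (H \<otimes> H)) (\<lambda>v. tmap V (H \<otimes> H) id \<Delta> (coact V v))"
      by (rule linear_map_comp[OF lin linear_tmap[OF V linear_map_id linear_comult]])
    fix j assume j: "j \<in> I"
    have "assoc V H H (tmap (V \<otimes> H) H (coact V) id (coact V (e j))) =
      (\<Sum>i\<in>I. pure V (H \<otimes> H) (e i) (\<Sum>k\<in>I. pure H H (c i k) (c k j)))"
      by (rule coassoc_sum[OF V vspace_H lin B(3) C(2) ce j])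
    also have "\<dots> = tmap V (H \<otimes> H) id \<Delta> (coact V (e j))"
      using tmap_sum_pure[OF V linear_map_id[of V] linear_comult, of I e "\<lambda>i. c i j"]
      by (simp add: ce j B(3) C(2,3))
    finally show "assoc V H H (tmap (V \<otimes> H) H (coact V) id (coact V (e j))) =
      tmap V (H \<otimes> H) id \<Delta> (coact V (e j))" .
  qed
  moreover have "tmap V ground id \<epsilon> (coact V v) = pure V ground v 1" if v: "v \<in> carrier V" for v
  proof (rule dual_basis_linear_eq[OF b V vspace_tensor _ _ _ v])
    show "linear_map V (V \<otimes> ground) (\<lambda>v. tmap V ground id \<epsilon> (coact V v))"
      by (rule linear_map_comp[OF lin linear_tmap[OF V linear_map_id linear_counit]])
    show "linear_map V (V \<otimes> ground) (\<lambda>v. pure V ground v 1)"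
      by (rule linear_pure_left) simp
    fix j assume j: "j \<in> I"
    have "tmap V ground id \<epsilon> (coact V (e j)) = (\<Sum>i\<in>I. pure V ground (e i) (\<epsilon> (c i j)))"
      using tmap_sum_pure[OF V linear_map_id[of V] linear_counit, of I e "\<lambda>i. c i j"]
      by (simp add: ce j B(3) C(2))
    also have "\<dots> = (\<Sum>i\<in>I. if i = j then pure V ground (e i) 1 else 0)"
      by (intro sum.cong refl) (simp add: C(4) j B(3) pure_zero_right[OF vspace_ground])
    also have "\<dots> = pure V ground (e j) 1" using j B(2) by simp
    finally show "tmap V ground id \<epsilon> (coact V (e j)) = pure V ground (e j) 1" .
  qed
  ultimately show ?thesis using V lin by (simp add: comodule_def)
qed

lemma comoduleD:
  assumes "comodule H V"
  shows "vspace V" and "linear_map V (V \<otimes> H) (coact V)"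
  using assms by (simp_all add: comodule_def)

text \<open>Stated for a dual family because it is also applied to a basis of a finite dimensional
  subcomodule of a coalgebra.\<close>

lemma comatrix_of_coaction:
  assumes V: "comodule H V" and b: "dual_family V I e f"
    and c: "\<And>i j. i \<in> I \<Longrightarrow> j \<in> I \<Longrightarrow> c i j \<in> carrier H"
    and ce: "\<And>j. j \<in> I \<Longrightarrow> coact V (e j) = (\<Sum>i\<in>I. pure V H (e i) (c i j))"
  shows "comatrix I c"
  using coefficient_matrix[OF comoduleD(1)[OF V] vspace_H comoduleD(2)[OF V] linear_comult
      linear_counit b c ce] V dual_familyD[OF b] c
  by (auto simp: comatrix_def comodule_def)

lemma comodule_has_matrix:
  assumes V: "comodule H V" and b: "dual_basis V I e f"
  obtains c where "has_matrix V I e f c"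
proof -
  note lin = comoduleD(2)[OF V]
  note B = dual_basisD[OF b]
  define c where "c i j = lslice V H (f i) (coact V (e j))" for i j
  have c: "c i j \<in> carrier H" if "i \<in> I" "j \<in> I" for i j
    unfolding c_def using that
    by (intro linear_map_in[OF linear_lslice[OF vspace_H]] linear_map_in[OF lin] B)
  have ce: "coact V (e j) = (\<Sum>i\<in>I. pure V H (e i) (c i j))" if "j \<in> I" for j
    unfolding c_def
    using dual_basis_tensor_expand[OF b comoduleD(1)[OF V] vspace_H linear_map_in[OF lin B(3)[OF that]]]
    by simp
  have "has_matrix V I e f c"
    unfolding has_matrix_def
    using comoduleD[OF V] b comatrix_of_coaction[OF V B(1) c ce] ce by blast
  then show ?thesis by (rule that)
qed

text \<open>Colinearity is linear in the vector, so a basis of the source decides. The colinearity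
  proofs below thereby become identities between finite sums over matrix entries.\<close>

lemma comodule_map_matrixI:
  assumes m: "has_matrix V I e f c" and W: "vspace W" and linW: "linear_map W (W \<otimes> H) (coact W)"
    and g: "linear_map V W g"
    and eq: "\<And>j. j \<in> I \<Longrightarrow> coact W (g (e j)) = (\<Sum>i\<in>I. pure W H (g (e i)) (c i j))"
  shows "comodule_map H V W g"
proof -
  note V = has_matrixD(1)[OF m] and b = has_matrixD(2)[OF m] and lin = has_matrixD(4)[OF m]
  note B = dual_basisD[OF b] and C = comatrixD[OF has_matrixD(3)[OF m]]
  have "coact W (g v) = tmap W H g id (coact V v)" if v: "v \<in> carrier V" for v
  proof (rule dual_basis_linear_eq[OF b V vspace_tensor linear_map_comp[OF g linW]
        linear_map_comp[OF lin linear_tmap[OF V g linear_map_id]] _ v])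
    show "coact W (g (e j)) = tmap W H g id (coact V (e j))" if j: "j \<in> I" for j
      using tmap_sum_pure[OF V g linear_map_id[of H], of I e "\<lambda>i. c i j"]
      by (simp add: eq j has_matrixD(5)[OF m] B(3) C(2))
  qed
  then show ?thesis using g by (simp add: comodule_map_def)
qed

lemma comodule_map_sum:
  assumes g: "comodule_map H V W g" and V: "vspace V" and v: "v \<in> carrier V"
    and x: "\<And>i. i \<in> I \<Longrightarrow> x i \<in> carrier V" and c: "\<And>i. i \<in> I \<Longrightarrow> c i \<in> carrier H"
    and eq: "coact V v = (\<Sum>i\<in>I. pure V H (x i) (c i))"
  shows "coact W (g v) = (\<Sum>i\<in>I. pure W H (g (x i)) (c i))"
  using g v tmap_sum_pure[OF V _ linear_map_id[of H], of W g I x c] x c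
  by (simp add: comodule_map_def eq)

section \<open>Matrices of tensor products, the unit object and duals\<close>

lemma tensor_comod_simps [simp]:
  "carrier (tensor_comod H V W) = carrier (V \<otimes> W)" "smult (tensor_comod H V W) = fscale"
  by (simp_all add: tensor_comod_def)

lemma dual_comod_simps [simp]:
  "carrier (dual_comod H V) = carrier (dual_space V)" "smult (dual_comod H V) = smult (dual_space V)"
  by (simp_all add: dual_comod_def)

text \<open>The two coactions may be expanded in arbitrary families instead of bases, since it is
  later applied to coefficients whose coaction is known only as some finite sum.\<close>

lemma tensor_coact_sum:
  assumes V: "vspace V" and W: "vspace W"
    and linV: "linear_map V (V \<otimes> H) (coact V)" and linW: "linear_map W (W \<otimes> H) (coact W)"
    and a: "\<And>p. p \<in> P \<Longrightarrow> a p \<in> carrier V" and c: "\<And>p. p \<in> P \<Longrightarrow> c p \<in> carrier H"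
    and b: "\<And>q. q \<in> Q \<Longrightarrow> b q \<in> carrier W" and d: "\<And>q. q \<in> Q \<Longrightarrow> d q \<in> carrier H"
    and v: "coact V v = (\<Sum>p\<in>P. pure V H (a p) (c p))"
    and w: "coact W w = (\<Sum>q\<in>Q. pure W H (b q) (d q))"
  shows "coact (tensor_comod H V W) (pure V W v w) =
    (\<Sum>p\<in>P. \<Sum>q\<in>Q. pure (V \<otimes> W) H (pure V W (a p) (b q)) (c p \<odot> d q))"
proof -
  define G where "G t = tmap (V \<otimes> W) H id (hmult H) (interchange V H W H t)" for t
  have linG: "linear_map ((V \<otimes> H) \<otimes> (W \<otimes> H)) ((V \<otimes> W) \<otimes> H) G"
    unfolding G_def
    by (rule linear_map_comp[OF linear_interchange[OF V vspace_H W vspace_H]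
          linear_tmap[OF vspace_tensor linear_map_id linear_mult]])
  have bil: "bilinear_map (V \<otimes> H) (W \<otimes> H) ((V \<otimes> W) \<otimes> H) (\<lambda>s t. G (pure (V \<otimes> H) (W \<otimes> H) s t))"
    by (rule bilinear_map_comp_out[OF bilinear_pure linG])
  let ?s = "\<lambda>p. pure V H (a p) (c p)" and ?t = "\<lambda>q. pure W H (b q) (d q)"
  have "coact (tensor_comod H V W) (pure V W v w) =
      G (pure (V \<otimes> H) (W \<otimes> H) (\<Sum>p\<in>P. ?s p) (\<Sum>q\<in>Q. ?t q))"
    by (simp add: tensor_comod_def G_def tmap_pure[OF linV linW] v w)
  also have "\<dots> = (\<Sum>p\<in>P. \<Sum>q\<in>Q. G (pure (V \<otimes> H) (W \<otimes> H) (?s p) (?t q)))"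
    by (intro bilinear_map_sum[OF bil vspace_tensor vspace_tensor vspace_tensor] pure_in a b c d)
  also have "\<dots> = (\<Sum>p\<in>P. \<Sum>q\<in>Q. pure (V \<otimes> W) H (pure V W (a p) (b q)) (c p \<odot> d q))"
    unfolding G_def
    by (intro sum.cong refl)
      (simp add: interchange_pure[OF V vspace_H W vspace_H] a b c d
        tmap_pure[OF linear_map_id linear_mult])
  finally show ?thesis .
qed

lemma linear_tensor_coact:
  assumes V: "vspace V" and W: "vspace W"
    and linV: "linear_map V (V \<otimes> H) (coact V)" and linW: "linear_map W (W \<otimes> H) (coact W)"
  shows "linear_map (V \<otimes> W) ((V \<otimes> W) \<otimes> H) (coact (tensor_comod H V W))"
  unfolding tensor_comod_def comod.simps
  by (rule linear_map_comp[OF linear_map_comp[OF linear_tmap[OF V linV linW]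
          linear_interchange[OF V vspace_H W vspace_H]]
        linear_tmap[OF vspace_tensor linear_map_id linear_mult]])

lemma has_matrix_tensor:
  assumes m: "has_matrix V I e f c" and m': "has_matrix W J e' f' d"
  shows "has_matrix (tensor_comod H V W) (I \<times> J) (\<lambda>p. pure V W (e (fst p)) (e' (snd p)))
    (\<lambda>p t. t (\<lambda>v w. f (fst p) v * f' (snd p) w)) (\<lambda>p q. c (fst p) (fst q) \<odot> d (snd p) (snd q))"
proof -
  note M = has_matrixD[OF m] and M' = has_matrixD[OF m']
  note B = dual_basisD[OF M(2)] and B' = dual_basisD[OF M'(2)]
  note C = comatrixD[OF M(3)] and C' = comatrixD[OF M'(3)]
  let ?T = "tensor_comod H V W"
  have TT: "carrier ?T = carrier (V \<otimes> W)" "smult ?T = smult (V \<otimes> W)" by simp_all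
  have "coact ?T (pure V W (e i) (e' j)) = (\<Sum>p\<in>I\<times>J. pure (V \<otimes> W) H (pure V W (e (fst p)) (e' (snd p)))
      (c (fst p) i \<odot> d (snd p) j))" if "i \<in> I" "j \<in> J" for i j
    using tensor_coact_sum[OF M(1) M'(1) M(4) M'(4) B(3) C(2) B'(3) C'(2) M(5) M'(5)] that
    by (simp add: sum.cartesian_product case_prod_unfold)
  then show ?thesis
    unfolding has_matrix_def vspace_eq_cong[OF TT] dual_basis_cong[OF TT]
      pure_cong[OF TT refl refl] tensor_cong[OF TT refl refl]
    using dual_basis_tensor[OF M(2) M'(2) M(1) M'(1)] comatrix_prod[OF M(3) M'(3)]
      linear_tensor_coact[OF M(1) M'(1) M(4) M'(4)] vspace_tensor
    by auto
qed

lemma has_matrix_unit: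
  "has_matrix (unit_comod H) {()} (\<lambda>_. 1) (\<lambda>_ x. x) (\<lambda>_ _. one)"
proof -
  have TT: "carrier (unit_comod H) = carrier ground" "smult (unit_comod H) = smult ground"
    by (simp_all add: unit_comod_def)
  have "dual_basis ground {()} (\<lambda>_. 1) (\<lambda>_ x. x)"
    by (simp add: dual_basis_def dual_family_def linear_map_ident)
  then show ?thesis
    unfolding has_matrix_def vspace_eq_cong[OF TT] dual_basis_cong[OF TT]
      pure_cong[OF TT refl refl] tensor_cong[OF TT refl refl]
    by (simp add: vspace_ground comatrix_def one_in comult_one counit_one)
      (simp add: unit_comod_def linear_pure_left one_in)
qed

lemma pure_ground: "h \<in> carrier H \<Longrightarrow> pure ground H r h = pure ground H 1 (smult H r h)"
  using pure_scale_left[of 1 ground h H r] pure_scale_right[of 1 ground h H r] by simp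

text \<open>The coaction of the dual is given by a definite description. The displayed sum satisfies
  the defining equation, as is checked on the basis of \<open>V\<close>. Conversely a tensor over
  the dual space is determined by its contractions with evaluation at the \<open>e i\<close>, and
  the equation prescribes these.\<close>

lemma dual_coact:
  assumes m: "has_matrix V I e f c" and f: "\<And>i. i \<in> I \<Longrightarrow> f i \<in> carrier (dual_space V)"
    and g: "g \<in> carrier (dual_space V)"
  shows "coact (dual_comod H V) g =
    (\<Sum>j\<in>I. pure (dual_space V) H (f j) (\<Sum>i\<in>I. smult H (g (e i)) (S (c i j))))"
    (is "_ = (\<Sum>j\<in>I. pure ?D H (f j) (?h j))")
proof -
  note M = has_matrixD[OF m]
  note B = dual_basisD[OF M(2)] and C = comatrixD[OF M(3)]
  have h: "?h j \<in> carrier H" if "j \<in> I" for j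
    using that by (intro vspace_sum[OF vspace_H] vspace_scale[OF vspace_H] antipode_in C(2))
  have ling: "linear_map V ground g" using g by (simp add: dual_space_simps)
  let ?R = "\<Sum>j\<in>I. pure ?D H (f j) (?h j)"
  let ?ev = "\<lambda>v t. tmap ground H (\<lambda>g. g v) id t" and ?r = "\<lambda>v. tmap ground H g S (coact V v)"
  have R_in: "?R \<in> carrier (?D \<otimes> H)"
    by (intro vspace_sum[OF vspace_tensor] pure_in f h)
  have evR: "?ev v ?R = (\<Sum>j\<in>I. pure ground H (f j v) (?h j))" if "v \<in> carrier V" for v
    using tmap_sum_pure[OF vspace_dual_space linear_dual_eval[OF that] linear_map_id[of H], of I f ?h] f h
    by simp
  have R: "?ev v ?R = ?r v" if v: "v \<in> carrier V" for v
    unfolding evR[OF v]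
  proof (rule dual_basis_linear_eq[OF M(2,1) vspace_tensor _ _ _ v])
    show "linear_map V (ground \<otimes> H) ?r"
      by (rule linear_map_comp[OF M(4) linear_tmap[OF M(1) ling linear_antipode]])
    show "linear_map V (ground \<otimes> H) (\<lambda>v. \<Sum>j\<in>I. pure ground H (f j v) (?h j))"
      by (rule linear_map_sum_fun[OF vspace_tensor])
        (rule linear_map_comp[OF B(4) linear_pure_left[OF h]])
    fix l assume l: "l \<in> I"
    have "?r (e l) = (\<Sum>i\<in>I. pure ground H (g (e i)) (S (c i l)))"
      using tmap_sum_pure[OF M(1) ling linear_antipode, of I e "\<lambda>i. c i l"] M(5)[OF l] B(3) C(2) l
      by simp
    also have "\<dots> = (\<Sum>i\<in>I. pure ground H 1 (smult H (g (e i)) (S (c i l))))"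
      by (intro sum.cong refl pure_ground antipode_in C(2) l)
    also have "\<dots> = pure ground H 1 (?h l)"
      by (intro pure_sum_right[OF vspace_H, symmetric] vspace_scale[OF vspace_H] antipode_in C(2) l) simp
    also have "\<dots> = (\<Sum>j\<in>I. if j = l then pure ground H 1 (?h j) else 0)"
      using l B(2) by simp
    also have "\<dots> = (\<Sum>j\<in>I. pure ground H (f j (e l)) (?h j))"
      by (intro sum.cong refl) (simp add: B(5) l pure_zero_left[OF vspace_ground h])
    finally show "(\<Sum>j\<in>I. pure ground H (f j (e l)) (?h j)) = ?r (e l)" ..
  qed
  \<comment> \<open>The defining equation lives in K \<otimes> H; contraction by evaluation at
    \<open>v\<close> factors through that space.\<close>
  have slice: "lslice ?D H (\<lambda>g. g v) t = lslice ground H id (?ev v t)"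
    if v: "v \<in> carrier V" and t: "t \<in> carrier (?D \<otimes> H)" for v t
    by (rule tensor_linear_eq[OF linear_lslice[OF vspace_H linear_dual_eval[OF v]]
          linear_map_comp[OF linear_tmap[OF vspace_dual_space linear_dual_eval[OF v] linear_map_id]
            linear_lslice[OF vspace_H linear_map_id]] vspace_dual_space vspace_H _ t])
      (simp add: lslice_pure[OF vspace_H] linear_dual_eval[OF v] linear_map_id
        tmap_pure[OF linear_dual_eval[OF v] linear_map_id])
  have uniq: "t = ?R" if t: "t \<in> carrier (?D \<otimes> H)" and eq: "\<forall>v\<in>carrier V. ?ev v t = ?r v" for t
  proof -
    have "dual_basis ?D I f (\<lambda>i g. g (e i))"
      using M(1,2) f by (intro dual_basis_dual_space)
    note e = dual_basis_tensor_expand[OF this vspace_dual_space vspace_H]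
    have "t = (\<Sum>i\<in>I. pure ?D H (f i) (lslice ?D H (\<lambda>g. g (e i)) t))"
      by (rule e[OF t, symmetric])
    also have "\<dots> = (\<Sum>i\<in>I. pure ?D H (f i) (lslice ?D H (\<lambda>g. g (e i)) ?R))"
      by (intro sum.cong refl) (simp add: slice B(3) t R_in eq R)
    also have "\<dots> = ?R" by (rule e[OF R_in])
    finally show ?thesis .
  qed
  show ?thesis
    unfolding dual_comod_def comod.simps
    by (rule the_equality) (use R_in R uniq in blast)+
qed

lemma has_matrix_dual:
  assumes m: "has_matrix V I e f c" and f: "\<And>i. i \<in> I \<Longrightarrow> f i \<in> carrier (dual_space V)"
  shows "has_matrix (dual_comod H V) I f (\<lambda>i g. g (e i)) (\<lambda>i j. S (c j i))"
proof -
  note M = has_matrixD[OF m]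
  note B = dual_basisD[OF M(2)] and C = comatrixD[OF M(3)]
  let ?D = "dual_space V"
  have DD: "carrier (dual_comod H V) = carrier ?D" "smult (dual_comod H V) = smult ?D" by simp_all
  have "linear_map ?D (?D \<otimes> H)
      (\<lambda>g. \<Sum>j\<in>I. pure ?D H (f j) (\<Sum>i\<in>I. smult H (g (e i)) (S (c i j))))"
    by (intro linear_map_sum_fun[OF vspace_tensor] linear_map_comp[OF _ linear_pure_right[OF f]]
        linear_map_sum_fun[OF vspace_H] linear_map_smult_vec[OF vspace_H] linear_dual_eval antipode_in
        B(3) C(2))
  then have lin: "linear_map ?D (?D \<otimes> H) (coact (dual_comod H V))"
    by (rule linear_map_cong[OF _ vspace_dual_space]) (simp add: dual_coact[OF m f])
  have "coact (dual_comod H V) (f i) = (\<Sum>j\<in>I. pure ?D H (f j) (S (c i j)))" if i: "i \<in> I" for i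
  proof -
    have "(\<Sum>k\<in>I. smult H (f i (e k)) (S (c k j))) = S (c i j)" for j
    proof -
      have "(\<Sum>k\<in>I. smult H (f i (e k)) (S (c k j))) = (\<Sum>k\<in>I. if i = k then S (c k j) else 0)"
        by (intro sum.cong refl) (simp add: B(5) i vspace_smult_simps[OF vspace_H])
      then show ?thesis using i B(2) by simp
    qed
    then show ?thesis by (simp add: dual_coact[OF m f f[OF i]])
  qed
  then show ?thesis
    unfolding has_matrix_def vspace_eq_cong[OF DD] dual_basis_cong[OF DD]
      pure_cong[OF DD refl refl] tensor_cong[OF DD refl refl]
    using vspace_dual_space lin dual_basis_dual_space[OF M(2) f M(1)] comatrix_dual[OF M(3)] by blast
qed

end

section \<open>The algebra \<open>V \<otimes> V\<^sup>*\<close> and the coalgebra \<open>V\<^sup>* \<otimes> V\<close>\<close>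

text \<open>The associativity axiom ranges over tensors in (A \<otimes> A) \<otimes> A; both sides
  are linear there, so products of elements suffice.\<close>

lemma algebraI:
  assumes A: "vspace A" and \<mu>: "linear_map (A \<otimes> A) A \<mu>" and \<eta>: "linear_map ground A \<eta>"
    and assoc: "\<And>a b c. a \<in> carrier A \<Longrightarrow> b \<in> carrier A \<Longrightarrow> c \<in> carrier A \<Longrightarrow>
      \<mu> (pure A A (\<mu> (pure A A a b)) c) = \<mu> (pure A A a (\<mu> (pure A A b c)))"
    and unit: "\<And>a. a \<in> carrier A \<Longrightarrow> \<mu> (pure A A (\<eta> 1) a) = a"
      "\<And>a. a \<in> carrier A \<Longrightarrow> \<mu> (pure A A a (\<eta> 1)) = a"
  shows "algebra A \<mu> \<eta>"
proof -
  let ?l = "\<lambda>t. \<mu> (tmap A A \<mu> id t)" and ?r = "\<lambda>t. \<mu> (tmap A A id \<mu> (assoc A A A t))"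
  have l: "linear_map ((A \<otimes> A) \<otimes> A) A ?l"
    by (rule linear_map_comp[OF linear_tmap[OF vspace_tensor \<mu> linear_map_id] \<mu>])
  have r: "linear_map ((A \<otimes> A) \<otimes> A) A ?r"
    by (rule linear_map_comp[OF linear_map_comp[OF linear_assoc[OF A A] linear_tmap[OF A linear_map_id \<mu>]] \<mu>])
  have "?l t = ?r t" if t: "t \<in> carrier ((A \<otimes> A) \<otimes> A)" for t
  proof (rule tensor_linear_eq[OF l r vspace_tensor A _ t])
    fix s c assume s: "s \<in> carrier (A \<otimes> A)" and c: "c \<in> carrier A"
    note p = linear_pure_left[OF c, of "A \<otimes> A"]
    show "?l (pure (A \<otimes> A) A s c) = ?r (pure (A \<otimes> A) A s c)"
      by (rule tensor_linear_eq[OF linear_map_comp[OF p l] linear_map_comp[OF p r] A A _ s])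
        (simp add: tmap_pure[OF \<mu> linear_map_id] tmap_pure[OF linear_map_id \<mu>] assoc_pure[OF A A c]
          assoc c)
  qed
  then show ?thesis using A \<mu> \<eta> unit by (simp add: algebra_def)
qed

text \<open>The multiplication of \<open>end_alg\<close> depends on the vector space only;
  separating it from \<open>H\<close> lets it be studied before any coaction enters.
  \<open>coend_comult\<close> does the same for \<open>coend_coalg\<close>.\<close>

definition end_mult ::
  "('k::field, 'a::ab_group_add, 'z) vspace_scheme
    \<Rightarrow> ('k, ('k, 'a, 'a \<Rightarrow> 'k) tensor, ('k, 'a, 'a \<Rightarrow> 'k) tensor) tensor \<Rightarrow> ('k, 'a, 'a \<Rightarrow> 'k) tensor" where
  "end_mult V t = functional_on V (dual_space V)
     (\<lambda>\<beta>. t (\<lambda>x y. x (\<lambda>v f. y (\<lambda>w g. f w * \<beta> v g))))"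

definition coend_comult ::
  "('k::field, 'a::ab_group_add, 'z) vspace_scheme
    \<Rightarrow> ('k, 'a \<Rightarrow> 'k, 'a) tensor \<Rightarrow> ('k, ('k, 'a \<Rightarrow> 'k, 'a) tensor, ('k, 'a \<Rightarrow> 'k, 'a) tensor) tensor" where
  "coend_comult V t = functional_on (dual_space V \<otimes> V) (dual_space V \<otimes> V)
     (\<lambda>\<beta>. t (\<lambda>f v. coev V (\<lambda>w g. \<beta> (pure (dual_space V) V f w) (pure (dual_space V) V g v))))"

lemma end_mult_pure:
  fixes V :: "('k::field, 'a::ab_group_add, 'z) vspace_scheme"
  assumes V: "vspace V"
    and v: "v \<in> carrier V" and f: "f \<in> carrier (dual_space V)"
    and w: "w \<in> carrier V" and g: "g \<in> carrier (dual_space V)"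
  shows "end_mult V (pure (V \<otimes> dual_space V) (V \<otimes> dual_space V) (pure V (dual_space V) v f)
      (pure V (dual_space V) w g)) = fscale (f w) (pure V (dual_space V) v g)"
proof -
  let ?D = "dual_space V"
  have "\<beta> (smult V (f w) v) g = pure (V \<otimes> ?D) (V \<otimes> ?D) (pure V ?D v f) (pure V ?D w g)
      (\<lambda>x y. x (\<lambda>v f. y (\<lambda>w g. f w * \<beta> v g)))" if \<beta>: "bilinear_map V ?D ground \<beta>" for \<beta>
  proof -
    \<comment> \<open>The nested forms are bilinear, from the inside out; each level licenses one
      use of \<open>pure_apply\<close>.\<close>
    have i: "bilinear_map V ?D ground (\<lambda>w g. f w * \<beta> v g)" if "v \<in> carrier V" "f \<in> carrier ?D" for v f
      using that by (intro bilinear_map_prod bilinear_map_right[OF \<beta>]) (simp_all add: dual_space_simps)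
    have ii: "bilinear_map V ?D ground (\<lambda>v f. y (\<lambda>w g. f w * \<beta> v g))" if y: "y \<in> carrier (V \<otimes> ?D)" for y
    proof (rule bilinear_mapI)
      show "linear_map ?D ground (\<lambda>f. y (\<lambda>w g. f w * \<beta> v g))" if "v \<in> carrier V" for v
        by (rule tensor_eval_linear[OF y V i[OF that] _ vspace_dual_space])
          (auto intro: linear_form_mult_right linear_dual_eval)
      show "linear_map V ground (\<lambda>v. y (\<lambda>w g. f w * \<beta> v g))" if "f \<in> carrier ?D" for f
        by (rule tensor_eval_linear[OF y V i _ V])
          (auto intro: that linear_form_mult bilinear_map_left[OF \<beta>])
    qed
    have iii: "bilinear_map (V \<otimes> ?D) (V \<otimes> ?D) ground (\<lambda>x y. x (\<lambda>v f. y (\<lambda>w g. f w * \<beta> v g)))"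
    proof (rule bilinear_mapI)
      show "linear_map (V \<otimes> ?D) ground (\<lambda>y. x (\<lambda>v f. y (\<lambda>w g. f w * \<beta> v g)))"
        if "x \<in> carrier (V \<otimes> ?D)" for x
        by (rule tensor_eval_linear[OF that V ii _ vspace_tensor])
          (assumption, rule tensor_eval_linear_tensor)
    qed (rule tensor_eval_linear_tensor)
    show ?thesis
      by (simp add: pure_apply[OF iii] pure_apply[OF ii] pure_apply[OF i] pure_in v f w g
          bilinear_form_simps[OF \<beta>])
  qed
  then show ?thesis
    unfolding end_mult_def pure_scale_left[OF v g, symmetric]
    by (intro functional_on_eq_pure) simp
qed

lemma linear_end_mult:
  assumes V: "vspace V"
  shows "linear_map ((V \<otimes> dual_space V) \<otimes> (V \<otimes> dual_space V)) (V \<otimes> dual_space V) (end_mult V)"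
  unfolding end_mult_def[abs_def]
  by (rule linear_functional_on_tensors[OF V V], fold end_mult_def)
    (simp add: end_mult_pure[OF V] vspace_scale[OF vspace_tensor, unfolded tensor_smult] pure_in)

lemma bilinear_end_mult:
  assumes V: "vspace V"
  shows "bilinear_map (V \<otimes> dual_space V) (V \<otimes> dual_space V) (V \<otimes> dual_space V)
    (\<lambda>x y. end_mult V (pure (V \<otimes> dual_space V) (V \<otimes> dual_space V) x y))"
  by (rule bilinear_map_comp_out[OF bilinear_pure linear_end_mult[OF V]])

text \<open>On pure tensors both bracketings of (v \<otimes> f)(w \<otimes> g)(x \<otimes> h) give
  f(w) g(x) times v \<otimes> h.\<close>

lemma end_mult_assoc:
  fixes V :: "('k::field, 'a::ab_group_add, 'z) vspace_scheme"
  defines "T \<equiv> V \<otimes> dual_space V"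
  assumes V: "vspace V" and xyz: "x \<in> carrier T" "y \<in> carrier T" "z \<in> carrier T"
  shows "end_mult V (pure T T (end_mult V (pure T T x y)) z) =
    end_mult V (pure T T x (end_mult V (pure T T y z)))"
proof -
  have scale: "end_mult V (pure T T (fscale r x) y) = fscale r (end_mult V (pure T T x y))"
    "end_mult V (pure T T x (fscale r y)) = fscale r (end_mult V (pure T T x y))"
    if "x \<in> carrier T" "y \<in> carrier T" for r x y
    using linear_map_scale[OF bilinear_map_left[OF bilinear_end_mult[OF V], of y], of x r]
      linear_map_scale[OF bilinear_map_right[OF bilinear_end_mult[OF V], of x], of y r] that
    by (simp_all add: T_def)
  show ?thesis
    using xyz unfolding T_def
    by (rule tensor_bilinear_assoc[OF V bilinear_end_mult[OF V], rotated 1])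
      (simp_all add: end_mult_pure[OF V] scale[unfolded T_def] pure_in mult.commute)
qed

lemma coev_in:
  assumes "dual_basis V I e f" "vspace V" "\<And>i. i \<in> I \<Longrightarrow> f i \<in> carrier (dual_space V)"
  shows "coev V \<in> carrier (V \<otimes> dual_space V)"
  by (subst coev_eq[OF assms], assumption)
    (intro vspace_sum[OF vspace_tensor] pure_in dual_basisD(3)[OF assms(1)] assms(3))

text \<open>Multiplication by \<open>coev\<close> on the left replaces \<open>v\<close> by its
  expansion in the \<open>e i\<close>; on the right it replaces \<open>g\<close> by its expansion in
  the \<open>f i\<close>.\<close>

lemma
  assumes b: "dual_basis V I e f" and V: "vspace V"
    and f: "\<And>i. i \<in> I \<Longrightarrow> f i \<in> carrier (dual_space V)"
    and x: "x \<in> carrier (V \<otimes> dual_space V)"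
  shows end_mult_coev_left:
      "end_mult V (pure (V \<otimes> dual_space V) (V \<otimes> dual_space V) (coev V) x) = x"
    and end_mult_coev_right:
      "end_mult V (pure (V \<otimes> dual_space V) (V \<otimes> dual_space V) x (coev V)) = x"
proof -
  let ?D = "dual_space V"
  let ?T = "V \<otimes> ?D"
  note B = dual_basisD[OF b] and mp = end_mult_pure[OF V]
  note L = bilinear_map_left[OF bilinear_end_mult[OF V]]
    and R = bilinear_map_right[OF bilinear_end_mult[OF V]]
  have ce: "coev V \<in> carrier ?T" using b V f by (rule coev_in)
  have ceq: "coev V = (\<Sum>i\<in>I. pure V ?D (e i) (f i))" using b V f by (rule coev_eq)
  show "end_mult V (pure ?T ?T (coev V) x) = x"
  proof (rule tensor_linear_eq[OF R[OF ce] linear_map_ident V vspace_tensor _ x])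
    fix v g assume v: "v \<in> carrier V" and g: "g \<in> carrier ?D"
    have "end_mult V (pure ?T ?T (coev V) (pure V ?D v g)) =
        (\<Sum>i\<in>I. end_mult V (pure ?T ?T (pure V ?D (e i) (f i)) (pure V ?D v g)))"
      unfolding ceq
      by (rule linear_map_sum[OF L[OF pure_in[OF v g]] vspace_tensor vspace_tensor])
        (intro pure_in B(3) f)
    also have "\<dots> = (\<Sum>i\<in>I. pure V ?D (smult V (f i v) (e i)) g)"
      by (intro sum.cong refl) (simp add: mp v g B(3) f pure_scale_left)
    also have "\<dots> = pure V ?D v g"
      by (subst pure_sum_left[OF V g, symmetric]) (auto simp: B(3,6) v intro: vspace_scale[OF V])
    finally show "end_mult V (pure ?T ?T (coev V) (pure V ?D v g)) = pure V ?D v g" .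
  qed
  show "end_mult V (pure ?T ?T x (coev V)) = x"
  proof (rule tensor_linear_eq[OF L[OF ce] linear_map_ident V vspace_tensor _ x])
    fix v g assume v: "v \<in> carrier V" and g: "g \<in> carrier ?D"
    have "end_mult V (pure ?T ?T (pure V ?D v g) (coev V)) =
        (\<Sum>i\<in>I. end_mult V (pure ?T ?T (pure V ?D v g) (pure V ?D (e i) (f i))))"
      unfolding ceq
      by (rule linear_map_sum[OF R[OF pure_in[OF v g]] vspace_tensor vspace_tensor])
        (intro pure_in B(3) f)
    also have "\<dots> = (\<Sum>i\<in>I. pure V ?D v (smult ?D (g (e i)) (f i)))"
      by (intro sum.cong refl) (simp add: mp v g B(3) f pure_scale_right)
    also have "\<dots> = pure V ?D v (\<Sum>i\<in>I. smult ?D (g (e i)) (f i))"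
      by (intro pure_sum_right[OF vspace_dual_space v, symmetric] vspace_scale[OF vspace_dual_space] f)
    also have "(\<Sum>i\<in>I. smult ?D (g (e i)) (f i)) = g"
      using dual_basis_dual_space[OF b f V] g by (intro dual_basisD(6))
    finally show "end_mult V (pure ?T ?T (pure V ?D v g) (coev V)) = pure V ?D v g" .
  qed
qed

text \<open>The comultiplication inserts \<open>coev\<close> between the two factors, and by
  \<open>coev_eq\<close> any dual basis may be used to compute it.\<close>

lemma
  fixes V :: "('k::field, 'a::ab_group_add, 'z) vspace_scheme"
  assumes b: "dual_basis V I e f" and V: "vspace V"
    and f: "\<And>i. i \<in> I \<Longrightarrow> f i \<in> carrier (dual_space V)"
  shows coend_comult_pure: "g \<in> carrier (dual_space V) \<Longrightarrow> v \<in> carrier V \<Longrightarrow>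
      coend_comult V (pure (dual_space V) V g v) =
      (\<Sum>i\<in>I. pure (dual_space V \<otimes> V) (dual_space V \<otimes> V) (pure (dual_space V) V g (e i))
        (pure (dual_space V) V (f i) v))"
    and linear_coend_comult: "linear_map (dual_space V \<otimes> V)
      ((dual_space V \<otimes> V) \<otimes> (dual_space V \<otimes> V)) (coend_comult V)"
proof -
  let ?D = "dual_space V"
  let ?T = "?D \<otimes> V"
  note B = dual_basisD[OF b]
  have ce: "coev V \<in> carrier (V \<otimes> ?D)" using b V f by (rule coev_in)
  have ceq: "coev V = (\<Sum>i\<in>I. pure V ?D (e i) (f i))" using b V f by (rule coev_eq)
  have i: "bilinear_map V ?D ground (\<lambda>w g. \<beta> (pure ?D V f w) (pure ?D V g v))"
    if "bilinear_map ?T ?T ground \<beta>" "f \<in> carrier ?D" "v \<in> carrier V" for \<beta> f v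
    by (rule bilinear_map_comp[OF that(1) linear_pure_right[OF that(2)] linear_pure_left[OF that(3)]])
  have ii: "bilinear_map ?D V ground (\<lambda>f v. coev V (\<lambda>w g. \<beta> (pure ?D V f w) (pure ?D V g v)))"
    if \<beta>: "bilinear_map ?T ?T ground \<beta>" for \<beta>
  proof (rule bilinear_mapI)
    show "linear_map V ground (\<lambda>v. coev V (\<lambda>w g. \<beta> (pure ?D V f w) (pure ?D V g v)))"
      if "f \<in> carrier ?D" for f
      by (rule tensor_eval_linear[OF ce V i[OF \<beta> that] _ V])
        (auto intro!: linear_map_comp[OF linear_pure_right bilinear_map_right[OF \<beta>]] pure_in that)
    show "linear_map ?D ground (\<lambda>f. coev V (\<lambda>w g. \<beta> (pure ?D V f w) (pure ?D V g v)))"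
      if "v \<in> carrier V" for v
      by (rule tensor_eval_linear[OF ce V i[OF \<beta> _ that] _ vspace_dual_space])
        (auto intro!: linear_map_comp[OF linear_pure_left bilinear_map_left[OF \<beta>]] pure_in that)
  qed
  show pure: "coend_comult V (pure ?D V g v) =
      (\<Sum>i\<in>I. pure ?T ?T (pure ?D V g (e i)) (pure ?D V (f i) v))"
    if g: "g \<in> carrier ?D" and v: "v \<in> carrier V" for g v
  proof (rule ext)
    fix \<beta>
    show "coend_comult V (pure ?D V g v) \<beta> =
      (\<Sum>i\<in>I. pure ?T ?T (pure ?D V g (e i)) (pure ?D V (f i) v)) \<beta>"
    proof (cases "bilinear_map ?T ?T ground \<beta>")
      case True
      have "coend_comult V (pure ?D V g v) \<beta> = coev V (\<lambda>w h. \<beta> (pure ?D V g w) (pure ?D V h v))"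
        using True by (simp add: coend_comult_def functional_on_def pure_apply[OF ii])
      also have "\<dots> = (\<Sum>i\<in>I. \<beta> (pure ?D V g (e i)) (pure ?D V (f i) v))"
        unfolding ceq sum_fun_apply by (simp add: pure_apply[OF i[OF True g v]])
      finally show ?thesis by (simp add: sum_fun_apply pure_apply[OF True])
    qed (simp add: coend_comult_def functional_on_def sum_fun_apply pure_def)
  qed
  show "linear_map ?T (?T \<otimes> ?T) (coend_comult V)"
    unfolding coend_comult_def[abs_def]
    by (rule linear_functional_on[OF vspace_dual_space], fold coend_comult_def)
      (auto simp: pure intro!: vspace_sum[OF vspace_tensor] pure_in B(3) f)
qed

lemma bilinear_dual_pairing: "bilinear_map (dual_space V) V ground (\<lambda>f v. f v)"
  by (rule bilinear_mapI) (simp_all add: linear_dual_eval, simp add: dual_space_simps)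

text \<open>A row \<open>F i\<close>, taken as family with coefficient matrix \<open>F\<close>,
  behaves under \<open>\<delta>\<close> like a basis under a coaction. Coassociativity is therefore
  the same matrix square computation as for comodules.\<close>

lemma matrix_coalgebra:
  fixes C :: "('k::field, 'a::ab_group_add, 'z) vspace_scheme"
  assumes C: "vspace C" and I: "finite I"
    and b: "dual_basis C (I \<times> I) (\<lambda>p. F (fst p) (snd p)) g"
    and \<delta>: "linear_map C (C \<otimes> C) \<delta>" and \<epsilon>: "linear_map C ground \<epsilon>"
    and \<delta>F: "\<And>i j. i \<in> I \<Longrightarrow> j \<in> I \<Longrightarrow> \<delta> (F i j) = (\<Sum>k\<in>I. pure C C (F i k) (F k j))"
    and \<epsilon>F: "\<And>i j. i \<in> I \<Longrightarrow> j \<in> I \<Longrightarrow> \<epsilon> (F i j) = (if i = j then 1 else 0)"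
  shows "coalgebra C \<delta> \<epsilon>"
proof -
  have F: "F i j \<in> carrier C" if "i \<in> I" "j \<in> I" for i j
    using dual_basisD(3)[OF b, of "(i, j)"] that by simp
  have eqI: "h t = k t"
    if "linear_map C W h" "linear_map C W k" "vspace W"
      "\<And>i j. i \<in> I \<Longrightarrow> j \<in> I \<Longrightarrow> h (F i j) = k (F i j)" "t \<in> carrier C"
    for W :: "('k, 'w::ab_group_add, 'u) vspace_scheme" and h k t
    by (rule dual_basis_linear_eq[OF b C that(3,1,2) _ that(5)]) (use that(4) in auto)
  note lin = linear_map_id[of C]
  have "assoc C C C (tmap (C \<otimes> C) C \<delta> id (\<delta> t)) = tmap C (C \<otimes> C) id \<delta> (\<delta> t)"
    if t: "t \<in> carrier C" for t
  proof (rule eqI[OF linear_map_comp[OF linear_map_comp[OF \<delta> linear_tmap[OF C \<delta> lin]] linear_assoc[OF C C]]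
        linear_map_comp[OF \<delta> linear_tmap[OF C lin \<delta>]] vspace_tensor _ t])
    fix i j assume ij: "i \<in> I" "j \<in> I"
    have "assoc C C C (tmap (C \<otimes> C) C \<delta> id (\<delta> (F i j))) =
        (\<Sum>k\<in>I. pure C (C \<otimes> C) (F i k) (\<Sum>l\<in>I. pure C C (F k l) (F l j)))"
      by (rule coassoc_sum[where e = "F i" and c = F, OF C C \<delta>]) (simp_all add: F \<delta>F ij)
    also have "\<dots> = tmap C (C \<otimes> C) id \<delta> (\<delta> (F i j))"
      using tmap_sum_pure[OF C lin \<delta>, of I "F i" "\<lambda>k. F k j"] by (simp add: \<delta>F ij F)
    finally show "assoc C C C (tmap (C \<otimes> C) C \<delta> id (\<delta> (F i j))) = tmap C (C \<otimes> C) id \<delta> (\<delta> (F i j))" .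
  qed
  moreover have "tmap ground C \<epsilon> id (\<delta> t) = pure ground C 1 t" if t: "t \<in> carrier C" for t
  proof (rule eqI[OF linear_map_comp[OF \<delta> linear_tmap[OF C \<epsilon> lin]] linear_pure_right vspace_tensor _ t])
    fix i j assume ij: "i \<in> I" "j \<in> I"
    have "tmap ground C \<epsilon> id (\<delta> (F i j)) = (\<Sum>k\<in>I. if i = k then pure ground C 1 (F k j) else 0)"
      using tmap_sum_pure[OF C \<epsilon> lin, of I "F i" "\<lambda>k. F k j"]
      by (simp add: \<delta>F \<epsilon>F ij F) (intro sum.cong refl, simp add: pure_zero_left[OF vspace_ground F] ij)
    then show "tmap ground C \<epsilon> id (\<delta> (F i j)) = pure ground C 1 (F i j)" using I ij by simp
  qed simp
  moreover have "tmap C ground id \<epsilon> (\<delta> t) = pure C ground t 1" if t: "t \<in> carrier C" for t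
  proof (rule eqI[OF linear_map_comp[OF \<delta> linear_tmap[OF C lin \<epsilon>]] linear_pure_left vspace_tensor _ t])
    fix i j assume ij: "i \<in> I" "j \<in> I"
    have "tmap C ground id \<epsilon> (\<delta> (F i j)) = (\<Sum>k\<in>I. if k = j then pure C ground (F i k) 1 else 0)"
      using tmap_sum_pure[OF C lin \<epsilon>, of I "F i" "\<lambda>k. F k j"]
      by (simp add: \<delta>F \<epsilon>F ij F) (intro sum.cong refl, simp add: pure_zero_right[OF vspace_ground F] ij)
    then show "tmap C ground id \<epsilon> (\<delta> (F i j)) = pure C ground (F i j) 1" using I ij by simp
  qed simp
  ultimately show ?thesis using C \<delta> \<epsilon> by (simp add: coalgebra_def)
qed

section \<open>Compatibility of the two structures with the coaction\<close>

context hopf_alg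
begin

lemma dual_comod_tensor_cong:
  "V \<otimes> dual_comod H V = V \<otimes> dual_space V" "dual_comod H V \<otimes> V = dual_space V \<otimes> V"
  "pure V (dual_comod H V) = pure V (dual_space V)" "pure (dual_comod H V) V = pure (dual_space V) V"
  by ((rule tensor_cong pure_cong; simp)+)

lemma end_alg_simps:
  "carrier (end_alg H V) = carrier (V \<otimes> dual_space V)"
  "smult (end_alg H V) = smult (V \<otimes> dual_space V)"
  "coact (end_alg H V) = coact (tensor_comod H V (dual_comod H V))"
  "amult (end_alg H V) = end_mult V" "aunit (end_alg H V) = (\<lambda>c. fscale c (coev V))"
  by (simp_all add: end_alg_def Let_def dual_comod_tensor_cong end_mult_def fun_eq_iff)

lemma coend_coalg_simps:
  "carrier (coend_coalg H V) = carrier (dual_space V \<otimes> V)"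
  "smult (coend_coalg H V) = smult (dual_space V \<otimes> V)"
  "coact (coend_coalg H V) = coact (tensor_comod H (dual_comod H V) V)"
  "ccomult (coend_coalg H V) = coend_comult V" "ccounit (coend_coalg H V) = (\<lambda>t. t (\<lambda>f v. f v))"
  by (simp_all add: coend_coalg_def Let_def dual_comod_tensor_cong coend_comult_def fun_eq_iff)

lemma has_matrix_end_alg:
  assumes m: "has_matrix V I e f c" and f: "\<And>i. i \<in> I \<Longrightarrow> f i \<in> carrier (dual_space V)"
  shows "has_matrix (end_alg H V) (I \<times> I) (\<lambda>p. pure V (dual_space V) (e (fst p)) (f (snd p)))
    (\<lambda>p t. t (\<lambda>v g. f (fst p) v * g (e (snd p))))
    (\<lambda>p q. c (fst p) (fst q) \<odot> S (c (snd q) (snd p)))"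
proof -
  have s: "carrier (end_alg H V) = carrier (tensor_comod H V (dual_comod H V))"
    "smult (end_alg H V) = smult (tensor_comod H V (dual_comod H V))"
    by (simp_all add: end_alg_simps dual_comod_tensor_cong)
  show ?thesis
    using has_matrix_tensor[OF m has_matrix_dual[OF m f]]
    by (simp add: has_matrix_cong[OF s end_alg_simps(3)] dual_comod_tensor_cong)
qed

lemma has_matrix_coend_coalg:
  assumes m: "has_matrix V I e f c" and f: "\<And>i. i \<in> I \<Longrightarrow> f i \<in> carrier (dual_space V)"
  shows "has_matrix (coend_coalg H V) (I \<times> I) (\<lambda>p. pure (dual_space V) V (f (fst p)) (e (snd p)))
    (\<lambda>p t. t (\<lambda>g v. g (e (fst p)) * f (snd p) v))
    (\<lambda>p q. S (c (fst q) (fst p)) \<odot> c (snd p) (snd q))"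
proof -
  have s: "carrier (coend_coalg H V) = carrier (tensor_comod H (dual_comod H V) V)"
    "smult (coend_coalg H V) = smult (tensor_comod H (dual_comod H V) V)"
    by (simp_all add: coend_coalg_simps dual_comod_tensor_cong)
  show ?thesis
    using has_matrix_tensor[OF has_matrix_dual[OF m f] m]
    by (simp add: has_matrix_cong[OF s coend_coalg_simps(3)] dual_comod_tensor_cong)
qed

text \<open>\<open>H\<close> need not be commutative, so \<open>c\<close> and S(c) cancel only when
  adjacent. In a product of two coaction coefficients the adjacent pair stands in the middle, and
  the outer factors \<open>x\<close> and \<open>y\<close> are carried along.\<close>

lemma comatrix_mul_cancel:
  assumes c: "comatrix I c" and ij: "i \<in> I" "j \<in> I" and xy: "x \<in> carrier H" "y \<in> carrier H"
  shows "(\<Sum>k\<in>I. (x \<odot> S (c i k)) \<odot> (c k j \<odot> y)) = (if i = j then x \<odot> y else 0)"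
    and "(\<Sum>k\<in>I. (x \<odot> c i k) \<odot> (S (c k j) \<odot> y)) = (if i = j then x \<odot> y else 0)"
proof -
  note C = comatrixD[OF c]
  have *: "(\<Sum>k\<in>I. (x \<odot> a k) \<odot> (b k \<odot> y)) = (if i = j then x \<odot> y else 0)"
    if a: "\<And>k. k \<in> I \<Longrightarrow> a k \<in> carrier H" and b: "\<And>k. k \<in> I \<Longrightarrow> b k \<in> carrier H"
      and ab: "(\<Sum>k\<in>I. a k \<odot> b k) = (if i = j then one else 0)" for a b
  proof -
    have "(\<Sum>k\<in>I. (x \<odot> a k) \<odot> (b k \<odot> y)) = (\<Sum>k\<in>I. (x \<odot> (a k \<odot> b k)) \<odot> y)"
      by (intro sum.cong refl) (simp add: mul_assoc mul_in a b xy)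
    also have "\<dots> = (x \<odot> (\<Sum>k\<in>I. a k \<odot> b k)) \<odot> y"
      by (simp add: mul_sum_left mul_sum_right mul_in a b xy)
    also have "\<dots> = (if i = j then x \<odot> y else 0)"
      by (simp add: ab mul_one mul_zero xy)
    finally show ?thesis .
  qed
  show "(\<Sum>k\<in>I. (x \<odot> S (c i k)) \<odot> (c k j \<odot> y)) = (if i = j then x \<odot> y else 0)"
    and "(\<Sum>k\<in>I. (x \<odot> c i k) \<odot> (S (c k j) \<odot> y)) = (if i = j then x \<odot> y else 0)"
    using *[of "\<lambda>k. S (c i k)" "\<lambda>k. c k j"] *[of "\<lambda>k. c i k" "\<lambda>k. S (c k j)"]
    by (simp_all only: antipode_in C(2) ij comatrix_antipode[OF c ij])
qed

end

context hopf_alg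
begin

lemma end_alg_tensor_cong:
  "pure (end_alg H V) W = pure (V \<otimes> dual_space V) W"
  "pure W (end_alg H V) = pure W (V \<otimes> dual_space V)"
  "end_alg H V \<otimes> W = (V \<otimes> dual_space V) \<otimes> W"
  "W \<otimes> end_alg H V = W \<otimes> (V \<otimes> dual_space V)"
  by ((rule tensor_cong pure_cong; simp add: end_alg_simps)+)

lemma coend_coalg_tensor_cong:
  "pure (coend_coalg H V) W = pure (dual_space V \<otimes> V) W"
  "pure W (coend_coalg H V) = pure W (dual_space V \<otimes> V)"
  "coend_coalg H V \<otimes> W = (dual_space V \<otimes> V) \<otimes> W"
  "W \<otimes> coend_coalg H V = W \<otimes> (dual_space V \<otimes> V)"
  by ((rule tensor_cong pure_cong; simp add: coend_coalg_simps)+)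

lemma pure_tensor_comod: "pure (tensor_comod H V W) H = pure (V \<otimes> W) H"
  by (rule pure_cong) simp_all

text \<open>In matrix units, \<open>E i j\<close> times \<open>E k l\<close> is \<open>E i l\<close>
  if j = k and 0 otherwise, and \<open>E i j\<close> has coaction coefficients
  \<open>c a i \<odot> S (c j b)\<close>. Multiplying \<open>E a b\<close> by \<open>E r s\<close>
  forces b = r, so that \<open>S (c j b)\<close> meets \<open>c b k\<close> with b as common
  summation index, and they cancel to the delta of j and k. Coinvariance of the unit is c S(c) =
  1.\<close>

lemma comodule_algebra_end_alg:
  assumes m: "has_matrix V I e f c" and f: "\<And>i. i \<in> I \<Longrightarrow> f i \<in> carrier (dual_space V)"
  shows "comodule_algebra H (end_alg H V)"
proof -
  note M = has_matrixD[OF m]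
  note V = M(1) and B = dual_basisD[OF M(2)] and C = comatrixD[OF M(3)]
  let ?D = "dual_space V"
  let ?A = "end_alg H V"
  let ?T = "V \<otimes> ?D"
  have mA: "has_matrix ?A (I \<times> I) (\<lambda>p. pure V ?D (e (fst p)) (f (snd p)))
    (\<lambda>p t. t (\<lambda>v g. f (fst p) v * g (e (snd p)))) (\<lambda>p q. c (fst p) (fst q) \<odot> S (c (snd q) (snd p)))"
    using m f by (rule has_matrix_end_alg)
  note MA = has_matrixD[OF mA]
  define E where "E i j = pure V ?D (e i) (f j)" for i j
  have E_in: "E i j \<in> carrier ?T" if "i \<in> I" "j \<in> I" for i j
    using that by (auto simp: E_def intro!: pure_in f B(3))
  have coactE: "coact ?A (E i j) = (\<Sum>a\<in>I. \<Sum>b\<in>I. pure ?T H (E a b) (c a i \<odot> S (c j b)))"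
    if "i \<in> I" "j \<in> I" for i j
    using MA(5)[of "(i, j)"] that
    by (simp add: E_def sum.cartesian_product' end_alg_tensor_cong)
  have multE: "end_mult V (pure ?T ?T (E i j) (E k l)) = (if j = k then E i l else 0)"
    if "i \<in> I" "j \<in> I" "k \<in> I" "l \<in> I" for i j k l
    using that by (simp add: E_def end_mult_pure[OF V] B(3,5) f)
  have ce: "coev V \<in> carrier ?T" using M(2) V f by (rule coev_in)
  have linA: "linear_map (?A \<otimes> ?A) ?A (amult ?A)"
    using linear_end_mult[OF V] by (simp add: linear_map_def end_alg_simps end_alg_tensor_cong)
  have lin1: "linear_map ground ?A (aunit ?A)"
    using linear_map_smult_vec[OF vspace_tensor linear_map_ident ce]
    by (simp add: linear_map_def end_alg_simps)
  have "algebra ?A (amult ?A) (aunit ?A)"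
  proof (rule algebraI[OF MA(1) linA lin1])
    fix x assume "x \<in> carrier ?A"
    then have x: "x \<in> carrier ?T" by (simp add: end_alg_simps)
    show "amult ?A (pure ?A ?A (aunit ?A 1) x) = x"
      using end_mult_coev_left[OF M(2) V f x] by (simp add: end_alg_simps end_alg_tensor_cong)
    show "amult ?A (pure ?A ?A x (aunit ?A 1)) = x"
      using end_mult_coev_right[OF M(2) V f x] by (simp add: end_alg_simps end_alg_tensor_cong)
  qed (simp add: end_alg_simps end_alg_tensor_cong end_mult_assoc[OF V])
  moreover have "comodule_map H (tensor_comod H ?A ?A) ?A (amult ?A)"
  proof (rule comodule_map_matrixI[OF has_matrix_tensor[OF mA mA] MA(1) MA(4)])
    show "linear_map (tensor_comod H ?A ?A) ?A (amult ?A)"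
      using linA by (simp add: linear_map_def end_alg_tensor_cong)
  next
    fix q assume "q \<in> (I \<times> I) \<times> (I \<times> I)"
    then obtain i j k l where q: "q = ((i, j), (k, l))"
      and ij: "i \<in> I" "j \<in> I" and kl: "k \<in> I" "l \<in> I" by auto
    note x = mul_in antipode_in C(2) ij kl E_in
    have "(\<Sum>a\<in>I. \<Sum>b\<in>I. \<Sum>r\<in>I. \<Sum>s\<in>I. pure ?T H (end_mult V (pure ?T ?T (E a b) (E r s)))
        ((c a i \<odot> S (c j b)) \<odot> (c r k \<odot> S (c l s)))) =
      (\<Sum>a\<in>I. \<Sum>b\<in>I. \<Sum>r\<in>I. if b = r then \<Sum>s\<in>I. pure ?T H (E a s)
        ((c a i \<odot> S (c j b)) \<odot> (c r k \<odot> S (c l s))) else 0)"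
      by (intro sum.cong refl) (simp add: multE pure_zero_left[OF vspace_tensor] x)
    also have "\<dots> = (\<Sum>a\<in>I. \<Sum>b\<in>I. \<Sum>s\<in>I. pure ?T H (E a s)
        ((c a i \<odot> S (c j b)) \<odot> (c b k \<odot> S (c l s))))"
      using B(2) by simp
    also have "\<dots> = (\<Sum>a\<in>I. \<Sum>s\<in>I. \<Sum>b\<in>I. pure ?T H (E a s)
        ((c a i \<odot> S (c j b)) \<odot> (c b k \<odot> S (c l s))))"
      by (intro sum.cong refl sum.swap)
    also have "\<dots> = (\<Sum>a\<in>I. \<Sum>s\<in>I. pure ?T H (E a s)
        (\<Sum>b\<in>I. (c a i \<odot> S (c j b)) \<odot> (c b k \<odot> S (c l s))))"
      by (intro sum.cong refl pure_sum_right[OF vspace_H, symmetric] x)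
    also have "\<dots> = (\<Sum>a\<in>I. \<Sum>s\<in>I. pure ?T H (E a s) (if j = k then c a i \<odot> S (c l s) else 0))"
      by (intro sum.cong refl) (simp add: comatrix_mul_cancel[OF M(3)] x)
    also have "\<dots> = coact ?A (end_mult V (pure ?T ?T (E i j) (E k l)))"
    proof (cases "j = k")
      case True
      then show ?thesis by (simp add: multE coactE ij kl)
    next
      case False
      then show ?thesis
        using linear_map_zero[OF MA(4,1) vspace_tensor]
        by (simp add: multE pure_zero_right[OF vspace_H] x)
    qed
    finally show "coact ?A (amult ?A (pure ?A ?A (pure V ?D (e (fst (fst q))) (f (snd (fst q))))
        (pure V ?D (e (fst (snd q))) (f (snd (snd q)))))) =
      (\<Sum>p\<in>(I \<times> I) \<times> (I \<times> I). pure ?A H (amult ?A (pure ?A ?A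
        (pure V ?D (e (fst (fst p))) (f (snd (fst p)))) (pure V ?D (e (fst (snd p))) (f (snd (snd p))))))
        (c (fst (fst p)) (fst (fst q)) \<odot> S (c (snd (fst q)) (snd (fst p))) \<odot>
         (c (fst (snd p)) (fst (snd q)) \<odot> S (c (snd (snd q)) (snd (snd p))))))"
      by (simp add: q sum.cartesian_product' end_alg_simps end_alg_tensor_cong E_def)
  qed
  moreover have "comodule_map H (unit_comod H) ?A (aunit ?A)"
  proof (rule comodule_map_matrixI[OF has_matrix_unit MA(1) MA(4)])
    have ceq: "coev V = (\<Sum>i\<in>I. E i i)" unfolding E_def using M(2) V f by (rule coev_eq)
    show "linear_map (unit_comod H) ?A (aunit ?A)"
      using lin1 by (simp add: linear_map_def unit_comod_def)
    have TA: "carrier ?T = carrier ?A" by (simp add: end_alg_simps)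
    note x = mul_in antipode_in C(2) E_in
    have "coact ?A (coev V) = (\<Sum>i\<in>I. coact ?A (E i i))"
      unfolding ceq by (rule linear_map_sum[OF MA(4,1) vspace_tensor]) (simp add: E_in flip: TA)
    also have "\<dots> = (\<Sum>i\<in>I. \<Sum>a\<in>I. \<Sum>b\<in>I. pure ?T H (E a b) (c a i \<odot> S (c i b)))"
      by (intro sum.cong refl coactE)
    also have "\<dots> = (\<Sum>a\<in>I. \<Sum>b\<in>I. \<Sum>i\<in>I. pure ?T H (E a b) (c a i \<odot> S (c i b)))"
      by (subst sum.swap) (intro sum.cong refl sum.swap)
    also have "\<dots> = (\<Sum>a\<in>I. \<Sum>b\<in>I. pure ?T H (E a b) (\<Sum>i\<in>I. c a i \<odot> S (c i b)))"
      by (intro sum.cong refl pure_sum_right[OF vspace_H, symmetric] x)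
    also have "\<dots> = (\<Sum>a\<in>I. \<Sum>b\<in>I. if a = b then pure ?T H (E a b) one else 0)"
      by (intro sum.cong refl) (simp add: comatrix_antipode[OF M(3)] pure_zero_right[OF vspace_H] x)
    also have "\<dots> = (\<Sum>a\<in>I. pure ?T H (E a a) one)"
      using B(2) by simp
    also have "\<dots> = pure ?T H (coev V) one"
      unfolding ceq by (intro pure_sum_left[OF vspace_tensor one_in, symmetric] x)
    finally show "coact ?A (aunit ?A 1) = (\<Sum>i\<in>{()}. pure ?A H (aunit ?A 1) one)"
      by (simp add: end_alg_simps end_alg_tensor_cong)
  qed
  ultimately show ?thesis
    using has_matrix_comodule[OF mA] by (simp add: comodule_algebra_def)
qed

text \<open>For \<open>F i j\<close>, the tensor of \<open>f i\<close> and \<open>e j\<close>, the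
  coaction coefficients are \<open>S (c i a) \<odot> c b j\<close>. In the coaction on
  \<open>F i k \<otimes> F k j\<close> the adjacent entries \<open>c b k\<close> and
  \<open>S (c k r)\<close> cancel under the sum over k and leave b = r, which is the
  comultiplication of \<open>F\<close> again. For the counit, S(c) c = 1 is used.\<close>

lemma comodule_coalgebra_coend_coalg:
  assumes m: "has_matrix V I e f c" and f: "\<And>i. i \<in> I \<Longrightarrow> f i \<in> carrier (dual_space V)"
  shows "comodule_coalgebra H (coend_coalg H V)"
proof -
  note M = has_matrixD[OF m]
  note V = M(1) and B = dual_basisD[OF M(2)] and C = comatrixD[OF M(3)]
  let ?D = "dual_space V"
  let ?C = "coend_coalg H V"
  let ?T = "?D \<otimes> V"
  let ?\<epsilon> = "\<lambda>t. t (\<lambda>f v. f v) :: 'k"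
  have mC: "has_matrix ?C (I \<times> I) (\<lambda>p. pure ?D V (f (fst p)) (e (snd p)))
    (\<lambda>p t. t (\<lambda>g v. g (e (fst p)) * f (snd p) v)) (\<lambda>p q. S (c (fst q) (fst p)) \<odot> c (snd p) (snd q))"
    using m f by (rule has_matrix_coend_coalg)
  note MC = has_matrixD[OF mC]
  define F where "F i j = pure ?D V (f i) (e j)" for i j
  have F_in: "F i j \<in> carrier ?T" if "i \<in> I" "j \<in> I" for i j
    using that by (auto simp: F_def intro!: pure_in f B(3))
  have TC: "carrier ?T = carrier ?C" by (simp add: coend_coalg_simps)
  have coactF: "coact ?C (F i j) = (\<Sum>p\<in>I\<times>I. pure ?C H (F (fst p) (snd p)) (S (c i (fst p)) \<odot> c (snd p) j))"
    if "i \<in> I" "j \<in> I" for i j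
    using MC(5)[of "(i, j)"] that by (simp add: F_def)
  have dF: "coend_comult V (F i j) = (\<Sum>k\<in>I. pure ?T ?T (F i k) (F k j))" if "i \<in> I" "j \<in> I" for i j
    unfolding F_def using M(2) V f f[OF that(1)] B(3)[OF that(2)] by (rule coend_comult_pure)
  have eF: "?\<epsilon> (F i j) = (if i = j then 1 else 0)" if "i \<in> I" "j \<in> I" for i j
    using that by (simp add: F_def pure_apply[OF bilinear_dual_pairing] B(5))
  have "linear_map ?T (?T \<otimes> ?T) (coend_comult V)"
    using M(2) V f by (rule linear_coend_comult)
  then have linC: "linear_map ?C (?C \<otimes> ?C) (ccomult ?C)"
    by (simp add: linear_map_def coend_coalg_simps coend_coalg_tensor_cong)
  have lin\<epsilon>: "linear_map ?C ground (ccounit ?C)"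
    using tensor_eval_linear_tensor[of ?D V] by (simp add: linear_map_def coend_coalg_simps)
  note x = mul_in antipode_in C(2) F_in
  have "coalgebra ?C (ccomult ?C) (ccounit ?C)"
  proof (rule matrix_coalgebra[OF MC(1) B(2) MC(2)[folded F_def] linC lin\<epsilon>])
    show "ccomult ?C (F i j) = (\<Sum>k\<in>I. pure ?C ?C (F i k) (F k j))" if "i \<in> I" "j \<in> I" for i j
      using dF[OF that] by (simp add: coend_coalg_simps coend_coalg_tensor_cong)
    show "ccounit ?C (F i j) = (if i = j then 1 else 0)" if "i \<in> I" "j \<in> I" for i j
      using eF[OF that] by (simp add: coend_coalg_simps)
  qed
  moreover have "comodule_map H ?C (tensor_comod H ?C ?C) (ccomult ?C)"
  proof (rule comodule_map_matrixI[OF mC])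
    note MT = has_matrixD[OF has_matrix_tensor[OF mC mC]]
    show "vspace (tensor_comod H ?C ?C)" by (rule MT(1))
    show "linear_map (tensor_comod H ?C ?C) (tensor_comod H ?C ?C \<otimes> H)
        (coact (tensor_comod H ?C ?C))" by (rule MT(4))
    show "linear_map ?C (tensor_comod H ?C ?C) (ccomult ?C)"
      using linC by (simp add: linear_map_def coend_coalg_tensor_cong)
  next
    fix q assume "q \<in> I \<times> I"
    then obtain i j where q: "q = (i, j)" and ij: "i \<in> I" "j \<in> I" by auto
    note MT = has_matrixD[OF has_matrix_tensor[OF mC mC]]
    let ?P = "pure (?T \<otimes> ?T) H"
    have "coact (tensor_comod H ?C ?C) (coend_comult V (F i j)) =
        (\<Sum>k\<in>I. coact (tensor_comod H ?C ?C) (pure ?T ?T (F i k) (F k j)))"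
      unfolding dF[OF ij]
      by (rule linear_map_sum[OF MT(4,1) vspace_tensor])
        (auto simp: coend_coalg_tensor_cong intro!: pure_in F_in ij)
    also have "\<dots> = (\<Sum>k\<in>I. \<Sum>a\<in>I. \<Sum>b\<in>I. \<Sum>r\<in>I. \<Sum>s\<in>I. ?P (pure ?T ?T (F a b) (F r s))
        ((S (c i a) \<odot> c b k) \<odot> (S (c k r) \<odot> c s j)))"
    proof (rule sum.cong[OF refl])
      fix k assume k: "k \<in> I"
      have "coact (tensor_comod H ?C ?C) (pure ?C ?C (F i k) (F k j)) =
          (\<Sum>p\<in>I\<times>I. \<Sum>q\<in>I\<times>I. pure (?C \<otimes> ?C) H (pure ?C ?C (F (fst p) (snd p)) (F (fst q) (snd q)))
            ((S (c i (fst p)) \<odot> c (snd p) k) \<odot> (S (c k (fst q)) \<odot> c (snd q) j)))"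
        by (rule tensor_coact_sum[OF MC(1,1,4,4) _ _ _ _ coactF[OF ij(1) k] coactF[OF k ij(2)]])
          (auto simp: x ij k simp flip: TC)
      then show "coact (tensor_comod H ?C ?C) (pure ?T ?T (F i k) (F k j)) =
        (\<Sum>a\<in>I. \<Sum>b\<in>I. \<Sum>r\<in>I. \<Sum>s\<in>I. ?P (pure ?T ?T (F a b) (F r s))
          ((S (c i a) \<odot> c b k) \<odot> (S (c k r) \<odot> c s j)))"
        by (simp add: coend_coalg_tensor_cong sum.cartesian_product')
    qed
    also have "\<dots> = (\<Sum>a\<in>I. \<Sum>b\<in>I. \<Sum>r\<in>I. \<Sum>s\<in>I. \<Sum>k\<in>I. ?P (pure ?T ?T (F a b) (F r s))
        ((S (c i a) \<odot> c b k) \<odot> (S (c k r) \<odot> c s j)))"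
      \<comment> \<open>The index \<open>k\<close> is moved inside the four other sums, where it
        occurs only in the factor from \<open>H\<close>.\<close>
      by (rule trans[OF sum.swap], rule sum.cong[OF refl], rule trans[OF sum.swap],
          rule sum.cong[OF refl], rule trans[OF sum.swap], rule sum.cong[OF refl], rule sum.swap)
    also have "\<dots> = (\<Sum>a\<in>I. \<Sum>b\<in>I. \<Sum>r\<in>I. \<Sum>s\<in>I. ?P (pure ?T ?T (F a b) (F r s))
        (\<Sum>k\<in>I. (S (c i a) \<odot> c b k) \<odot> (S (c k r) \<odot> c s j)))"
      by (intro sum.cong refl pure_sum_right[OF vspace_H, symmetric] pure_in x ij)
    also have "\<dots> = (\<Sum>a\<in>I. \<Sum>b\<in>I. \<Sum>r\<in>I. if b = r then \<Sum>s\<in>I. ?P (pure ?T ?T (F a b) (F r s))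
        (S (c i a) \<odot> c s j) else 0)"
      by (intro sum.cong refl)
        (simp add: comatrix_mul_cancel[OF M(3)] pure_zero_right[OF vspace_H] pure_in x ij)
    also have "\<dots> = (\<Sum>a\<in>I. \<Sum>k\<in>I. \<Sum>b\<in>I. ?P (pure ?T ?T (F a k) (F k b)) (S (c i a) \<odot> c b j))"
      using B(2) by simp
    also have "\<dots> = (\<Sum>a\<in>I. \<Sum>b\<in>I. \<Sum>k\<in>I. ?P (pure ?T ?T (F a k) (F k b)) (S (c i a) \<odot> c b j))"
      by (intro sum.cong refl sum.swap)
    also have "\<dots> = (\<Sum>a\<in>I. \<Sum>b\<in>I. ?P (coend_comult V (F a b)) (S (c i a) \<odot> c b j))"
      by (intro sum.cong refl, subst dF, assumption, assumption)
        (intro pure_sum_left[OF vspace_tensor, symmetric] pure_in x ij)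
    finally show "coact (tensor_comod H ?C ?C) (ccomult ?C (pure ?D V (f (fst q)) (e (snd q)))) =
      (\<Sum>p\<in>I\<times>I. pure (tensor_comod H ?C ?C) H (ccomult ?C (pure ?D V (f (fst p)) (e (snd p))))
        (S (c (fst q) (fst p)) \<odot> c (snd p) (snd q)))"
      by (simp add: q sum.cartesian_product' coend_coalg_simps coend_coalg_tensor_cong
          pure_tensor_comod F_def)
  qed
  moreover have "comodule_map H ?C (unit_comod H) (ccounit ?C)"
  proof (rule comodule_map_matrixI[OF mC has_matrixD(1,4)[OF has_matrix_unit]])
    show "linear_map ?C (unit_comod H) (ccounit ?C)"
      using lin\<epsilon> by (simp add: linear_map_def unit_comod_def)
  next
    fix q assume "q \<in> I \<times> I"
    then obtain i j where q: "q = (i, j)" and ij: "i \<in> I" "j \<in> I" by auto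
    have U: "pure (unit_comod H) H = pure ground H" by (rule pure_cong) (simp_all add: unit_comod_def)
    have "(\<Sum>a\<in>I. \<Sum>b\<in>I. pure ground H (?\<epsilon> (F a b)) (S (c i a) \<odot> c b j)) =
        (\<Sum>a\<in>I. \<Sum>b\<in>I. if a = b then pure ground H 1 (S (c i a) \<odot> c b j) else 0)"
      by (intro sum.cong refl) (simp add: eF pure_zero_left[OF vspace_ground] x ij)
    also have "\<dots> = (\<Sum>a\<in>I. pure ground H 1 (S (c i a) \<odot> c a j))" using B(2) by simp
    also have "\<dots> = pure ground H 1 (\<Sum>a\<in>I. S (c i a) \<odot> c a j)"
      by (intro pure_sum_right[OF vspace_H, symmetric] x ij) simp
    also have "\<dots> = pure ground H (?\<epsilon> (F i j)) one"
      by (simp add: comatrix_antipode[OF M(3)] ij eF pure_zero_left[OF vspace_ground one_in]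
          pure_zero_right[OF vspace_H])
    finally show "coact (unit_comod H) (ccounit ?C (pure ?D V (f (fst q)) (e (snd q)))) =
      (\<Sum>p\<in>I\<times>I. pure (unit_comod H) H (ccounit ?C (pure ?D V (f (fst p)) (e (snd p))))
        (S (c (fst q) (fst p)) \<odot> c (snd p) (snd q)))"
      by (simp add: q sum.cartesian_product' coend_coalg_simps U F_def)
        (simp add: unit_comod_def)
  qed
  ultimately show ?thesis
    using has_matrix_comodule[OF mC] by (simp add: comodule_coalgebra_def)
qed

end

section \<open>The regular representation\<close>

text \<open>K^n as sequences that vanish from index n on. For every n it lies in the single type
  \<open>nat \<Rightarrow> 'k\<close> over which the existential statements range.\<close>

definition std_space :: "nat \<Rightarrow> ('k::field, nat \<Rightarrow> 'k) vspace" where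
  "std_space n = \<lparr>carrier = {g. \<forall>i\<ge>n. g i = 0}, smult = fscale\<rparr>"

definition unit_vec :: "nat \<Rightarrow> nat \<Rightarrow> 'k::field" where
  "unit_vec i = (\<lambda>x. if x = i then 1 else 0)"

text \<open>The cut-off outside the carrier is what membership in \<open>dual_space\<close>
  demands.\<close>

definition coord :: "nat \<Rightarrow> nat \<Rightarrow> (nat \<Rightarrow> 'k) \<Rightarrow> 'k::field" where
  "coord n i g = (if g \<in> carrier (std_space n) then g i else 0)"

lemma vspace_std: "vspace (std_space n :: ('k::field, nat \<Rightarrow> 'k) vspace)"
proof -
  interpret vector_space "fscale :: 'k \<Rightarrow> (nat \<Rightarrow> 'k) \<Rightarrow> nat \<Rightarrow> 'k" by (rule vector_space_fscale)
  have "subspace (carrier (std_space n))"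
    unfolding subspace_def by (auto simp: std_space_def fscale_def)
  then show ?thesis by (simp add: vspace_def std_space_def vector_space_fscale)
qed

lemma coord_dual: "coord n i \<in> carrier (dual_space (std_space n))"
  unfolding dual_space_simps
  by (auto intro!: linear_mapI simp: coord_def vspace_add[OF vspace_std] vspace_scale[OF vspace_std])
    (simp add: std_space_def fscale_def)

lemma dual_basis_std: "dual_basis (std_space n) {..<n} unit_vec (coord n)"
proof -
  have 1: "unit_vec i \<in> carrier (std_space n)" if "i < n" for i
    using that by (auto simp: std_space_def unit_vec_def)
  have 2: "g = (\<Sum>i<n. fscale (coord n i g) (unit_vec i))" if g: "g \<in> carrier (std_space n)" for g
  proof
    fix x
    have "(\<Sum>i<n. fscale (coord n i g) (unit_vec i)) x = (\<Sum>i<n. if x = i then g x else 0)"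
      unfolding sum_fun_apply using g by (intro sum.cong) (auto simp: fscale_def unit_vec_def coord_def)
    also have "\<dots> = g x" using g by (auto simp: std_space_def)
    finally show "g x = (\<Sum>i<n. fscale (coord n i g) (unit_vec i)) x" ..
  qed
  show ?thesis
    unfolding dual_basis_def dual_family_def
    using 1 2 coord_dual[of n]
    by (auto simp: dual_space_simps std_space_def) (auto simp: coord_def std_space_def unit_vec_def)
qed

section \<open>The comodule K^n with a prescribed matrix\<close>

context hopf_alg
begin

definition std_comod :: "nat \<Rightarrow> (nat \<Rightarrow> nat \<Rightarrow> 'h) \<Rightarrow> ('k, nat \<Rightarrow> 'k, 'h) comod" where
  "std_comod n c = \<lparr>carrier = carrier (std_space n), smult = smult (std_space n),
     coact = (\<lambda>g. \<Sum>j<n. fscale (coord n j g) (\<Sum>i<n. pure (std_space n) H (unit_vec i) (c i j)))\<rparr>"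

lemma std_comod_simps:
  "carrier (std_comod n c) = carrier (std_space n)" "smult (std_comod n c) = smult (std_space n)"
  by (simp_all add: std_comod_def)

lemma dual_space_std: "dual_space (std_comod n c) = dual_space (std_space n)"
  by (simp add: dual_space_def std_comod_simps linear_map_def)

lemma has_matrix_std:
  assumes c: "comatrix {..<n} c"
  shows "has_matrix (std_comod n c) {..<n} unit_vec (coord n) c"
proof -
  let ?V = "std_space n"
  note B = dual_basisD[OF dual_basis_std[of n]] and C = comatrixD[OF c]
  let ?\<rho> = "\<lambda>g. \<Sum>j<n. fscale (coord n j g) (\<Sum>i<n. pure ?V H (unit_vec i) (c i j))"
  have "linear_map ?V (?V \<otimes> H) ?\<rho>"
    by (rule linear_map_sum_fun[OF vspace_tensor], fold tensor_smult[of ?V H],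
        rule linear_map_smult_vec[OF vspace_tensor B(4)])
      (auto intro!: vspace_sum[OF vspace_tensor] pure_in B(3) C(2))
  moreover have "?\<rho> (unit_vec j) = (\<Sum>i<n. pure ?V H (unit_vec i) (c i j))" if "j < n" for j
  proof -
    have "?\<rho> (unit_vec j) =
        (\<Sum>l<n. if l = j then \<Sum>i<n. pure ?V H (unit_vec i) (c i l) else 0)"
      using that by (intro sum.cong refl) (simp add: B(5))
    then show ?thesis using that by simp
  qed
  ultimately show ?thesis
    unfolding has_matrix_def vspace_eq_cong[OF std_comod_simps] dual_basis_cong[OF std_comod_simps]
      pure_cong[OF std_comod_simps refl refl] tensor_cong[OF std_comod_simps refl refl]
    using c by (simp add: std_comod_def vspace_std dual_basis_std)
qed

lemma has_matrix_fin_dim: "has_matrix V I e f c \<Longrightarrow> fin_dim V"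
  by (rule dual_basis_fin_dim[OF has_matrixD(1,2)])

section \<open>Left multiplication as a morphism into V \<otimes> V^*, for V a copy of the comodule
  Y\<close>

context
  fixes Y :: "('k, 'y::ab_group_add, 'h) comod_alg" and V :: "('k, 'v::ab_group_add, 'h) comod"
    and I :: "'i set" and y ys e f c
  assumes Y: "comodule_algebra H Y" and mY: "has_matrix Y I y ys c"
    and mV: "has_matrix V I e f c" and f: "\<And>i. i \<in> I \<Longrightarrow> f i \<in> carrier (dual_space V)"
begin

text \<open>The comodule isomorphism matching \<open>y i\<close> with \<open>e i\<close>:
  \<open>Y\<close> and \<open>V\<close> share the matrix \<open>c\<close> but not the type. Products
  are formed in \<open>Y\<close>, tensors over \<open>V\<close>.\<close>

definition transport where "transport a = (\<Sum>i\<in>I. smult V (ys i a) (e i))"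

definition regular where
  "regular a = (\<Sum>j\<in>I. pure V (dual_space V) (transport (amult Y (pure Y Y a (y j)))) (f j))"

private abbreviation amul (infixl "\<cdot>" 75) where "a \<cdot> b \<equiv> amult Y (pure Y Y a b)"

lemma comodule_algebra_facts:
  shows "vspace Y" and "linear_map (Y \<otimes> Y) Y (amult Y)"
    and "aunit Y 1 \<in> carrier Y"
    and "a \<in> carrier Y \<Longrightarrow> aunit Y 1 \<cdot> a = a" "a \<in> carrier Y \<Longrightarrow> a \<cdot> aunit Y 1 = a"
    and "bilinear_map Y Y Y (\<lambda>a b. a \<cdot> b)"
    and "a \<in> carrier Y \<Longrightarrow> b \<in> carrier Y \<Longrightarrow> d \<in> carrier Y \<Longrightarrow> a \<cdot> b \<cdot> d = a \<cdot> (b \<cdot> d)"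
proof -
  have A: "algebra Y (amult Y) (aunit Y)" using Y by (simp add: comodule_algebra_def)
  show "vspace Y" and lin: "linear_map (Y \<otimes> Y) Y (amult Y)"
    and "a \<in> carrier Y \<Longrightarrow> aunit Y 1 \<cdot> a = a" "a \<in> carrier Y \<Longrightarrow> a \<cdot> aunit Y 1 = a"
    using A by (simp_all add: algebra_def)
  have "linear_map ground Y (aunit Y)" using A by (simp add: algebra_def)
  then show "aunit Y 1 \<in> carrier Y" by (rule linear_map_in) simp
  show "bilinear_map Y Y Y (\<lambda>a b. a \<cdot> b)"
    by (rule bilinear_map_comp_out[OF bilinear_pure lin])
  assume abd: "a \<in> carrier Y" "b \<in> carrier Y" "d \<in> carrier Y"
  let ?t = "pure (Y \<otimes> Y) Y (pure Y Y a b) d"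
  have "?t \<in> carrier ((Y \<otimes> Y) \<otimes> Y)" using abd by (intro pure_in)
  then have "amult Y (tmap Y Y (amult Y) id ?t) = amult Y (tmap Y Y id (amult Y) (assoc Y Y Y ?t))"
    using A by (simp add: algebra_def)
  then show "a \<cdot> b \<cdot> d = a \<cdot> (b \<cdot> d)"
    by (simp add: tmap_pure[OF lin linear_map_id] tmap_pure[OF linear_map_id lin]
        assoc_pure[OF \<open>vspace Y\<close> \<open>vspace Y\<close> abd(3)])
qed

private lemmas A = comodule_algebra_facts
private lemmas MY = has_matrixD[OF mY] and MV = has_matrixD[OF mV]
private lemmas BY = dual_basisD[OF MY(2)] and BV = dual_basisD[OF MV(2)]
private lemmas V = MV(1) and C = comatrixD[OF MY(3)]

private lemma amul_in: "a \<in> carrier Y \<Longrightarrow> b \<in> carrier Y \<Longrightarrow> a \<cdot> b \<in> carrier Y"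
  by (rule linear_map_in[OF bilinear_map_right[OF A(6)]])

private lemma mE: "has_matrix (end_alg H V) (I \<times> I) (\<lambda>p. pure V (dual_space V) (e (fst p)) (f (snd p)))
    (\<lambda>p t. t (\<lambda>v g. f (fst p) v * g (e (snd p)))) (\<lambda>p q. c (fst p) (fst q) \<odot> S (c (snd q) (snd p)))"
  using mV f by (rule has_matrix_end_alg)

lemma linear_transport: "linear_map Y V transport"
proof -
  show ?thesis
    unfolding transport_def[abs_def]
    by (rule linear_map_sum_fun[OF V]) (rule linear_map_smult_vec[OF V BY(4) BV(3)])
qed

private lemmas tr_in = linear_map_in[OF linear_transport]

lemma transport_basis: "i \<in> I \<Longrightarrow> transport (y i) = e i"
proof -
  assume i: "i \<in> I"
  have "transport (y i) = (\<Sum>k\<in>I. if k = i then e k else 0)"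
    unfolding transport_def
    by (intro sum.cong refl) (simp add: BY(5) i vspace_smult_simps[OF V])
  then show ?thesis using i BY(2) by simp
qed

lemma coord_transport: "i \<in> I \<Longrightarrow> a \<in> carrier Y \<Longrightarrow> f i (transport a) = ys i a"
proof -
  assume i: "i \<in> I" and a: "a \<in> carrier Y"
  show ?thesis
    by (rule dual_basis_linear_eq[OF MY(2,1) vspace_ground
          linear_map_comp[OF linear_transport BV(4)[OF i]] BY(4)[OF i] _ a])
      (simp add: transport_basis BY(5) BV(5) i)
qed

lemma comodule_map_transport: "comodule_map H Y V transport"
  by (rule comodule_map_matrixI[OF mY MV(1,4) linear_transport])
    (simp add: transport_basis MV(5))

lemma linear_regular: "linear_map Y (V \<otimes> dual_space V) regular"
proof -
  show ?thesis
    unfolding regular_def[abs_def]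
    by (rule linear_map_sum_fun[OF vspace_tensor])
      (rule linear_map_comp[OF linear_map_comp[OF
          bilinear_map_left[OF comodule_algebra_facts(6) BY(3)] linear_transport] linear_pure_left[OF f]])
qed

text \<open>Pairing \<open>f j\<close> with the transported product of \<open>b\<close> and
  \<open>y q\<close> gives the coordinate \<open>ys j (b \<cdot> y q)\<close> in \<open>Y\<close>.
  Summing over j reassembles \<open>a \<cdot> (b \<cdot> y q)\<close>, and associativity of
  \<open>Y\<close> finishes.\<close>

lemma regular_mult:
  assumes a: "a \<in> carrier Y" and b: "b \<in> carrier Y"
  shows "regular (a \<cdot> b) = end_mult V (pure (V \<otimes> dual_space V) (V \<otimes> dual_space V) (regular a) (regular b))"
proof -
  let ?D = "dual_space V"
  let ?T = "V \<otimes> ?D"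
  have bil: "bilinear_map ?T ?T ?T (\<lambda>x y. end_mult V (pure ?T ?T x y))"
    by (rule bilinear_map_comp_out[OF bilinear_pure linear_end_mult[OF V]])
  let ?t = "\<lambda>x j. pure V ?D (transport (x \<cdot> y j)) (f j)"
  have t_in: "?t x j \<in> carrier ?T" if "x \<in> carrier Y" "j \<in> I" for x j
    using that by (intro pure_in tr_in amul_in BY(3) f)
  have "end_mult V (pure ?T ?T (regular a) (regular b)) =
      (\<Sum>j\<in>I. \<Sum>q\<in>I. end_mult V (pure ?T ?T (?t a j) (?t b q)))"
    unfolding regular_def
    by (intro bilinear_map_sum[OF bil vspace_tensor vspace_tensor vspace_tensor] t_in a b)
  also have "\<dots> = (\<Sum>j\<in>I. \<Sum>q\<in>I. pure V ?D (smult V (ys j (b \<cdot> y q)) (transport (a \<cdot> y j))) (f q))"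
    by (intro sum.cong refl)
      (simp add: end_mult_pure[OF V] tr_in amul_in a b BY(3) f coord_transport pure_scale_left)
  also have "\<dots> = (\<Sum>q\<in>I. \<Sum>j\<in>I. pure V ?D (smult V (ys j (b \<cdot> y q)) (transport (a \<cdot> y j))) (f q))"
    by (rule sum.swap)
  also have "\<dots> = (\<Sum>q\<in>I. pure V ?D (\<Sum>j\<in>I. smult V (ys j (b \<cdot> y q)) (transport (a \<cdot> y j))) (f q))"
    by (intro sum.cong refl pure_sum_left[OF V, symmetric] vspace_scale[OF V] tr_in amul_in a BY(3) f)
  also have "\<dots> = (\<Sum>q\<in>I. pure V ?D (transport (a \<cdot> (b \<cdot> y q))) (f q))"
    by (intro sum.cong refl arg_cong[where f = "\<lambda>x. pure V ?D x (f _)"]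
        dual_basis_linear_expand[OF MY(2,1) V
          linear_map_comp[OF bilinear_map_right[OF A(6) a] linear_transport], symmetric] amul_in b BY(3))
  also have "\<dots> = regular (a \<cdot> b)"
    unfolding regular_def by (intro sum.cong refl) (simp add: A(7) a b BY(3))
  finally show ?thesis ..
qed

text \<open>Colinearity of the product of \<open>Y\<close> contributes
  \<open>c a i \<odot> c b j\<close>, the dual factor contributes \<open>S (c j q)\<close>. The sum
  over j in \<open>regular\<close> joins the adjacent entries \<open>c b j\<close> and
  \<open>S (c j q)\<close>, which cancel to the delta of b and q, and only \<open>c a i\<close>
  survives. Left multiplication is what makes them adjacent.\<close>

lemma coact_regular:
  assumes i: "i \<in> I"
  shows "coact (end_alg H V) (regular (y i)) = (\<Sum>a\<in>I. pure (V \<otimes> dual_space V) H (regular (y a)) (c a i))"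
proof -
  let ?D = "dual_space V"
  let ?T = "V \<otimes> ?D"
  let ?P = "pure ?T H"
  have mD: "has_matrix (dual_comod H V) I f (\<lambda>i g. g (e i)) (\<lambda>i j. S (c j i))"
    using mV f by (rule has_matrix_dual)
  have y_mul_in: "y a \<cdot> y b \<in> carrier Y" if "a \<in> I" "b \<in> I" for a b
    using that by (intro amul_in BY(3))
  note x = tr_in y_mul_in mul_in antipode_in C(2) f
  have coactYY: "coact Y (y k \<cdot> y j) = (\<Sum>p\<in>I\<times>I. pure Y H (y (fst p) \<cdot> y (snd p)) (c (fst p) k \<odot> c (snd p) j))"
    if "k \<in> I" "j \<in> I" for k j
  proof -
    note MT = has_matrixD[OF has_matrix_tensor[OF mY mY]]
    have "comodule_map H (tensor_comod H Y Y) Y (amult Y)"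
      using Y by (simp add: comodule_algebra_def)
    from comodule_map_sum[OF this MT(1) _ _ _ MT(5)[of "(k, j)"]] that show ?thesis
      by (auto simp: pure_in BY(3) mul_in C(2))
  qed
  have coactV: "coact V (transport (y k \<cdot> y j)) =
      (\<Sum>p\<in>I\<times>I. pure V H (transport (y (fst p) \<cdot> y (snd p))) (c (fst p) k \<odot> c (snd p) j))"
    if "k \<in> I" "j \<in> I" for k j
    by (rule comodule_map_sum[OF comodule_map_transport MY(1) y_mul_in[OF that] _ _ coactYY[OF that]])
      (auto simp: y_mul_in mul_in C(2) that)
  let ?t = "\<lambda>j. pure V ?D (transport (y i \<cdot> y j)) (f j)"
  have "coact (end_alg H V) (regular (y i)) = (\<Sum>j\<in>I. coact (end_alg H V) (?t j))"
    unfolding regular_def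
    by (rule linear_map_sum[OF has_matrixD(4,1)[OF mE] vspace_tensor])
      (simp add: end_alg_simps pure_in x i)
  also have "\<dots> = (\<Sum>j\<in>I. \<Sum>a\<in>I. \<Sum>b\<in>I. \<Sum>q\<in>I. ?P (pure V ?D (transport (y a \<cdot> y b)) (f q))
      ((c a i \<odot> c b j) \<odot> S (c j q)))"
  proof (rule sum.cong[OF refl])
    fix j assume j: "j \<in> I"
    have "coact (tensor_comod H V (dual_comod H V)) (pure V (dual_comod H V) (transport (y i \<cdot> y j)) (f j)) =
        (\<Sum>p\<in>I\<times>I. \<Sum>q\<in>I. pure (V \<otimes> dual_comod H V) H
          (pure V (dual_comod H V) (transport (y (fst p) \<cdot> y (snd p))) (f q))
          ((c (fst p) i \<odot> c (snd p) j) \<odot> S (c j q)))"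
      by (rule tensor_coact_sum[OF V has_matrixD(1)[OF mD] MV(4) has_matrixD(4)[OF mD] _ _ _ _
            coactV[OF i j] has_matrixD(5)[OF mD j]])
        (auto simp: x i j)
    then show "coact (end_alg H V) (?t j) = (\<Sum>a\<in>I. \<Sum>b\<in>I. \<Sum>q\<in>I.
        ?P (pure V ?D (transport (y a \<cdot> y b)) (f q)) ((c a i \<odot> c b j) \<odot> S (c j q)))"
      by (simp add: dual_comod_tensor_cong end_alg_simps sum.cartesian_product')
  qed
  also have "\<dots> = (\<Sum>a\<in>I. \<Sum>b\<in>I. \<Sum>q\<in>I. \<Sum>j\<in>I. ?P (pure V ?D (transport (y a \<cdot> y b)) (f q))
      ((c a i \<odot> c b j) \<odot> S (c j q)))"
    by (rule trans[OF sum.swap], rule sum.cong[OF refl], rule trans[OF sum.swap],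
        rule sum.cong[OF refl], rule sum.swap)
  also have "\<dots> = (\<Sum>a\<in>I. \<Sum>b\<in>I. \<Sum>q\<in>I. ?P (pure V ?D (transport (y a \<cdot> y b)) (f q))
      (\<Sum>j\<in>I. (c a i \<odot> c b j) \<odot> S (c j q)))"
    by (intro sum.cong refl pure_sum_right[OF vspace_H, symmetric] pure_in x i)
  \<comment> \<open>The product ends in \<open>S (c j q)\<close>, so the cancellation rule is used
    with \<open>one\<close> as its right outer factor.\<close>
  also have "\<dots> = (\<Sum>a\<in>I. \<Sum>b\<in>I. \<Sum>q\<in>I.
      if b = q then ?P (pure V ?D (transport (y a \<cdot> y b)) (f q)) (c a i) else 0)"
    using comatrix_mul_cancel(2)[OF MY(3) _ _ C(2) one_in]
    by (intro sum.cong refl) (simp add: mul_one x i pure_zero_right[OF vspace_H] pure_in)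
  also have "\<dots> = (\<Sum>a\<in>I. \<Sum>b\<in>I. ?P (pure V ?D (transport (y a \<cdot> y b)) (f b)) (c a i))"
    using BY(2) by simp
  also have "\<dots> = (\<Sum>a\<in>I. ?P (regular (y a)) (c a i))"
    unfolding regular_def
    by (intro sum.cong refl pure_sum_left[OF vspace_tensor, symmetric] pure_in x i)
  finally show ?thesis .
qed

lemma comodule_algebra_map_regular: "comodule_algebra_map H Y (end_alg H V) regular"
proof -
  let ?D = "dual_space V"
  let ?T = "V \<otimes> ?D"
  have lin: "linear_map Y (end_alg H V) regular"
    unfolding vspace_eq_cong(3)[OF end_alg_simps(1,2)] by (rule linear_regular)
  have "comodule_map H Y (end_alg H V) regular"
    by (rule comodule_map_matrixI[OF mY has_matrixD(1,4)[OF mE] lin])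
      (simp add: coact_regular end_alg_tensor_cong)
  moreover have "regular (amult Y t) = amult (end_alg H V) (tmap (end_alg H V) (end_alg H V) regular regular t)"
    if t: "t \<in> carrier (Y \<otimes> Y)" for t
  proof (rule tensor_linear_eq[OF linear_map_comp[OF A(2) linear_regular] _ A(1) vspace_tensor _ t])
    have "linear_map ((end_alg H V) \<otimes> (end_alg H V)) ?T (amult (end_alg H V))"
      using linear_end_mult[OF V] by (simp add: end_alg_tensor_cong end_alg_simps)
    then show "linear_map (Y \<otimes> Y) ?T
        (\<lambda>t. amult (end_alg H V) (tmap (end_alg H V) (end_alg H V) regular regular t))"
      by (rule linear_map_comp[OF linear_tmap[OF A(1) lin lin]])
    show "regular (a \<cdot> b) = amult (end_alg H V)
        (tmap (end_alg H V) (end_alg H V) regular regular (pure Y Y a b))"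
      if "a \<in> carrier Y" "b \<in> carrier Y" for a b
      using that by (simp add: tmap_pure[OF lin lin] regular_mult end_alg_simps end_alg_tensor_cong)
  qed
  moreover have "regular (aunit Y 1) = aunit (end_alg H V) 1"
  proof -
    have "coev V = (\<Sum>i\<in>I. pure V ?D (e i) (f i))"
      using MV(2) V f by (rule coev_eq)
    then show ?thesis
      unfolding regular_def
      by (simp add: A(4) BY(3) transport_basis end_alg_simps)
  qed
  ultimately show ?thesis by (simp add: comodule_algebra_map_def)
qed

text \<open>Contraction with evaluation at \<open>e j\<close> recovers the transported product with
  \<open>y j\<close>. Elements with equal image therefore have equal left multiplications, and these
  are compared at the unit of \<open>Y\<close>.\<close>

lemma regular_inject:
  assumes a: "a \<in> carrier Y" and b: "b \<in> carrier Y" and eq: "regular a = regular b"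
  shows "a = b"
proof -
  let ?D = "dual_space V"
  have slice: "rslice V ?D (\<lambda>g. g (e j)) (regular x) = transport (x \<cdot> y j)"
    if x: "x \<in> carrier Y" and j: "j \<in> I" for x j
  proof -
    note ev = linear_dual_eval[OF BV(3)[OF j]]
    have "rslice V ?D (\<lambda>g. g (e j)) (regular x) =
        (\<Sum>k\<in>I. rslice V ?D (\<lambda>g. g (e j)) (pure V ?D (transport (x \<cdot> y k)) (f k)))"
      unfolding regular_def
      by (rule linear_map_sum[OF linear_rslice[OF V ev] vspace_tensor V])
        (intro pure_in tr_in amul_in x BY(3) f)
    also have "\<dots> = (\<Sum>k\<in>I. if k = j then transport (x \<cdot> y k) else 0)"
      by (intro sum.cong refl)
        (simp add: rslice_pure[OF V ev] tr_in amul_in x BY(3) f BV(5) j vspace_smult_simps[OF V])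
    also have "\<dots> = transport (x \<cdot> y j)" using j BY(2) by simp
    finally show ?thesis .
  qed
  have "a \<cdot> y j = b \<cdot> y j" if j: "j \<in> I" for j
  proof -
    have "transport (a \<cdot> y j) = transport (b \<cdot> y j)"
      using slice[OF a j] slice[OF b j] eq by simp
    then have "ys i (a \<cdot> y j) = ys i (b \<cdot> y j)" if "i \<in> I" for i
      by (simp only: coord_transport[OF that amul_in[OF a BY(3)[OF j]], symmetric]
          coord_transport[OF that amul_in[OF b BY(3)[OF j]], symmetric])
    then have "(\<Sum>i\<in>I. smult Y (ys i (a \<cdot> y j)) (y i)) = (\<Sum>i\<in>I. smult Y (ys i (b \<cdot> y j)) (y i))"
      by (intro sum.cong refl) (simp only:)
    then show ?thesis
      by (simp only: BY(6)[OF amul_in[OF a BY(3)[OF j]]] BY(6)[OF amul_in[OF b BY(3)[OF j]]])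
  qed
  from dual_basis_linear_eq[OF MY(2,1) A(1) bilinear_map_right[OF A(6) a]
      bilinear_map_right[OF A(6) b] this A(3)]
  show ?thesis by (simp only: A(5) a b)
qed

end

text \<open>\<open>V\<close> is K^n with the matrix of the comodule \<open>Y\<close>. The one map
  \<open>regular\<close> is injective and so separates all pairs of morphisms into \<open>Y\<close>
  at once.\<close>

lemma end_alg_cogenerates:
  fixes Y :: "('k, 'y::ab_group_add, 'h) comod_alg"
  assumes Y: "comodule_algebra H Y" and fin: "fin_dim Y"
  obtains V :: "('k, nat \<Rightarrow> 'k, 'h) comod" and h where "comodule H V" "fin_dim V"
    "comodule_algebra_map H Y (end_alg H V) h" "inj_on h (carrier Y)"
proof -
  have cY: "comodule H Y" using Y by (simp add: comodule_algebra_def)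
  obtain n :: nat and y ys where b: "dual_basis Y {..<n} y ys"
    by (rule dual_basis_exists[OF comoduleD(1)[OF cY] fin])
  obtain c where mY: "has_matrix Y {..<n} y ys c"
    by (rule comodule_has_matrix[OF cY b])
  let ?V = "std_comod n c"
  have mV: "has_matrix ?V {..<n} unit_vec (coord n) c"
    by (rule has_matrix_std[OF has_matrixD(3)[OF mY]])
  have f: "coord n i \<in> carrier (dual_space ?V)" for i
    by (simp add: dual_space_std coord_dual)
  show ?thesis
    by (rule that[OF has_matrix_comodule[OF mV] has_matrix_fin_dim[OF mV]
          comodule_algebra_map_regular[OF Y mY mV f]])
      (rule inj_onI, rule regular_inject[OF Y mY mV f])
qed

end

section \<open>Local finiteness and the coalgebras \<open>V\<^sup>* \<otimes> V\<close>\<close>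

text \<open>Encodes that the right factors of \<open>t\<close> lie in the span of \<open>S\<close>
  by what is needed of it: every dual family whose span contains \<open>S\<close> expands
  \<open>t\<close>. In this form the property survives enlarging \<open>S\<close>, so several
  tensors can be given one family.\<close>

definition expands_over ::
  "('k::field, 'a::ab_group_add, 'z) vspace_scheme \<Rightarrow> ('k, 'b::ab_group_add, 'w) vspace_scheme
    \<Rightarrow> ('k, 'a, 'b) tensor \<Rightarrow> 'b set \<Rightarrow> bool" where
  "expands_over V W t S \<longleftrightarrow> (\<forall>n w \<phi>. dual_family W {..<n::nat} w \<phi> \<longrightarrow>
     (\<forall>s\<in>S. s = (\<Sum>k<n. smult W (\<phi> k s) (w k))) \<longrightarrow> t = (\<Sum>k<n. pure V W (rslice V W (\<phi> k) t) (w k)))"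

lemma expands_overI:
  assumes "\<And>(n::nat) w \<phi>. dual_family W {..<n} w \<phi> \<Longrightarrow>
    (\<And>s. s \<in> S \<Longrightarrow> s = (\<Sum>k<n. smult W (\<phi> k s) (w k))) \<Longrightarrow>
    t = (\<Sum>k<n. pure V W (rslice V W (\<phi> k) t) (w k))"
  shows "expands_over V W t S"
  unfolding expands_over_def
proof (intro allI impI)
  fix n :: nat and w \<phi>
  assume d: "dual_family W {..<n} w \<phi>" and s: "\<forall>s\<in>S. s = (\<Sum>k<n. smult W (\<phi> k s) (w k))"
  show "t = (\<Sum>k<n. pure V W (rslice V W (\<phi> k) t) (w k))"
    by (rule assms[OF d]) (rule bspec[OF s])
qed

lemma expands_overD:
  assumes e: "expands_over V W t S" and d: "dual_family W {..<n::nat} w \<phi>"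
    and s: "\<And>s. s \<in> S \<Longrightarrow> s = (\<Sum>k<n. smult W (\<phi> k s) (w k))"
  shows "t = (\<Sum>k<n. pure V W (rslice V W (\<phi> k) t) (w k))"
  by (rule e[unfolded expands_over_def, rule_format, OF d]) (rule s)

text \<open>The right factors are collected along an induction over sums of pure tensors.\<close>

lemma expands_over_finite:
  assumes t: "t \<in> carrier (V \<otimes> W)" and V: "vspace V" and W: "vspace W"
  obtains S where "finite S" "S \<subseteq> carrier W" "expands_over V W t S"
proof -
  from t V have "\<exists>S. finite S \<and> S \<subseteq> carrier W \<and> expands_over V W t S"
  proof (induction rule: tensor_induct)
    case zero
    have "expands_over V W 0 {}"
    proof (rule expands_overI)
      fix n :: nat and w \<phi> assume d: "dual_family W {..<n} w \<phi>"
      show "0 = (\<Sum>k<n. pure V W (rslice V W (\<phi> k) 0) (w k))"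
        by (intro sum.neutral[symmetric] ballI)
          (simp only: linear_map_zero[OF linear_rslice[OF V dual_familyD(3)[OF d]] vspace_tensor V]
            pure_zero_left[OF V dual_familyD(2)[OF d]])
    qed
    then show ?case
      by (intro exI[of _ "{}"]) (simp only: finite.emptyI empty_subsetI simp_thms)
  next
    case (add v b s)
    obtain S where S: "finite S" "S \<subseteq> carrier W" and es: "expands_over V W s S"
      using add(4) by (elim exE conjE)
    have "expands_over V W (pure V W v b + s) (insert b S)"
    proof (rule expands_overI)
      fix n :: nat and w \<phi>
      assume d: "dual_family W {..<n} w \<phi>"
        and ex: "\<And>s. s \<in> insert b S \<Longrightarrow> s = (\<Sum>k<n. smult W (\<phi> k s) (w k))"
      note D = dual_familyD[OF d]
      have s: "s = (\<Sum>k<n. pure V W (rslice V W (\<phi> k) s) (w k))"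
        by (rule expands_overD[OF es d]) (rule ex, simp)
      have "pure V W v b = pure V W v (\<Sum>k<n. smult W (\<phi> k b) (w k))"
        by (rule arg_cong[OF ex]) simp
      also have "\<dots> = (\<Sum>k<n. pure V W v (smult W (\<phi> k b) (w k)))"
        by (intro pure_sum_right[OF W add(1)] vspace_scale[OF W] D(2))
      also have "\<dots> = (\<Sum>k<n. pure V W (rslice V W (\<phi> k) (pure V W v b)) (w k))"
        by (intro sum.cong refl)
          (simp add: rslice_pure[OF V D(3)] add(1,2) pure_scale_left pure_scale_right D(2))
      finally have b: "pure V W v b = (\<Sum>k<n. pure V W (rslice V W (\<phi> k) (pure V W v b)) (w k))" .
      have "pure V W v b + s = (\<Sum>k<n. pure V W (rslice V W (\<phi> k) (pure V W v b)) (w k)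
          + pure V W (rslice V W (\<phi> k) s) (w k))"
        by (subst sum.distrib) (rule arg_cong2[OF b s, of "(+)"])
      also have "\<dots> = (\<Sum>k<n. pure V W (rslice V W (\<phi> k) (pure V W v b + s)) (w k))"
      proof (rule sum.cong[OF refl])
        fix k assume "k \<in> {..<n}"
        note r = linear_rslice[OF V D(3)[OF this]] and p = linear_pure_left[OF D(2)[OF this], of V]
        show "pure V W (rslice V W (\<phi> k) (pure V W v b)) (w k) + pure V W (rslice V W (\<phi> k) s) (w k)
          = pure V W (rslice V W (\<phi> k) (pure V W v b + s)) (w k)"
          by (rule linear_map_add[OF linear_map_comp[OF r p] pure_in[OF add(1,2)] add(3), symmetric])
      qed
      finally show "pure V W v b + s = (\<Sum>k<n. pure V W (rslice V W (\<phi> k) (pure V W v b + s)) (w k))" .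
    qed
    then show ?case
      by (intro exI[of _ "insert b S"]) (simp only: finite_insert insert_subset S add(2) simp_thms)
  qed
  then show ?thesis using that by (elim exE conjE)
qed

text \<open>A basis of the span of all right factors together works for every \<open>t k\<close>.
  The range of the inner index \<open>u\<close> then does not depend on \<open>k\<close>, which
  later makes nested sums exchangeable.\<close>

lemma tensor_common_right_family:
  fixes t :: "'i \<Rightarrow> ('k::field, 'a::ab_group_add, 'b::ab_group_add) tensor"
  assumes K: "finite K" and t: "\<And>k. k \<in> K \<Longrightarrow> t k \<in> carrier (V \<otimes> W)" and V: "vspace V" and W: "vspace W"
  obtains n :: nat and w \<phi> a where "dual_family W {..<n} w \<phi>"
    "\<forall>k\<in>K. \<forall>u\<in>{..<n}. a k u \<in> carrier V" "\<forall>k\<in>K. t k = (\<Sum>u<n. pure V W (a k u) (w u))"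
proof -
  have "\<exists>S. finite S \<and> S \<subseteq> carrier W \<and> expands_over V W (t k) S" if "k \<in> K" for k
    by (rule expands_over_finite[OF t[OF that] V W]) (intro exI conjI)
  then obtain S where S: "\<And>k. k \<in> K \<Longrightarrow> finite (S k) \<and> S k \<subseteq> carrier W"
    and e: "\<And>k. k \<in> K \<Longrightarrow> expands_over V W (t k) (S k)" by metis
  let ?S = "\<Union>k\<in>K. S k"
  have "finite ?S" "?S \<subseteq> carrier W" using S K by auto
  from dual_family_exists[OF W this] obtain n :: nat and w \<phi> where d: "dual_family W {..<n} w \<phi>"
    and ex: "\<forall>v\<in>module.span (smult W) ?S. v = (\<Sum>i<n. smult W (\<phi> i v) (w i))"
    by (elim exE conjE)
  show ?thesis
  proof (rule that[OF d, of "\<lambda>k u. rslice V W (\<phi> u) (t k)"]; intro ballI)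
    show "rslice V W (\<phi> u) (t k) \<in> carrier V" if "k \<in> K" "u \<in> {..<n}" for k u
      by (rule linear_map_in[OF linear_rslice[OF V dual_familyD(3)[OF d that(2)]] t[OF that(1)]])
    show "t k = (\<Sum>u<n. pure V W (rslice V W (\<phi> u) (t k)) (w u))" if k: "k \<in> K" for k
    proof (rule expands_overD[OF e[OF k] d])
      fix s assume "s \<in> S k"
      then have "s \<in> ?S" using k by blast
      then show "s = (\<Sum>k<n. smult W (\<phi> k s) (w k))"
        by (rule bspec[OF ex module.span_base[OF vspace_module[OF W]]])
    qed
  qed
qed

text \<open>
  The left tensor factors of \<open>\<delta> v\<close>, taken against linearly independent right factors \<open>w\<^sub>k\<close>, span a
  subcomodule: apply a functional dual to \<open>w\<^sub>j\<close> to the last factor of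
  \<open>(\<delta> \<otimes> 1) \<delta> v = (1 \<otimes> \<Delta>) \<delta> v\<close>.
\<close>

lemma coaction_left_factors:
  assumes V: "vspace V" and C: "vspace C" and \<delta>: "linear_map V (V \<otimes> C) \<delta>"
    and \<Delta>: "linear_map C (C \<otimes> C) \<Delta>" and \<epsilon>: "linear_map C ground \<epsilon>"
    and w: "dual_family C I w \<phi>" and x: "\<And>k. k \<in> I \<Longrightarrow> x k \<in> carrier V"
    and v: "v \<in> carrier V" and \<delta>v: "\<delta> v = (\<Sum>k\<in>I. pure V C (x k) (w k))"
    and coassoc: "assoc V C C (tmap (V \<otimes> C) C \<delta> id (\<delta> v)) = tmap V (C \<otimes> C) id \<Delta> (\<delta> v)"
    and counit: "tmap V ground id \<epsilon> (\<delta> v) = pure V ground v 1"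
  shows "j \<in> I \<Longrightarrow> \<delta> (x j) = (\<Sum>k\<in>I. pure V C (x k) (rslice C C (\<phi> j) (\<Delta> (w k))))"
    and "v = (\<Sum>k\<in>I. smult V (\<epsilon> (w k)) (x k))"
proof -
  note D = dual_familyD[OF w]
  show "\<delta> (x j) = (\<Sum>k\<in>I. pure V C (x k) (rslice C C (\<phi> j) (\<Delta> (w k))))" if j: "j \<in> I"
  proof -
    define R where "R = tmap V C id (rslice C C (\<phi> j))"
    note linr = linear_rslice[OF C D(3)[OF j]]
    have linR: "linear_map (V \<otimes> (C \<otimes> C)) (V \<otimes> C) R"
      unfolding R_def by (rule linear_tmap[OF V linear_map_id linr])
    have linRa: "linear_map ((V \<otimes> C) \<otimes> C) (V \<otimes> C) (\<lambda>t. R (assoc V C C t))"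
      by (rule linear_map_comp[OF linear_assoc[OF V C] linR])
    \<comment> \<open>After rebracketing, \<open>R\<close> contracts the last factor of (V \<otimes>
      C) \<otimes> C with \<open>\<phi> j\<close>.\<close>
    have R: "R (assoc V C C (pure (V \<otimes> C) C s c)) = fscale (\<phi> j c) s"
      if s: "s \<in> carrier (V \<otimes> C)" and c: "c \<in> carrier C" for s c
    proof (rule tensor_linear_eq[OF linear_map_comp[OF linear_pure_left[OF c] linRa] _ V vspace_tensor _ s])
      show "linear_map (V \<otimes> C) (V \<otimes> C) (fscale (\<phi> j c))"
        using linear_map_smult[OF vspace_tensor linear_map_ident, of V C "\<phi> j c"] by simp
      show "R (assoc V C C (pure (V \<otimes> C) C (pure V C a b) c)) = fscale (\<phi> j c) (pure V C a b)"
        if "a \<in> carrier V" "b \<in> carrier C" for a b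
        using that c
        by (simp add: assoc_pure[OF V C] R_def tmap_pure[OF linear_map_id linr] rslice_pure[OF C D(3)[OF j]]
            pure_scale_right)
    qed
    have "R (assoc V C C (tmap (V \<otimes> C) C \<delta> id (\<delta> v))) =
        R (assoc V C C (\<Sum>k\<in>I. pure (V \<otimes> C) C (\<delta> (x k)) (w k)))"
      using tmap_sum_pure[OF V \<delta> linear_map_id[of C], of I x w] x D(2) by (simp add: \<delta>v)
    also have "\<dots> = (\<Sum>k\<in>I. R (assoc V C C (pure (V \<otimes> C) C (\<delta> (x k)) (w k))))"
      by (rule linear_map_sum[OF linRa vspace_tensor vspace_tensor])
        (intro pure_in linear_map_in[OF \<delta>] x D(2))
    also have "\<dots> = (\<Sum>k\<in>I. if j = k then \<delta> (x k) else 0)"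
      by (intro sum.cong refl) (simp add: R linear_map_in[OF \<delta>] x D(2,4) j)
    also have "\<dots> = \<delta> (x j)" using j D(1) by simp
    finally have "\<delta> (x j) = R (tmap V (C \<otimes> C) id \<Delta> (\<delta> v))" by (simp add: coassoc)
    also have "\<dots> = R (\<Sum>k\<in>I. pure V (C \<otimes> C) (x k) (\<Delta> (w k)))"
      using tmap_sum_pure[OF V linear_map_id[of V] \<Delta>, of I x w] x D(2) by (simp add: \<delta>v)
    also have "\<dots> = (\<Sum>k\<in>I. pure V C (x k) (rslice C C (\<phi> j) (\<Delta> (w k))))"
      unfolding R_def using tmap_sum_pure[OF V linear_map_id[of V] linr, of I x "\<lambda>k. \<Delta> (w k)"]
      by (simp add: x linear_map_in[OF \<Delta>] D(2))
    finally show ?thesis .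
  qed
  \<comment> \<open>The counit law exhibits \<open>v\<close> itself in the span of its left
    factors.\<close>
  have "v = rslice V ground id (tmap V ground id \<epsilon> (\<delta> v))"
    by (simp add: counit rslice_pure[OF V linear_map_id] v vspace_smult_simps[OF V])
  also have "\<dots> = rslice V ground id (\<Sum>k\<in>I. pure V ground (x k) (\<epsilon> (w k)))"
    using tmap_sum_pure[OF V linear_map_id[of V] \<epsilon>, of I x w] x D(2) by (simp add: \<delta>v)
  also have "\<dots> = (\<Sum>k\<in>I. rslice V ground id (pure V ground (x k) (\<epsilon> (w k))))"
    by (rule linear_map_sum[OF linear_rslice[OF V linear_map_id] vspace_tensor V])
      (intro pure_in linear_map_in[OF \<epsilon>] x D(2))
  also have "\<dots> = (\<Sum>k\<in>I. smult V (\<epsilon> (w k)) (x k))"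
    by (intro sum.cong refl) (simp add: rslice_pure[OF V linear_map_id] x)
  finally show "v = (\<Sum>k\<in>I. smult V (\<epsilon> (w k)) (x k))" .
qed

text \<open>If the left factors of \<open>t\<close> lie in the span of \<open>e\<close>, contraction
  with the \<open>f i\<close> yields coefficients of \<open>t\<close> along \<open>e\<close>. This
  passes from a spanning set to a basis.\<close>

lemma dual_family_tensor_expand:
  assumes V: "vspace V" and C: "vspace C" and d: "dual_family V I e f"
    and s: "\<And>p. p \<in> P \<Longrightarrow> s p \<in> carrier V" and g: "\<And>p. p \<in> P \<Longrightarrow> g p \<in> carrier C"
    and ex: "\<And>p. p \<in> P \<Longrightarrow> s p = (\<Sum>i\<in>I. smult V (f i (s p)) (e i))"
    and t: "t = (\<Sum>p\<in>P. pure V C (s p) (g p))"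
  shows "t = (\<Sum>i\<in>I. pure V C (e i) (lslice V C (f i) t))"
proof -
  note D = dual_familyD[OF d]
  define Q where "Q t = (\<Sum>i\<in>I. pure V C (e i) (lslice V C (f i) t))" for t
  have linQ: "linear_map (V \<otimes> C) (V \<otimes> C) Q"
    unfolding Q_def
    by (rule linear_map_sum_fun[OF vspace_tensor])
      (rule linear_map_comp[OF linear_lslice[OF C D(3)] linear_pure_right[OF D(2)]])
  have "Q t = (\<Sum>p\<in>P. Q (pure V C (s p) (g p)))"
    unfolding t by (rule linear_map_sum[OF linQ vspace_tensor vspace_tensor]) (intro pure_in s g)
  also have "\<dots> = t"
    unfolding t
  proof (rule sum.cong[OF refl])
    fix p assume p: "p \<in> P"
    have "Q (pure V C (s p) (g p)) = (\<Sum>i\<in>I. pure V C (smult V (f i (s p)) (e i)) (g p))"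
      unfolding Q_def
      by (intro sum.cong refl)
        (simp add: lslice_pure[OF C D(3)] s g p pure_scale_left pure_scale_right D(2))
    also have "\<dots> = pure V C (\<Sum>i\<in>I. smult V (f i (s p)) (e i)) (g p)"
      by (intro pure_sum_left[OF V, symmetric] vspace_scale[OF V] D(2) g p)
    also have "\<dots> = pure V C (s p) (g p)" by (simp only: ex[OF p, symmetric])
    finally show "Q (pure V C (s p) (g p)) = pure V C (s p) (g p)" .
  qed
  finally show ?thesis by (simp add: Q_def)
qed

section \<open>Finite dimensional subcomodules that are right coideals\<close>

context hopf_alg
begin

lemma comodule_coalgebraD:
  assumes "comodule_coalgebra H X"
  shows "comodule H X" and "vspace X" and "linear_map X (X \<otimes> H) (coact X)"
    and "linear_map X (X \<otimes> X) (ccomult X)" and "linear_map X ground (ccounit X)"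
    and "x \<in> carrier X \<Longrightarrow> assoc X X X (tmap (X \<otimes> X) X (ccomult X) id (ccomult X x)) =
      tmap X (X \<otimes> X) id (ccomult X) (ccomult X x)"
    and "x \<in> carrier X \<Longrightarrow> tmap ground X (ccounit X) id (ccomult X x) = pure ground X 1 x"
    and "x \<in> carrier X \<Longrightarrow> tmap X ground id (ccounit X) (ccomult X x) = pure X ground x 1"
    and "comodule_map H X (tensor_comod H X X) (ccomult X)"
  using assms by (simp_all add: comodule_coalgebra_def comodule_def coalgebra_def)

text \<open>
  The left factors of \<open>\<Delta> x\<close> span a right coideal \<open>L\<close>, and the left factors of the coactions of
  elements of \<open>L\<close> span a subcomodule \<open>U\<close>, which is again a right coideal because \<open>\<Delta>\<close> is colinear.
\<close>

lemma comodule_coalgebra_locally_finite: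
  fixes X :: "('k, 'x::ab_group_add, 'h) comod_coalg"
  assumes X: "comodule_coalgebra H X" and x: "x \<in> carrier X"
  obtains n :: nat and e f c d where "dual_family X {..<n} e f"
    "x = (\<Sum>i<n. smult X (f i x) (e i))"
    "\<forall>i\<in>{..<n}. \<forall>j\<in>{..<n}. c i j \<in> carrier H \<and> d i j \<in> carrier X"
    "\<forall>j\<in>{..<n}. coact X (e j) = (\<Sum>i<n. pure X H (e i) (c i j))"
    "\<forall>j\<in>{..<n}. ccomult X (e j) = (\<Sum>i<n. pure X X (e i) (d i j))"
proof -
  note CX = comodule_coalgebraD[OF X]
  note V = CX(2) and linC = CX(3) and linD = CX(4)
  let ?\<delta> = "ccomult X" and ?\<rho> = "coact X"
  have coH: "assoc X H H (tmap (X \<otimes> H) H ?\<rho> id (?\<rho> v)) = tmap X (H \<otimes> H) id \<Delta> (?\<rho> v)"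
    "tmap X ground id \<epsilon> (?\<rho> v) = pure X ground v 1" if "v \<in> carrier X" for v
    using CX(1) that by (simp_all add: comodule_def)
  obtain n :: nat and w \<phi> a0 where w: "dual_family X {..<n} w \<phi>"
    and a0: "\<forall>k\<in>{()}. \<forall>u\<in>{..<n}. a0 k u \<in> carrier X"
      "\<forall>k\<in>{()}. ?\<delta> x = (\<Sum>u<n. pure X X (a0 k u) (w u))"
    by (rule tensor_common_right_family[of "{()}" "\<lambda>_. ?\<delta> x", OF _ linear_map_in[OF linD x] V V]) simp
  note W = dual_familyD[OF w]
  define l where "l = a0 ()"
  have l_in: "l k \<in> carrier X" if "k \<in> {..<n}" for k using a0(1) that by (simp add: l_def)
  have \<delta>x: "?\<delta> x = (\<Sum>k<n. pure X X (l k) (w k))" using a0(2) by (simp add: l_def)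
  define d0 where "d0 k j = rslice X X (\<phi> j) (?\<delta> (w k))" for k j
  have d0_in: "d0 k j \<in> carrier X" if "k \<in> {..<n}" "j \<in> {..<n}" for k j
    unfolding d0_def
    by (rule linear_map_in[OF linear_rslice[OF V W(3)[OF that(2)]] linear_map_in[OF linD W(2)[OF that(1)]]])
  have \<delta>l: "?\<delta> (l j) = (\<Sum>k<n. pure X X (l k) (d0 k j))" if "j \<in> {..<n}" for j
    unfolding d0_def using V V linD linD CX(5) w l_in x \<delta>x CX(6)[OF x] CX(8)[OF x] that
    by (rule coaction_left_factors(1))
  have xl: "x = (\<Sum>k<n. smult X (ccounit X (w k)) (l k))"
    using V V linD linD CX(5) w l_in x \<delta>x CX(6)[OF x] CX(8)[OF x]
    by (rule coaction_left_factors(2))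
  have \<rho>l_in: "?\<rho> (l k) \<in> carrier (X \<otimes> H)" if "k \<in> {..<n}" for k
    by (rule linear_map_in[OF linC l_in[OF that]])
  \<comment> \<open>One family \<open>h\<close> serves all \<open>l k\<close>, so there are finitely
    many left factors \<open>z (k, i)\<close>; by coassociativity the coaction of
    \<open>z (k, j)\<close> again has its left factors among the \<open>z (k, i)\<close>.\<close>
  obtain m :: nat and h \<psi> z0 where h: "dual_family H {..<m} h \<psi>"
    and z0: "\<forall>k\<in>{..<n}. \<forall>i\<in>{..<m}. z0 k i \<in> carrier X"
      "\<forall>k\<in>{..<n}. ?\<rho> (l k) = (\<Sum>i<m. pure X H (z0 k i) (h i))"
    by (rule tensor_common_right_family[OF finite_lessThan \<rho>l_in V vspace_H])
  note Hd = dual_familyD[OF h]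
  define z where "z p = z0 (fst p) (snd p)" for p
  let ?P = "{..<n} \<times> {..<m}"
  have z_in: "z p \<in> carrier X" if "p \<in> ?P" for p
    using z0(1) that by (auto simp: z_def)
  have zk_in: "z (k, i) \<in> carrier X" if "k \<in> {..<n}" "i \<in> {..<m}" for k i using z_in that by simp
  have \<rho>l: "?\<rho> (l k) = (\<Sum>i<m. pure X H (z (k, i)) (h i))" if "k \<in> {..<n}" for k
    using z0(2) that by (simp add: z_def)
  have \<rho>z: "?\<rho> (z (k, j)) = (\<Sum>i<m. pure X H (z (k, i)) (rslice H H (\<psi> j) (\<Delta> (h i))))"
    if k: "k \<in> {..<n}" and j: "j \<in> {..<m}" for k j
    using V vspace_H linC linear_comult linear_counit h zk_in[OF k] l_in[OF k] \<rho>l[OF k]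
      coH[OF l_in[OF k]] j
    by (rule coaction_left_factors(1))
  have lz: "l k = (\<Sum>i<m. smult X (\<epsilon> (h i)) (z (k, i)))" if k: "k \<in> {..<n}" for k
    using V vspace_H linC linear_comult linear_counit h zk_in[OF k] l_in[OF k] \<rho>l[OF k]
      coH[OF l_in[OF k]]
    by (rule coaction_left_factors(2))
  \<comment> \<open>Colinearity of \<Delta> at \<open>l k\<close> is contracted in \<open>H\<close>
    with \<open>\<psi> j\<close>. One side isolates \<Delta> of \<open>z (k, j)\<close>. On the
    other side the left factors in \<open>X\<close> come from the coactions of the
    \<open>l i\<close>, hence are among the \<open>z\<close>.\<close>
  have \<delta>z: "\<exists>g. (\<forall>p\<in>?P. g p \<in> carrier X) \<and> ?\<delta> (z q) = (\<Sum>p\<in>?P. pure X X (z p) (g p))"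
    if q: "q \<in> ?P" for q
  proof -
    obtain k j where kj: "q = (k, j)" "k \<in> {..<n}" "j \<in> {..<m}" using q by auto
    let ?S = "rslice (X \<otimes> X) H (\<psi> j)"
    have \<psi>j: "linear_map H ground (\<psi> j)" by (rule Hd(3)[OF kj(3)])
    note linS = linear_rslice[OF vspace_tensor[of X X] \<psi>j]
    have \<rho>d_in: "?\<rho> (d0 i k) \<in> carrier (X \<otimes> H)" if "i \<in> {..<n}" for i
      by (rule linear_map_in[OF linC d0_in[OF that kj(2)]])
    obtain r :: nat and b \<beta> a where b: "dual_family H {..<r} b \<beta>"
      and a: "\<forall>i\<in>{..<n}. \<forall>u\<in>{..<r}. a i u \<in> carrier X"
        "\<forall>i\<in>{..<n}. ?\<rho> (d0 i k) = (\<Sum>u<r. pure X H (a i u) (b u))"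
      by (rule tensor_common_right_family[OF finite_lessThan \<rho>d_in V vspace_H])
    note Bd = dual_familyD[OF b]
    have a_in: "a i u \<in> carrier X" if "i \<in> {..<n}" "u \<in> {..<r}" for i u using a(1) that by blast
    let ?co = "coact (tensor_comod H X X)"
    have "?co (?\<delta> (l k)) = (\<Sum>i<m. pure (tensor_comod H X X) H (?\<delta> (z (k, i))) (h i))"
      by (rule comodule_map_sum[OF CX(9) V l_in[OF kj(2)] zk_in[OF kj(2)] Hd(2) \<rho>l[OF kj(2)]])
    then have "?S (?co (?\<delta> (l k))) = ?S (\<Sum>i<m. pure (X \<otimes> X) H (?\<delta> (z (k, i))) (h i))"
      by (simp only: pure_tensor_comod)
    also have "\<dots> = (\<Sum>i<m. ?S (pure (X \<otimes> X) H (?\<delta> (z (k, i))) (h i)))"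
      by (rule linear_map_sum[OF linS vspace_tensor vspace_tensor])
        (intro pure_in linear_map_in[OF linD] zk_in kj Hd(2))
    also have "\<dots> = (\<Sum>i<m. if j = i then ?\<delta> (z (k, i)) else 0)"
      by (intro sum.cong refl) (simp del: lessThan_iff
          add: rslice_pure[OF vspace_tensor \<psi>j] linear_map_in[OF linD] zk_in kj Hd(2,4))
    also have "\<dots> = ?\<delta> (z q)" using kj by simp
    finally have "?\<delta> (z q) = ?S (?co (\<Sum>i<n. pure X X (l i) (d0 i k)))"
      by (simp only: \<delta>l kj)
    also have "?co (\<Sum>i<n. pure X X (l i) (d0 i k)) = (\<Sum>i<n. ?co (pure X X (l i) (d0 i k)))"
      by (rule linear_map_sum[OF linear_tensor_coact[OF V V linC linC] vspace_tensor vspace_tensor])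
        (intro pure_in l_in d0_in kj)
    also have "\<dots> = (\<Sum>p\<in>?P. \<Sum>u<r. pure (X \<otimes> X) H (pure X X (z p) (a (fst p) u)) (h (snd p) \<odot> b u))"
      unfolding sum.cartesian_product' fst_conv snd_conv
    proof (rule sum.cong[OF refl])
      fix i assume i: "i \<in> {..<n}"
      show "?co (pure X X (l i) (d0 i k)) =
          (\<Sum>v<m. \<Sum>u<r. pure (X \<otimes> X) H (pure X X (z (i, v)) (a i u)) (h v \<odot> b u))"
        by (rule tensor_coact_sum[OF V V linC linC zk_in[OF i] Hd(2) a_in[OF i] Bd(2) \<rho>l[OF i]
              bspec[OF a(2) i]])
    qed
    also have "?S \<dots> = (\<Sum>p\<in>?P. \<Sum>u<r. ?S (pure (X \<otimes> X) H (pure X X (z p) (a (fst p) u)) (h (snd p) \<odot> b u)))"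
      by (rule linear_map_sum2[OF linS vspace_tensor vspace_tensor])
        (auto intro!: pure_in z_in a_in mul_in Hd(2) Bd(2))
    also have "\<dots> = (\<Sum>p\<in>?P. \<Sum>u<r. pure X X (z p) (smult X (\<psi> j (h (snd p) \<odot> b u)) (a (fst p) u)))"
      by (intro sum.cong refl)
        (auto simp: rslice_pure[OF vspace_tensor \<psi>j] pure_in z_in a_in mul_in Hd(2) Bd(2) pure_scale_right)
    also have "\<dots> = (\<Sum>p\<in>?P. pure X X (z p) (\<Sum>u<r. smult X (\<psi> j (h (snd p) \<odot> b u)) (a (fst p) u)))"
      by (intro sum.cong refl pure_sum_right[OF V, symmetric] vspace_scale[OF V] z_in)
        (auto intro!: a_in)
    finally have "?\<delta> (z q) = (\<Sum>p\<in>?P. pure X X (z p) (\<Sum>u<r. smult X (\<psi> j (h (snd p) \<odot> b u)) (a (fst p) u)))" .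
    then show ?thesis
      by (intro exI[of _ "\<lambda>p. \<Sum>u<r. smult X (\<psi> j (h (snd p) \<odot> b u)) (a (fst p) u)"])
        (auto intro!: vspace_sum[OF V] vspace_scale[OF V] a_in)
  qed
  \<comment> \<open>The relation for row \<open>k\<close> is padded with zero coefficients to a sum
    over all pairs.\<close>
  have \<rho>z: "\<exists>g. (\<forall>p\<in>?P. g p \<in> carrier H) \<and> ?\<rho> (z q) = (\<Sum>p\<in>?P. pure X H (z p) (g p))"
    if q: "q \<in> ?P" for q
  proof -
    obtain k j where kj: "q = (k, j)" "k \<in> {..<n}" "j \<in> {..<m}" using q by auto
    define g where "g p = (if fst p = k then rslice H H (\<psi> j) (\<Delta> (h (snd p))) else 0)" for p
    have g: "g p \<in> carrier H" if "p \<in> ?P" for p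
      using that kj by (auto simp: g_def vspace_zero[OF vspace_H] intro!:
          linear_map_in[OF linear_rslice[OF vspace_H Hd(3)]] linear_map_in[OF linear_comult] Hd(2))
    have "(\<Sum>p\<in>?P. pure X H (z p) (g p)) =
        (\<Sum>i<n. if i = k then \<Sum>v<m. pure X H (z (i, v)) (rslice H H (\<psi> j) (\<Delta> (h v))) else 0)"
      unfolding sum.cartesian_product'
      by (intro sum.cong refl) (simp add: g_def pure_zero_right[OF vspace_H] zk_in)
    also have "\<dots> = ?\<rho> (z q)" using \<rho>z kj by simp
    finally show ?thesis using g by (intro exI[of _ g]) simp
  qed
  have fin: "finite (z ` ?P)" and sub: "z ` ?P \<subseteq> carrier X" using z_in by auto
  \<comment> \<open>The basis is selected among the \<open>z\<close> themselves, so both closure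
    properties hold for each \<open>e j\<close>.\<close>
  obtain N :: nat and e f where d: "dual_family X {..<N} e f" and eS: "e ` {..<N} \<subseteq> z ` ?P"
    and ex: "\<forall>v\<in>module.span (smult X) (z ` ?P). v = (\<Sum>i<N. smult X (f i v) (e i))"
    using dual_family_exists[OF V fin sub] by (elim exE conjE)
  note D = dual_familyD[OF d]
  note M = vspace_module[OF V]
  have zex: "z p = (\<Sum>i<N. smult X (f i (z p)) (e i))" if "p \<in> ?P" for p
    using ex module.span_base[OF M, of "z p" "z ` ?P"] that by blast
  \<comment> \<open>The two counit relations are chained: \<open>x\<close> lies in the span of the
    \<open>l k\<close>, and these lie in the span of the \<open>z\<close>.\<close>
  have "l k \<in> module.span (smult X) (z ` ?P)" if "k \<in> {..<n}" for k
    unfolding lz[OF that]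
    using that by (intro module.span_sum[OF M] module.span_scale[OF M] module.span_base[OF M]) auto
  then have "x \<in> module.span (smult X) (z ` ?P)"
    by (subst xl) (intro module.span_sum[OF M] module.span_scale[OF M]; simp)
  then have xe: "x = (\<Sum>i<N. smult X (f i x) (e i))" using ex by blast
  have expand: "t = (\<Sum>i<N. pure X C (e i) (lslice X C (f i) t))"
    if "vspace C" "\<forall>p\<in>?P. g p \<in> carrier C" "t = (\<Sum>p\<in>?P. pure X C (z p) (g p))"
    for C :: "('k, 'c::ab_group_add, 'z) vspace_scheme" and g t
    by (rule dual_family_tensor_expand[OF V that(1) d z_in _ zex that(3)]) (use that(2) in auto)
  let ?c = "\<lambda>i j. lslice X H (f i) (?\<rho> (e j))" and ?d = "\<lambda>i j. lslice X X (f i) (?\<delta> (e j))"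
  have in_car: "?c i j \<in> carrier H \<and> ?d i j \<in> carrier X" if "i \<in> {..<N}" "j \<in> {..<N}" for i j
  proof
    show "?c i j \<in> carrier H"
      by (rule linear_map_in[OF linear_lslice[OF vspace_H D(3)[OF that(1)]] linear_map_in[OF linC D(2)[OF that(2)]]])
    show "?d i j \<in> carrier X"
      by (rule linear_map_in[OF linear_lslice[OF V D(3)[OF that(1)]] linear_map_in[OF linD D(2)[OF that(2)]]])
  qed
  have ce: "?\<rho> (e j) = (\<Sum>i<N. pure X H (e i) (?c i j))"
    and de: "?\<delta> (e j) = (\<Sum>i<N. pure X X (e i) (?d i j))" if j: "j \<in> {..<N}" for j
  proof -
    obtain q where q: "e j = z q" "q \<in> ?P"
      by (rule imageE[OF subsetD[OF eS imageI[OF j]]])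
    obtain g where g: "\<forall>p\<in>?P. g p \<in> carrier H" "?\<rho> (e j) = (\<Sum>p\<in>?P. pure X H (z p) (g p))"
      using \<rho>z[OF q(2)] unfolding q(1) by (elim exE conjE)
    show "?\<rho> (e j) = (\<Sum>i<N. pure X H (e i) (?c i j))"
      by (rule expand[OF vspace_H g])
    obtain g where g: "\<forall>p\<in>?P. g p \<in> carrier X" "?\<delta> (e j) = (\<Sum>p\<in>?P. pure X X (z p) (g p))"
      using \<delta>z[OF q(2)] unfolding q(1) by (elim exE conjE)
    show "?\<delta> (e j) = (\<Sum>i<N. pure X X (e i) (?d i j))"
      by (rule expand[OF V g])
  qed
  show ?thesis
  proof (rule that[OF d xe, of ?c ?d])
    show "\<forall>i\<in>{..<N}. \<forall>j\<in>{..<N}. ?c i j \<in> carrier H \<and> ?d i j \<in> carrier X"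
      by (intro ballI in_car)
    show "\<forall>j\<in>{..<N}. ?\<rho> (e j) = (\<Sum>i<N. pure X H (e i) (?c i j))"
      by (rule ballI) (rule ce)
    show "\<forall>j\<in>{..<N}. ?\<delta> (e j) = (\<Sum>i<N. pure X X (e i) (?d i j))"
      by (rule ballI) (rule de)
  qed
qed

end

section \<open>Coefficient morphisms from V^* \<otimes> V whose image contains a given
  element\<close>

context hopf_alg
begin

text \<open>The coefficients \<open>d i j\<close> of \<Delta> on a right coideal obey the
  comultiplication and counit rules of the basis of V^* \<otimes> V, and colinearity of \<Delta>
  determines their coaction. Having \<open>x\<close> in the image is what separation uses: maps that
  differ at \<open>x\<close> still differ after composition with \<open>h\<close>.\<close>

lemma coend_coalg_generates:
  fixes X :: "('k, 'x::ab_group_add, 'h) comod_coalg"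
  assumes X: "comodule_coalgebra H X" and x: "x \<in> carrier X"
  obtains V :: "('k, nat \<Rightarrow> 'k, 'h) comod" and h where "comodule H V" "fin_dim V"
    "comodule_coalgebra_map H (coend_coalg H V) X h" "x \<in> h ` carrier (coend_coalg H V)"
proof -
  note CX = comodule_coalgebraD[OF X]
  note VX = CX(2) and linC = CX(3) and linD = CX(4)
  let ?\<delta> = "ccomult X" and ?\<rho> = "coact X"
  obtain n :: nat and y f c d where fam: "dual_family X {..<n} y f"
    and xy: "x = (\<Sum>i<n. smult X (f i x) (y i))"
    and cd_in: "\<forall>i\<in>{..<n}. \<forall>j\<in>{..<n}. c i j \<in> carrier H \<and> d i j \<in> carrier X"
    and \<rho>y': "\<forall>j\<in>{..<n}. ?\<rho> (y j) = (\<Sum>i<n. pure X H (y i) (c i j))"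
    and \<delta>y': "\<forall>j\<in>{..<n}. ?\<delta> (y j) = (\<Sum>i<n. pure X X (y i) (d i j))"
    by (rule comodule_coalgebra_locally_finite[OF X x])
  let ?I = "{..<n}"
  have c_in: "c i j \<in> carrier H" and d_in: "d i j \<in> carrier X" if "i \<in> ?I" "j \<in> ?I" for i j
    using that cd_in by blast+
  have \<rho>y: "?\<rho> (y j) = (\<Sum>i<n. pure X H (y i) (c i j))"
    and \<delta>y: "?\<delta> (y j) = (\<Sum>i<n. pure X X (y i) (d i j))" if "j \<in> ?I" for j
    using that \<rho>y' \<delta>y' by blast+
  note D = dual_familyD[OF fam]
  have c: "comatrix ?I c"
    using CX(1) fam c_in \<rho>y by (rule comatrix_of_coaction)
  \<comment> \<open>On the span of the \<open>y j\<close> the comultiplication is a right coaction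
    of \<open>X\<close>, and \<open>d\<close> is its matrix.\<close>
  have \<delta>d: "?\<delta> (d i j) = (\<Sum>k<n. pure X X (d i k) (d k j))"
    and \<epsilon>d: "ccounit X (d i j) = (if i = j then 1 else 0)" if "i \<in> ?I" "j \<in> ?I" for i j
    by (rule coefficient_matrix[OF VX VX linD linD CX(5) fam d_in \<delta>y CX(6)[OF D(2)] CX(8)[OF D(2)]];
        use that in simp)+
  \<comment> \<open>The left counit law places every \<open>y j\<close> in the span of the
    coefficients \<open>d i j\<close>.\<close>
  have y\<epsilon>: "y j = (\<Sum>i<n. smult X (ccounit X (y i)) (d i j))" if j: "j \<in> ?I" for j
  proof -
    note linid = linear_map_id[of "ground :: ('k, 'k) vspace"]
    have "y j = lslice ground X id (pure ground X 1 (y j))"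
      by (simp add: lslice_pure[OF VX linid] D(2)[OF j] vspace_smult_simps[OF VX])
    also have "pure ground X 1 (y j) = (\<Sum>i<n. pure ground X (ccounit X (y i)) (d i j))"
      using CX(7)[OF D(2)[OF j]] tmap_sum_pure[OF VX CX(5) linear_map_id[of X], of ?I y "\<lambda>i. d i j"]
      by (simp add: \<delta>y[OF j] D(2) d_in[OF _ j])
    also have "lslice ground X id \<dots> = (\<Sum>i<n. lslice ground X id (pure ground X (ccounit X (y i)) (d i j)))"
      by (rule linear_map_sum[OF linear_lslice[OF VX linid] vspace_tensor VX])
        (intro pure_in linear_map_in[OF CX(5)] D(2) d_in j)
    also have "\<dots> = (\<Sum>i<n. smult X (ccounit X (y i)) (d i j))"
      by (intro sum.cong refl) (simp add: lslice_pure[OF VX linid _ d_in[OF _ j]])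
    finally show ?thesis .
  qed
  \<comment> \<open>Colinearity of \<open>\<Delta>\<close> on \<open>y\<^sub>j\<close> reads \<open>\<Sum>\<^sub>i c\<^sub>p\<^sub>i \<cdot> \<rho>(d\<^sub>i\<^sub>j) = \<Sum>\<^sub>q d\<^sub>p\<^sub>q \<otimes> c\<^sub>q\<^sub>j\<close>; the matrix \<open>S(c)\<close> inverts \<open>c\<close>.\<close>
  let ?co = "coact (tensor_comod H X X)"
  have \<rho>d: "?\<rho> (d k j) = (\<Sum>p<n. \<Sum>q<n. pure X H (d p q) (S (c k p) \<odot> c q j))"
    if k: "k \<in> ?I" and j: "j \<in> ?I" for k j
  proof -
    have \<rho>d_in: "?\<rho> (d i j) \<in> carrier (X \<otimes> H)" if "i \<in> ?I" for i
      by (rule linear_map_in[OF linC d_in[OF that j]])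
    obtain m :: nat and b \<beta> a where b: "dual_family H {..<m} b \<beta>"
      and a: "\<forall>i\<in>?I. \<forall>u\<in>{..<m}. a i u \<in> carrier X"
        "\<forall>i\<in>?I. ?\<rho> (d i j) = (\<Sum>u<m. pure X H (a i u) (b u))"
      by (rule tensor_common_right_family[OF finite_lessThan \<rho>d_in VX vspace_H])
    note Bd = dual_familyD[OF b] and \<rho>a = bspec[OF a(2)]
    have a_in: "a i u \<in> carrier X" if "i \<in> ?I" "u \<in> {..<m}" for i u using a(1) that by blast
    have eq: "(\<Sum>i<n. \<Sum>u<m. pure X H (a i u) (c p i \<odot> b u)) = (\<Sum>q<n. pure X H (d p q) (c q j))"
      if p: "p \<in> ?I" for p
    proof -
      \<comment> \<open>Contraction of the first factor of X \<otimes> X with \<open>f p\<close>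
        selects one row of the colinearity relation.\<close>
      let ?G = "tmap X H (lslice X X (f p)) id"
      note linf = linear_lslice[OF VX D(3)[OF p]]
      have linG: "linear_map ((X \<otimes> X) \<otimes> H) (X \<otimes> H) ?G"
        by (rule linear_tmap[OF vspace_tensor linf linear_map_id])
      have G: "?G (pure (X \<otimes> X) H s h) = pure X H (lslice X X (f p) s) h" for s h
        by (simp add: tmap_pure[OF linf linear_map_id])
      have "?co (?\<delta> (y j)) = (\<Sum>i<n. ?co (pure X X (y i) (d i j)))"
        unfolding \<delta>y[OF j]
        by (rule linear_map_sum[OF linear_tensor_coact[OF VX VX linC linC] vspace_tensor vspace_tensor])
          (intro pure_in D(2) d_in j)
      also have "\<dots> = (\<Sum>i<n. \<Sum>v<n. \<Sum>u<m. pure (X \<otimes> X) H (pure X X (y v) (a i u)) (c v i \<odot> b u))"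
      proof (rule sum.cong[OF refl])
        fix i assume i: "i \<in> ?I"
        show "?co (pure X X (y i) (d i j)) =
            (\<Sum>v<n. \<Sum>u<m. pure (X \<otimes> X) H (pure X X (y v) (a i u)) (c v i \<odot> b u))"
          by (rule tensor_coact_sum[OF VX VX linC linC _ _ _ _ \<rho>y[OF i] \<rho>a[OF i]])
            (fact D(2) c_in[OF _ i] a_in[OF i] Bd(2))+
      qed
      finally have "?G (?co (?\<delta> (y j))) =
          ?G (\<Sum>i<n. \<Sum>v<n. \<Sum>u<m. pure (X \<otimes> X) H (pure X X (y v) (a i u)) (c v i \<odot> b u))"
        by (rule arg_cong)
      also have "\<dots> = (\<Sum>i<n. ?G (\<Sum>v<n. \<Sum>u<m. pure (X \<otimes> X) H (pure X X (y v) (a i u)) (c v i \<odot> b u)))"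
        by (rule linear_map_sum[OF linG vspace_tensor vspace_tensor])
          (intro vspace_sum[OF vspace_tensor] pure_in D(2) a_in mul_in c_in Bd(2))
      also have "\<dots> = (\<Sum>i<n. \<Sum>u<m. pure X H (a i u) (c p i \<odot> b u))"
      proof (rule sum.cong[OF refl])
        fix i assume i: "i \<in> ?I"
        have "?G (\<Sum>v<n. \<Sum>u<m. pure (X \<otimes> X) H (pure X X (y v) (a i u)) (c v i \<odot> b u)) =
            (\<Sum>v<n. \<Sum>u<m. ?G (pure (X \<otimes> X) H (pure X X (y v) (a i u)) (c v i \<odot> b u)))"
          by (intro linear_map_sum2[OF linG vspace_tensor vspace_tensor] pure_in D(2) a_in mul_in
              c_in Bd(2) i)
        also have "\<dots> = (\<Sum>v<n. if p = v then \<Sum>u<m. pure X H (a i u) (c v i \<odot> b u) else 0)"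
          by (intro sum.cong refl)
            (simp del: lessThan_iff add: G lslice_pure[OF VX D(3)[OF p]] D(2,4) p a_in i vspace_smult_simps[OF VX]
              pure_zero_left[OF VX] mul_in c_in Bd(2))
        also have "\<dots> = (\<Sum>u<m. pure X H (a i u) (c p i \<odot> b u))"
          using p by simp
        finally show "?G (\<Sum>v<n. \<Sum>u<m. pure (X \<otimes> X) H (pure X X (y v) (a i u)) (c v i \<odot> b u)) =
            (\<Sum>u<m. pure X H (a i u) (c p i \<odot> b u))" .
      qed
      finally have l: "?G (?co (?\<delta> (y j))) = (\<Sum>i<n. \<Sum>u<m. pure X H (a i u) (c p i \<odot> b u))" .
      have "?co (?\<delta> (y j)) = (\<Sum>q<n. pure (tensor_comod H X X) H (?\<delta> (y q)) (c q j))"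
        by (rule comodule_map_sum[OF CX(9) VX D(2)[OF j] D(2) c_in[OF _ j] \<rho>y[OF j]])
      then have "?G (?co (?\<delta> (y j))) = ?G (\<Sum>q<n. pure (X \<otimes> X) H (?\<delta> (y q)) (c q j))"
        by (simp only: pure_tensor_comod)
      also have "\<dots> = (\<Sum>q<n. ?G (pure (X \<otimes> X) H (?\<delta> (y q)) (c q j)))"
        by (rule linear_map_sum[OF linG vspace_tensor vspace_tensor])
          (intro pure_in linear_map_in[OF linD] D(2) c_in j)
      also have "\<dots> = (\<Sum>q<n. pure X H (d p q) (c q j))"
      proof (rule sum.cong[OF refl])
        fix q assume q: "q \<in> ?I"
        have "lslice X X (f p) (?\<delta> (y q)) = d p q"
          unfolding \<delta>y[OF q] by (rule dual_family_lslice[OF fam VX d_in[OF _ q] p])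
        then show "?G (pure (X \<otimes> X) H (?\<delta> (y q)) (c q j)) = pure X H (d p q) (c q j)"
          by (simp only: G)
      qed
      finally show ?thesis using l by (simp only:)
    qed
    have linN: "linear_map (X \<otimes> H) (X \<otimes> H) (tmap X H id (\<lambda>h. S (c k p) \<odot> h))" if "p \<in> ?I" for p
      by (rule linear_tmap[OF VX linear_map_id linear_mul_right[OF antipode_in[OF c_in[OF k that]]]])
    have N: "tmap X H id (\<lambda>h. S (c k p) \<odot> h) (pure X H z h) = pure X H z (S (c k p) \<odot> h)"
      if "p \<in> ?I" for p z h
      by (simp add: tmap_pure[OF linear_map_id linear_mul_right[OF antipode_in[OF c_in[OF k that]]]])
    \<comment> \<open>Row \<open>k\<close> is isolated by inserting the sum over p of
      \<open>S (c k p) \<odot> c p i\<close>, the delta of k and i; once the sum over p is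
      outermost, the relation \<open>eq\<close> applies to each row p.\<close>
    have "?\<rho> (d k j) = (\<Sum>i<n. if k = i then \<Sum>u<m. pure X H (a i u) (b u) else 0)"
      using k by (simp add: \<rho>a)
    also have "\<dots> = (\<Sum>i<n. \<Sum>u<m. pure X H (a i u) ((\<Sum>p<n. S (c k p) \<odot> c p i) \<odot> b u))"
      by (intro sum.cong refl)
        (simp add: comatrix_antipode[OF c k] mul_one mul_zero Bd(2) pure_zero_right[OF vspace_H] a_in)
    also have "\<dots> = (\<Sum>i<n. \<Sum>u<m. \<Sum>p<n. pure X H (a i u) (S (c k p) \<odot> (c p i \<odot> b u)))"
    proof (intro sum.cong refl)
      fix i u assume i: "i \<in> ?I" and u: "u \<in> {..<m}"
      have "(\<Sum>p<n. S (c k p) \<odot> c p i) \<odot> b u = (\<Sum>p<n. S (c k p) \<odot> c p i \<odot> b u)"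
        by (intro mul_sum_left mul_in antipode_in c_in k i Bd(2)[OF u])
      also have "\<dots> = (\<Sum>p<n. S (c k p) \<odot> (c p i \<odot> b u))"
        by (intro sum.cong refl mul_assoc antipode_in c_in k i Bd(2)[OF u])
      finally show "pure X H (a i u) ((\<Sum>p<n. S (c k p) \<odot> c p i) \<odot> b u) =
          (\<Sum>p<n. pure X H (a i u) (S (c k p) \<odot> (c p i \<odot> b u)))"
        by (simp only:)
          (intro pure_sum_right[OF vspace_H] a_in[OF i u] mul_in antipode_in c_in k i Bd(2)[OF u])
    qed
    also have "\<dots> = (\<Sum>i<n. \<Sum>p<n. \<Sum>u<m. pure X H (a i u) (S (c k p) \<odot> (c p i \<odot> b u)))"
      by (intro sum.cong refl sum.swap)
    also have "\<dots> = (\<Sum>p<n. \<Sum>i<n. \<Sum>u<m. pure X H (a i u) (S (c k p) \<odot> (c p i \<odot> b u)))"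
      by (rule sum.swap)
    also have "\<dots> = (\<Sum>p<n. tmap X H id (\<lambda>h. S (c k p) \<odot> h) (\<Sum>i<n. \<Sum>u<m. pure X H (a i u) (c p i \<odot> b u)))"
    proof (rule sum.cong[OF refl])
      fix p assume p: "p \<in> ?I"
      let ?N = "tmap X H id (\<lambda>h. S (c k p) \<odot> h)"
      have "?N (\<Sum>i<n. \<Sum>u<m. pure X H (a i u) (c p i \<odot> b u)) =
          (\<Sum>i<n. \<Sum>u<m. ?N (pure X H (a i u) (c p i \<odot> b u)))"
        by (intro linear_map_sum2[OF linN[OF p] vspace_tensor vspace_tensor] pure_in a_in mul_in
            c_in Bd(2) p)
      then show "(\<Sum>i<n. \<Sum>u<m. pure X H (a i u) (S (c k p) \<odot> (c p i \<odot> b u))) =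
          ?N (\<Sum>i<n. \<Sum>u<m. pure X H (a i u) (c p i \<odot> b u))"
        by (simp only: N[OF p])
    qed
    also have "\<dots> = (\<Sum>p<n. \<Sum>q<n. pure X H (d p q) (S (c k p) \<odot> c q j))"
    proof (rule sum.cong[OF refl])
      fix p assume p: "p \<in> ?I"
      have "tmap X H id (\<lambda>h. S (c k p) \<odot> h) (\<Sum>q<n. pure X H (d p q) (c q j)) =
          (\<Sum>q<n. tmap X H id (\<lambda>h. S (c k p) \<odot> h) (pure X H (d p q) (c q j)))"
        by (rule linear_map_sum[OF linN[OF p] vspace_tensor vspace_tensor])
          (intro pure_in d_in c_in p j)
      then show "tmap X H id (\<lambda>h. S (c k p) \<odot> h) (\<Sum>i<n. \<Sum>u<m. pure X H (a i u) (c p i \<odot> b u)) =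
          (\<Sum>q<n. pure X H (d p q) (S (c k p) \<odot> c q j))"
        by (simp only: N[OF p] eq[OF p])
    qed
    finally show ?thesis .
  qed
  let ?V = "std_comod n c"
  let ?D = "dual_space ?V"
  let ?T = "?D \<otimes> ?V"
  let ?C = "coend_coalg H ?V"
  have mV: "has_matrix ?V ?I unit_vec (coord n) c" by (rule has_matrix_std[OF c])
  note MV = has_matrixD[OF mV]
  note BV = dual_basisD[OF MV(2)]
  have cd: "coord n i \<in> carrier ?D" for i by (simp add: dual_space_std coord_dual)
  have mC: "has_matrix ?C (?I \<times> ?I) (\<lambda>p. pure ?D ?V (coord n (fst p)) (unit_vec (snd p)))
    (\<lambda>p t. t (\<lambda>g v. g (unit_vec (fst p)) * coord n (snd p) v))
    (\<lambda>p q. S (c (fst q) (fst p)) \<odot> c (snd p) (snd q))"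
    using mV cd by (rule has_matrix_coend_coalg)
  note MC = has_matrixD[OF mC]
  note BC = dual_basisD[OF MC(2)]
  define F where "F i j = pure ?D ?V (coord n i) (unit_vec j)" for i j
  have F_in: "F i j \<in> carrier ?C" if "i \<in> ?I" "j \<in> ?I" for i j
    using BC(3)[of "(i, j)"] that by (simp add: F_def)
  \<comment> \<open>The linear extension of sending \<open>F i j\<close> to \<open>d i j\<close>,
    written with the coordinate functionals of the tensor basis.\<close>
  define h where "h t = (\<Sum>p\<in>?I\<times>?I. smult X (t (\<lambda>g v. g (unit_vec (fst p)) * coord n (snd p) v))
    (d (fst p) (snd p)))" for t :: "('k, (nat \<Rightarrow> 'k) \<Rightarrow> 'k, nat \<Rightarrow> 'k) tensor"
  have linh: "linear_map ?C X h"
    unfolding h_def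
    by (rule linear_map_sum_fun[OF VX], rule linear_map_smult_vec[OF VX BC(4)]) (auto simp: d_in)
  have hF: "h (F i j) = d i j" if "i \<in> ?I" "j \<in> ?I" for i j
  proof -
    have "h (F i j) = (\<Sum>p\<in>?I\<times>?I. if p = (i, j) then d (fst p) (snd p) else 0)"
      unfolding h_def F_def
      using BC(5)[of _ "(i, j)"] that
      by (intro sum.cong refl) (simp add: vspace_smult_simps[OF VX])
    then show ?thesis using that by simp
  qed
  have "comodule_map H ?C X h"
  proof (rule comodule_map_matrixI[OF mC VX linC linh])
    fix q assume "q \<in> ?I \<times> ?I"
    then obtain i j where q: "q = (i, j)" and ij: "i \<in> ?I" "j \<in> ?I" by auto
    have "?\<rho> (h (F i j)) = (\<Sum>a<n. \<Sum>b<n. pure X H (h (F a b)) (S (c i a) \<odot> c b j))"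
      using \<rho>d[OF ij] by (simp del: lessThan_iff add: hF ij)
    then show "?\<rho> (h (pure ?D ?V (coord n (fst q)) (unit_vec (snd q)))) =
      (\<Sum>p\<in>?I\<times>?I. pure X H (h (pure ?D ?V (coord n (fst p)) (unit_vec (snd p))))
        (S (c (fst q) (fst p)) \<odot> c (snd p) (snd q)))"
      by (simp only: q sum.cartesian_product' F_def fst_conv snd_conv)
  qed
  moreover have "?\<delta> (h t) = tmap X X h h (ccomult ?C t)" if t: "t \<in> carrier ?C" for t
  proof (rule dual_basis_linear_eq[OF MC(2,1) vspace_tensor linear_map_comp[OF linh linD] _ _ t])
    have "coalgebra ?C (ccomult ?C) (ccounit ?C)"
      using comodule_coalgebra_coend_coalg[OF mV cd] by (simp add: comodule_coalgebra_def)
    then have linCC: "linear_map ?C (?C \<otimes> ?C) (ccomult ?C)" by (simp add: coalgebra_def)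
    show "linear_map ?C (X \<otimes> X) (\<lambda>t. tmap X X h h (ccomult ?C t))"
      by (rule linear_map_comp[OF linCC linear_tmap[OF MC(1) linh linh]])
    fix q assume "q \<in> ?I \<times> ?I"
    then obtain i j where q: "q = (i, j)" and ij: "i \<in> ?I" "j \<in> ?I" by auto
    have "ccomult ?C (F i j) = (\<Sum>k<n. pure ?C ?C (F i k) (F k j))"
      unfolding F_def coend_coalg_simps coend_coalg_tensor_cong
      using MV(2,1) cd cd BV(3)[OF ij(2)] by (rule coend_comult_pure)
    then have "tmap X X h h (ccomult ?C (F i j)) = (\<Sum>k<n. pure X X (h (F i k)) (h (F k j)))"
      using tmap_sum_pure[OF MC(1) linh linh, of ?I "F i" "\<lambda>k. F k j"] F_in ij
      by (simp del: lessThan_iff)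
    also have "\<dots> = ?\<delta> (h (F i j))"
      by (simp del: lessThan_iff add: hF ij \<delta>d)
    finally show "?\<delta> (h (pure ?D ?V (coord n (fst q)) (unit_vec (snd q)))) =
        tmap X X h h (ccomult ?C (pure ?D ?V (coord n (fst q)) (unit_vec (snd q))))"
      by (simp only: q F_def fst_conv snd_conv)
  qed
  moreover have "ccounit X (h t) = ccounit ?C t" if t: "t \<in> carrier ?C" for t
  proof (rule dual_basis_linear_eq[OF MC(2,1) vspace_ground linear_map_comp[OF linh CX(5)] _ _ t])
    show "linear_map ?C ground (ccounit ?C)"
      using tensor_eval_linear_tensor[of ?D ?V] by (simp add: linear_map_def coend_coalg_simps)
    fix q assume "q \<in> ?I \<times> ?I"
    then obtain i j where q: "q = (i, j)" and ij: "i \<in> ?I" "j \<in> ?I" by auto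
    have "ccounit ?C (F i j) = (if i = j then 1 else 0)"
      using BV(5)[OF ij] by (simp add: F_def coend_coalg_simps pure_apply[OF bilinear_dual_pairing])
    then have "ccounit X (h (F i j)) = ccounit ?C (F i j)"
      by (simp only: hF[OF ij] \<epsilon>d[OF ij])
    then show "ccounit X (h (pure ?D ?V (coord n (fst q)) (unit_vec (snd q)))) =
        ccounit ?C (pure ?D ?V (coord n (fst q)) (unit_vec (snd q)))"
      by (simp only: q F_def fst_conv snd_conv)
  qed
  ultimately have map: "comodule_coalgebra_map H ?C X h"
    by (simp add: comodule_coalgebra_map_def)
  have "x \<in> h ` carrier ?C"
  proof (rule image_eqI)
    \<comment> \<open>The preimage comes from substituting the expansion \<open>y\<epsilon>\<close>
      of each \<open>y j\<close> into the expansion \<open>xy\<close> of \<open>x\<close>.\<close>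
    let ?r = "\<lambda>j i. smult ?C (f j x * ccounit X (y i)) (F i j)"
    have r_in: "?r j i \<in> carrier ?C" if "i \<in> ?I" "j \<in> ?I" for i j
      using that by (intro vspace_scale[OF MC(1)] F_in)
    show "(\<Sum>j<n. \<Sum>i<n. ?r j i) \<in> carrier ?C"
      by (intro vspace_sum[OF MC(1)] r_in)
    have "h (\<Sum>j<n. \<Sum>i<n. ?r j i) = (\<Sum>j<n. \<Sum>i<n. h (?r j i))"
      by (intro linear_map_sum2[OF linh MC(1) VX] r_in)
    also have "\<dots> = (\<Sum>j<n. \<Sum>i<n. smult X (f j x) (smult X (ccounit X (y i)) (d i j)))"
      by (intro sum.cong refl)
        (simp del: lessThan_iff add: linear_map_scale[OF linh] F_in hF vspace_smult_simps[OF VX])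
    also have "\<dots> = (\<Sum>j<n. smult X (f j x) (\<Sum>i<n. smult X (ccounit X (y i)) (d i j)))"
      by (simp only: vspace_smult_distrib[OF VX])
    also have "\<dots> = (\<Sum>j<n. smult X (f j x) (y j))"
      by (intro sum.cong refl arg_cong[where f = "smult X _"] y\<epsilon>[symmetric])
    also have "\<dots> = x" by (rule xy[symmetric])
    finally show "x = h (\<Sum>j<n. \<Sum>i<n. ?r j i)" ..
  qed
  then show ?thesis
    by (rule that[OF has_matrix_comodule[OF mV] has_matrix_fin_dim[OF mV] map])
qed

section \<open>The structures for an abstract finite dimensional comodule, and separation of
  parallel morphisms\<close>

lemma end_alg_coend_coalg_structure:
  assumes V: "comodule H V" and fin: "fin_dim V"
  shows "comodule_algebra H (end_alg H V)" "fin_dim (end_alg H V)"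
    "comodule_coalgebra H (coend_coalg H V)"
proof -
  obtain n :: nat and e f where b: "dual_basis V {..<n} e f"
    and f: "\<forall>i\<in>{..<n}. f i \<in> carrier (dual_space V)"
    by (rule dual_basis_exists[OF comoduleD(1)[OF V] fin])
  have f: "f i \<in> carrier (dual_space V)" if "i \<in> {..<n}" for i using f that by simp
  obtain c where m: "has_matrix V {..<n} e f c"
    by (rule comodule_has_matrix[OF V b])
  show "comodule_algebra H (end_alg H V)" using m f by (rule comodule_algebra_end_alg)
  show "comodule_coalgebra H (coend_coalg H V)" using m f by (rule comodule_coalgebra_coend_coalg)
  have "has_matrix (end_alg H V) ({..<n} \<times> {..<n}) (\<lambda>p. pure V (dual_space V) (e (fst p)) (f (snd p)))
    (\<lambda>p t. t (\<lambda>v g. f (fst p) v * g (e (snd p)))) (\<lambda>p q. c (fst p) (fst q) \<odot> S (c (snd q) (snd p)))"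
    using m f by (rule has_matrix_end_alg)
  then show "fin_dim (end_alg H V)" by (rule has_matrix_fin_dim)
qed

lemma end_alg_separates:
  fixes X :: "('k, 'x::ab_group_add, 'h) comod_alg" and Y :: "('k, 'y::ab_group_add, 'h) comod_alg"
  assumes Y: "comodule_algebra H Y" "fin_dim Y"
    and u: "comodule_algebra_map H X Y u" and v: "comodule_algebra_map H X Y v"
    and ne: "\<exists>x \<in> carrier X. u x \<noteq> v x"
  shows "\<exists>(V :: ('k, nat \<Rightarrow> 'k, 'h) comod) h. comodule H V \<and> fin_dim V \<and>
    comodule_algebra_map H Y (end_alg H V) h \<and> (\<exists>x \<in> carrier X. h (u x) \<noteq> h (v x))"
proof -
  obtain V :: "('k, nat \<Rightarrow> 'k, 'h) comod" and h where V: "comodule H V" "fin_dim V"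
    and h: "comodule_algebra_map H Y (end_alg H V) h" and inj: "inj_on h (carrier Y)"
    by (rule end_alg_cogenerates[OF Y])
  obtain x where x: "x \<in> carrier X" "u x \<noteq> v x" using ne by blast
  have "u x \<in> carrier Y" "v x \<in> carrier Y"
    using u v x(1) by (auto simp: comodule_algebra_map_def comodule_map_def linear_map_def)
  then have "h (u x) \<noteq> h (v x)" using inj x(2) by (auto dest: inj_onD)
  then show ?thesis using V h x(1) by blast
qed

lemma coend_coalg_separates:
  fixes X :: "('k, 'x::ab_group_add, 'h) comod_coalg"
  assumes X: "comodule_coalgebra H X" and ne: "\<exists>x \<in> carrier X. u x \<noteq> v x"
  shows "\<exists>(V :: ('k, nat \<Rightarrow> 'k, 'h) comod) h. comodule H V \<and> fin_dim V \<and>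
    comodule_coalgebra_map H (coend_coalg H V) X h \<and>
    (\<exists>g \<in> carrier (coend_coalg H V). u (h g) \<noteq> v (h g))"
proof -
  obtain x where x: "x \<in> carrier X" "u x \<noteq> v x" using ne by blast
  obtain V :: "('k, nat \<Rightarrow> 'k, 'h) comod" and h where V: "comodule H V" "fin_dim V"
    and h: "comodule_coalgebra_map H (coend_coalg H V) X h" and "x \<in> h ` carrier (coend_coalg H V)"
    by (rule coend_coalg_generates[OF X x(1)])
  then show ?thesis using x(2) by blast
qed

end

theorem theorem4p7:
  fixes H :: "('k::field, 'h::ab_group_add) hopf"
  assumes "hopf_algebra H"
  shows
    "(\<forall>V :: ('k, 'v::ab_group_add, 'h) comod.
        comodule H V \<and> fin_dim V \<longrightarrow>
          comodule_algebra H (end_alg H V) \<and> fin_dim (end_alg H V) \<and>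
          comodule_coalgebra H (coend_coalg H V))
     \<and>
     (\<forall>(X :: ('k, 'x::ab_group_add, 'h) comod_alg) (Y :: ('k, 'y::ab_group_add, 'h) comod_alg) u v.
        comodule_algebra H X \<and> fin_dim X \<and> comodule_algebra H Y \<and> fin_dim Y \<and>
        comodule_algebra_map H X Y u \<and> comodule_algebra_map H X Y v \<and>
        (\<exists>x \<in> carrier X. u x \<noteq> v x) \<longrightarrow>
          (\<exists>(V :: ('k, nat \<Rightarrow> 'k, 'h) comod) h.
             comodule H V \<and> fin_dim V \<and> comodule_algebra_map H Y (end_alg H V) h \<and>
             (\<exists>x \<in> carrier X. h (u x) \<noteq> h (v x))))
     \<and>
     (\<forall>(X :: ('k, 'x, 'h) comod_alg) (Y :: ('k, 'y, 'h) comod_alg) u v.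
        comodule_algebra H X \<and> comodule_algebra H Y \<and> fin_dim Y \<and>
        comodule_algebra_map H X Y u \<and> comodule_algebra_map H X Y v \<and>
        (\<exists>x \<in> carrier X. u x \<noteq> v x) \<longrightarrow>
          (\<exists>(V :: ('k, nat \<Rightarrow> 'k, 'h) comod) h.
             comodule H V \<and> fin_dim V \<and> comodule_algebra_map H Y (end_alg H V) h \<and>
             (\<exists>x \<in> carrier X. h (u x) \<noteq> h (v x))))
     \<and>
     (\<forall>(X :: ('k, 'x, 'h) comod_coalg) (Y :: ('k, 'y, 'h) comod_coalg) u v.
        comodule_coalgebra H X \<and> comodule_coalgebra H Y \<and>
        comodule_coalgebra_map H X Y u \<and> comodule_coalgebra_map H X Y v \<and>
        (\<exists>x \<in> carrier X. u x \<noteq> v x) \<longrightarrow>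
          (\<exists>(V :: ('k, nat \<Rightarrow> 'k, 'h) comod) h.
             comodule H V \<and> fin_dim V \<and> comodule_coalgebra_map H (coend_coalg H V) X h \<and>
             (\<exists>g \<in> carrier (coend_coalg H V). u (h g) \<noteq> v (h g))))"
proof -
  interpret hopf_alg H by (rule hopf_alg.intro[OF assms])
  \<comment> \<open>The lemma \<open>end_alg_separates\<close> settles both algebra statements, the
    one with finite dimensional source and the one with arbitrary source.\<close>
  show ?thesis
    by (intro conjI allI impI; elim conjE)
      (rule end_alg_coend_coalg_structure end_alg_separates coend_coalg_separates; assumption)+
qed

end
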